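(* Given any weak composition $\mathbf{a}=(a_1,\ldots,a_n)$ and any pair of positive integers $k\le n$ and $m$, there exists a weight-preserving bijection $$\mathrm{KD}(\mathbf{a})\times\mathrm{KD}(m\,\mathbf{e}_k)\ \xrightarrow{\ \sim\ }\ \mathcal{D}^{(m)}(\mathbf{a},k).$$
   Context: Fix a positive integer $n$. A weak composition is a sequence $\mathbf{a}=(a_1,\ldots,a_n)$ of nonnegative integers; $\mathbf{e}_k$ is the weak composition with a single nonzero part, equal to $1$, in position $k$; addition is coordinatewise, and $m\mathbf{e}_k$ has single nonzero part $m$ in position $k$. A diagram is a finite set of unit cells in the first quadrant; the cell in column $c$ and row $r$ ($c,r\ge1$, columns numbered left to right, rows bottom to top) is denoted $(c,r)$. The key diagram of $\mathbf{a}$ has cells $(c,r)$ with $1\le c\le a_r$. A Kohnert move on a diagram selects the rightmost cell of some row and moves it down within its column to the first unoccupied position below (in a row $\ge1$), if one exists, jumping over other cells as needed. $\mathrm{KD}(\mathbf{a})$ is the set of diagrams obtainable from the key diagram of $\mathbf{a}$ by a (possibly empty) sequence of Kohnert moves. For a diagram $T$, $\mathbf{wt}(T)$ is the weak composition whose $i$th part is the number of cells in row $i$; the weight of a pair is $\mathbf{wt}(S,T)=\mathbf{wt}(S)+\mathbf{wt}(T)$. A left swap on $\mathbf{a}$ exchanges two parts $a_i<a_j$ with $i<j$. The left swap order is the reflexive transitive closure of the relations $\mathbf{b}\preceq\mathbf{a}$ whenever $\mathbf{b}$ is a left swap of $\mathbf{a}$. Define $\mathcal{D}^{(m)}(\mathbf{a},k)=\bigcup_{\mathbf{b}}\mathrm{KD}(\mathbf{b})$,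 the union over all weak compositions $\mathbf{b}$ for which there is a sequence of weak compositions $\mathbf{b}^{(0)},\mathbf{b}^{(1)},\ldots,\mathbf{b}^{(m)}=\mathbf{b}$ and indices $1\le j_1,\ldots,j_m\le k$ such that (1) $\mathbf{b}^{(0)}\preceq\mathbf{a}$; (2) $\mathbf{b}^{(i)}\preceq\mathbf{b}^{(i-1)}+\mathbf{e}_{j_i}$ for each $1\le i\le m$; (3) the columns $b^{(i-1)}_{j_i}+1$, $1\le i\le m$, in which the cells are added are all distinct. *)

theory Defs
  imports "HOL-Library.Function_Algebras"
begin

text \<open>
  A weak composition of length \<open>n\<close> is a function with parts at the indices \<open>1, \<dots>, n\<close>, extended by
  zero. Addition of weak compositions is the pointwise addition of functions.
\<close>

definition weak_comps :: "nat \<Rightarrow> (nat \<Rightarrow> nat) set" where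
  "weak_comps n = {a. \<forall>i. i \<notin> {1..n} \<longrightarrow> a i = 0}"

definition single_part :: "nat \<Rightarrow> nat \<Rightarrow> nat \<Rightarrow> nat" where
  "single_part m k = (\<lambda>i. if i = k then m else 0)"

abbreviation unit_comp :: "nat \<Rightarrow> nat \<Rightarrow> nat" where
  "unit_comp k \<equiv> single_part 1 k"

text \<open>The cell in column \<open>c\<close> and row \<open>r\<close> is the pair \<open>(c, r)\<close>; rows increase upwards.\<close>

type_synonym cell = "nat \<times> nat"

definition diagram :: "cell set \<Rightarrow> bool" where
  "diagram T \<longleftrightarrow> finite T \<and> (\<forall>(c, r) \<in> T. 1 \<le> c \<and> 1 \<le> r)"

definition key_diagram :: "(nat \<Rightarrow> nat) \<Rightarrow> cell set" where
  "key_diagram a = {(c, r). 1 \<le> r \<and> 1 \<le> c \<and> c \<le> a r}"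

definition kohnert_move :: "cell set \<Rightarrow> cell set \<Rightarrow> bool" where
  "kohnert_move T T' \<longleftrightarrow>
     (\<exists>c r r'. (c, r) \<in> T \<and> (\<forall>c'. (c', r) \<in> T \<longrightarrow> c' \<le> c) \<and>
        1 \<le> r' \<and> r' < r \<and> (c, r') \<notin> T \<and> (\<forall>s. r' < s \<and> s < r \<longrightarrow> (c, s) \<in> T) \<and>
        T' = insert (c, r') (T - {(c, r)}))"

definition KD :: "(nat \<Rightarrow> nat) \<Rightarrow> cell set set" where
  "KD a = {T. kohnert_move\<^sup>*\<^sup>* (key_diagram a) T}"

definition wt :: "cell set \<Rightarrow> nat \<Rightarrow> nat" where
  "wt T = (\<lambda>i. card {c. (c, i) \<in> T})"

text \<open>\<open>left_swap n a b\<close>: the composition \<open>b\<close> is a left swap of \<open>a\<close>.\<close>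

definition left_swap :: "nat \<Rightarrow> (nat \<Rightarrow> nat) \<Rightarrow> (nat \<Rightarrow> nat) \<Rightarrow> bool" where
  "left_swap n a b \<longleftrightarrow>
     (\<exists>i j. 1 \<le> i \<and> i < j \<and> j \<le> n \<and> a i < a j \<and> b = a(i := a j, j := a i))"

text \<open>\<open>swap_le n b a\<close> is the left swap order \<open>b \<preceq> a\<close>; left swaps go down in this order.\<close>

definition swap_le :: "nat \<Rightarrow> (nat \<Rightarrow> nat) \<Rightarrow> (nat \<Rightarrow> nat) \<Rightarrow> bool" where
  "swap_le n b a \<longleftrightarrow> (left_swap n)\<^sup>*\<^sup>* a b"

definition pieri_comps :: "nat \<Rightarrow> nat \<Rightarrow> (nat \<Rightarrow> nat) \<Rightarrow> nat \<Rightarrow> (nat \<Rightarrow> nat) set" where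
  "pieri_comps n m a k =
     {b. \<exists>(bs :: nat \<Rightarrow> nat \<Rightarrow> nat) (j :: nat \<Rightarrow> nat).
           (\<forall>i \<in> {0..m}. bs i \<in> weak_comps n) \<and> bs m = b \<and>
           (\<forall>i \<in> {1..m}. 1 \<le> j i \<and> j i \<le> k) \<and>
           swap_le n (bs 0) a \<and>
           (\<forall>i \<in> {1..m}. swap_le n (bs i) (bs (i - 1) + unit_comp (j i))) \<and>
           inj_on (\<lambda>i. bs (i - 1) (j i) + 1) {1..m}}"

definition pieri_diagrams :: "nat \<Rightarrow> nat \<Rightarrow> (nat \<Rightarrow> nat) \<Rightarrow> nat \<Rightarrow> cell set set" where
  "pieri_diagrams n m a k = (\<Union>b \<in> pieri_comps n m a k. KD b)"

text \<open>
  Kohnert moves are defined on arbitrary sets of cells. The next lemmas show that only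
  diagrams occur in \<open>KD a\<close>, so that the cardinalities in \<open>wt\<close> are those of finite sets.
\<close>

lemma diagram_key_diagram:
  assumes "a \<in> weak_comps n"
  shows "diagram (key_diagram a)"
proof -
  have "key_diagram a \<subseteq> (\<Union>r \<in> {1..n}. {1..a r} \<times> {r})"
    using assms by (force simp: key_diagram_def weak_comps_def)
  then have "finite (key_diagram a)"
    by (rule finite_subset) auto
  then show ?thesis
    by (auto simp: diagram_def key_diagram_def)
qed

lemma diagram_kohnert_move:
  assumes "kohnert_move T T'" "diagram T"
  shows "diagram T'"
proof -
  obtain c r r' where "(c, r) \<in> T" "1 \<le> r'" and T': "T' = insert (c, r') (T - {(c, r)})"
    using assms(1) unfolding kohnert_move_def by blast
  moreover have "1 \<le> c"
    using \<open>(c, r) \<in> T\<close> assms(2) unfolding diagram_def by blast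
  ultimately show ?thesis
    using assms(2) unfolding diagram_def T' by simp
qed

lemma diagram_KD:
  assumes "a \<in> weak_comps n" "T \<in> KD a"
  shows "diagram T"
proof -
  have "kohnert_move\<^sup>*\<^sup>* (key_diagram a) T"
    using assms(2) by (simp add: KD_def)
  then show ?thesis
    by (induction rule: rtranclp_induct)
      (use assms(1) in \<open>auto intro: diagram_key_diagram diagram_kohnert_move\<close>)
qed

end

theory Submission
  imports Defs "HOL-Library.Infinite_Set" "HOL-Library.FuncSet"
begin

text \<open>
  Membership in \<open>KD a\<close> is a family of linear inequalities: the diagram \<open>T\<close> has the column heights of
  the key diagram of \<open>a\<close>, and every weakly decreasing path \<open>f\<close> that picks a column \<open>f r \<le> v\<close> in each
  row \<open>r \<le> i\<close> meets at least as many cells of \<open>T\<close> as there are parts \<open>a l \<ge> v\<close> with \<open>l \<le> i\<close>. Kohnert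
  moves preserve these inequalities, and a diagram satisfying them can be straightened to a key
  diagram by inverse moves. Since the left swap order is a comparison of the numbers of parts
  \<open>\<ge> v\<close> among the first \<open>i\<close>, the Pieri diagrams have the same description, with the bound for \<open>v\<close>
  raised by one from row \<open>k\<close> on for the columns \<open>v\<close> in some set \<open>S\<close> of size \<open>m\<close>.

  The case \<open>a = 0\<close> of this description is \<open>KD (single_part m k)\<close>, so both sides can be compared with
  \<open>KD a\<close> times the monomials of degree \<open>m\<close> in the first \<open>k\<close> variables. This is done by induction on
  the rows from the bottom: for a fixed diagram \<open>U\<close> above the lowest row, the admissible lowest rows
  are the lower sets of a relation on columns whose linked runs are intervals, the last of them
  infinite. Filling the last run one cell at a time accounts for the powers of the variable of that
  row, and the sets avoiding it correspond to the upper sets, which arise from first removing the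
  lowest row from \<open>a\<close>.
\<close>

section \<open>Path counts and Kohnert moves\<close>

text \<open>A diagram can lie in \<open>KD b\<close> for several admissible \<open>b\<close>, so
  nothing can be counted through \<open>b\<close>. The set \<open>S\<close>, in contrast, is
  determined by the column heights; this is why both sides are first rewritten without compositions.
  The induction then runs over arbitrary antitone supermodular demands: what is left of
  \<open>prefix_parts a\<close> after removing a row is simply \<open>residual\<close>, and need not
  be recognised as the count of a composition.

  In terms of generating functions, let \<open>D m\<close> be the weight sum of the diagrams above
  row \<open>j\<close> with \<open>m\<close> added cells, \<open>x\<close> the variable of row
  \<open>j + 1\<close>, and \<open>P m\<close> the sum over one removed row times the diagrams that
  remain above it. The comparison of lower and upper sets says that \<open>D m\<close> is the sum of
  \<open>x^t * P (m - t)\<close> over \<open>t \<le> m\<close>. For \<open>m = 0\<close> this is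
  \<open>D 0 = P 0\<close>, and the induction hypothesis turns \<open>P m\<close> into
  \<open>P 0\<close> times the complete homogeneous polynomial of degree \<open>m\<close> in the
  later variables. Together they make \<open>D m\<close> the product of \<open>D 0\<close> and the
  complete homogeneous polynomial in all variables from \<open>j + 1\<close> to
  \<open>k\<close>.\<close>

definition prefix_parts :: "(nat \<Rightarrow> nat) \<Rightarrow> nat \<Rightarrow> nat \<Rightarrow> nat" where
  "prefix_parts a v i = (\<Sum>l\<in>{0<..i}. of_bool (v \<le> a l))"

text \<open>A path is a total function, so that clamping, shifting and merging paths are pointwise
  operations; only its values on \<open>{j<..i}\<close> are ever counted.\<close>

definition staircase :: "nat \<Rightarrow> (nat \<Rightarrow> nat) \<Rightarrow> bool" where
  "staircase v f \<longleftrightarrow> antimono f \<and> (\<forall>r. 1 \<le> f r \<and> f r \<le> v)"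

definition path_count :: "cell set \<Rightarrow> (nat \<Rightarrow> nat) \<Rightarrow> nat \<Rightarrow> nat \<Rightarrow> nat" where
  "path_count T f j i = (\<Sum>r\<in>{j<..i}. of_bool ((f r, r) \<in> T))"

abbreviation col :: "cell set \<Rightarrow> nat \<Rightarrow> nat set" where
  "col T c \<equiv> {r. (c, r) \<in> T}"

definition meets :: "nat \<Rightarrow> cell set \<Rightarrow> (nat \<Rightarrow> nat \<Rightarrow> nat) \<Rightarrow> bool" where
  "meets n T d \<longleftrightarrow> (\<forall>v f i. staircase v f \<longrightarrow> i \<le> n \<longrightarrow> d v i \<le> path_count T f 0 i)"

definition in_rows :: "nat \<Rightarrow> nat \<Rightarrow> cell set \<Rightarrow> bool" where
  "in_rows j n T \<longleftrightarrow> finite T \<and> (\<forall>c r. (c, r) \<in> T \<longrightarrow> 1 \<le> c \<and> j < r \<and> r \<le> n)"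

lemma greaterThanAtMost_Suc_left: "j \<le> i \<Longrightarrow> {j<..Suc i} = insert (Suc i) {j<..i}"
  by auto

lemma prefix_parts_0 [simp]: "prefix_parts a v 0 = 0"
  by (simp add: prefix_parts_def)

lemma prefix_parts_Suc [simp]:
  "prefix_parts a v (Suc i) = prefix_parts a v i + of_bool (v \<le> a (Suc i))"
  by (simp add: prefix_parts_def greaterThanAtMost_Suc_left)

lemma prefix_parts_zero [simp]: "prefix_parts a 0 i = i"
  by (induction i) auto

lemma prefix_parts_antimono: "u \<le> v \<Longrightarrow> prefix_parts a v i \<le> prefix_parts a u i"
  by (induction i) auto

lemma prefix_parts_supermodular:
  assumes "u \<le> v" "i \<le> i'"
  shows "prefix_parts a u i + prefix_parts a v i' \<le> prefix_parts a u i' + prefix_parts a v i"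
  using assms(2) by (induction rule: dec_induct) (use assms(1) in auto)

lemma prefix_parts_cong:
  "(\<And>l. 0 < l \<Longrightarrow> l \<le> i \<Longrightarrow> a l = b l) \<Longrightarrow> prefix_parts a v i = prefix_parts b v i"
  by (simp add: prefix_parts_def)

lemma staircaseD:
  assumes "staircase v f"
  shows "antimono f" "r \<le> s \<Longrightarrow> f s \<le> f r" "1 \<le> f r" "f r \<le> v"
  using assms by (auto simp: staircase_def antimono_def)

lemma staircaseI:
  assumes "\<And>r s. r \<le> s \<Longrightarrow> f s \<le> f r" "\<And>r. 1 \<le> f r" "\<And>r. f r \<le> v"
  shows "staircase v f"
  using assms by (auto simp: staircase_def antimono_def)

lemma staircase_const: "1 \<le> u \<Longrightarrow> u \<le> v \<Longrightarrow> staircase v (\<lambda>_. u)"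
  by (auto intro: staircaseI)

lemma path_count_le:
  assumes "\<And>t. j < t \<Longrightarrow> t \<le> i \<Longrightarrow> (g t, t) \<in> T \<Longrightarrow> (f t, t) \<in> T'"
  shows "path_count T g j i \<le> path_count T' f j i"
  unfolding path_count_def by (rule sum_mono) (use assms in auto)

text \<open>For comparisons in which the new path may lose a cell in row \<open>r\<close>: the gain
  in row \<open>s\<close> pays for it.\<close>

lemma path_count_le_exchange:
  assumes "\<And>t. j < t \<Longrightarrow> t \<le> i \<Longrightarrow> t \<noteq> r \<Longrightarrow> t \<noteq> s \<Longrightarrow> (g t, t) \<in> T \<Longrightarrow> (f t, t) \<in> T'"
    and "j < r" "r \<le> i" "j < s" "s \<le> i" "r \<noteq> s"
    and "(g s, s) \<notin> T" "(f s, s) \<in> T'"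
  shows "path_count T g j i \<le> path_count T' f j i"
proof -
  have split: "path_count X h j i = of_bool ((h r, r) \<in> X) + (of_bool ((h s, s) \<in> X) +
      (\<Sum>t\<in>{j<..i} - {r} - {s}. of_bool ((h t, t) \<in> X)))" for X h
    unfolding path_count_def using assms(2-6)
    by (subst sum.remove[where x = r], simp, simp, subst sum.remove[where x = s], auto)
  have "(\<Sum>t\<in>{j<..i} - {r} - {s}. of_bool ((g t, t) \<in> T)) \<le>
        (\<Sum>t\<in>{j<..i} - {r} - {s}. (of_bool ((f t, t) \<in> T') :: nat))"
    by (rule sum_mono) (use assms in auto)
  then show ?thesis
    using assms(7,8) unfolding split by auto
qed

lemma path_count_const:
  assumes "in_rows j n T"
  shows "path_count T (\<lambda>_. c) j n = card (col T c)"
proof -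
  have "col T c = {j<..n} \<inter> {r. (c, r) \<in> T}"
    using assms by (auto simp: in_rows_def)
  then show ?thesis
    by (simp add: path_count_def sum.If_cases of_bool_def)
qed

lemma path_count_key_const:
  "1 \<le> v \<Longrightarrow> path_count (key_diagram b) (\<lambda>_. v) 0 i = prefix_parts b v i"
  unfolding path_count_def prefix_parts_def key_diagram_def by (rule sum.cong) auto

lemma in_rows_key_diagram:
  assumes "b \<in> weak_comps n"
  shows "in_rows 0 n (key_diagram b)"
proof -
  have "finite (key_diagram b)"
    using diagram_key_diagram[OF assms] by (simp add: diagram_def)
  moreover have "r \<le> n" if "1 \<le> c" "c \<le> b r" for c r
  proof (rule ccontr)
    assume "\<not> r \<le> n"
    then have "b r = 0" using assms by (simp add: weak_comps_def)
    then show False using that by simp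
  qed
  ultimately show ?thesis
    by (auto simp: in_rows_def key_diagram_def)
qed

section \<open>Path demands under Kohnert moves\<close>

lemma meets_key_diagram: "meets n (key_diagram b) (prefix_parts b)"
  unfolding meets_def
proof (intro allI impI)
  fix v f i assume f: "staircase v f"
  show "prefix_parts b v i \<le> path_count (key_diagram b) f 0 i"
    unfolding prefix_parts_def path_count_def
    by (rule sum_mono) (use staircaseD(3,4)[OF f] in \<open>auto simp: key_diagram_def intro: order_trans\<close>)
qed

text \<open>A path loses a cell only if it runs through \<open>(c, r)\<close>. It regains one if it
  is still in column \<open>c\<close> at row \<open>r'\<close>; otherwise it is compared with
  another path in \<open>T\<close>.\<close>

lemma meets_kohnert_move:
  assumes "kohnert_move T T'" "meets n T d"
  shows "meets n T' d"
  unfolding meets_def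
proof (intro allI impI)
  fix v f i assume f: "staircase v f" and i: "i \<le> n"
  obtain c r r' where c: "(c, r) \<in> T" "\<And>c'. (c', r) \<in> T \<Longrightarrow> c' \<le> c" "1 \<le> r'" "r' < r"
    "(c, r') \<notin> T" "\<And>s. r' < s \<Longrightarrow> s < r \<Longrightarrow> (c, s) \<in> T"
    and T': "T' = insert (c, r') (T - {(c, r)})"
    using assms(1) unfolding kohnert_move_def by blast
  show "d v i \<le> path_count T' f 0 i"
  proof (cases "f r = c \<and> r \<le> i")
    case False
    have "path_count T f 0 i \<le> path_count T' f 0 i"
      by (rule path_count_le) (use False in \<open>auto simp: T'\<close>)
    then show ?thesis
      using assms(2) f i unfolding meets_def by (meson order_trans)
  next
    case True
    show ?thesis
    proof (cases "f r' = c")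
      case True2: True
      have "path_count T f 0 i \<le> path_count T' f 0 i"
        by (rule path_count_le_exchange[of _ _ r r']) (use True True2 c in \<open>auto simp: T'\<close>)
      then show ?thesis
        using assms(2) f i unfolding meets_def by (meson order_trans)
    next
      case False
      \<comment> \<open>The path is pushed to column \<open>c + 1\<close> up to row
        \<open>r\<close>, where it meets nothing since \<open>(c, r)\<close> ends its row. Strictly
        between \<open>r'\<close> and \<open>r\<close>, column \<open>c\<close> is filled, so
        \<open>f\<close> meets a cell wherever it was pushed. The bound \<open>v\<close> still holds
        because \<open>c + 1 \<le> f r'\<close>.\<close>
      define g where "g s = (if s \<le> r then max (f s) (c + 1) else f s)" for s
      have fr': "f r' \<ge> c + 1"
        using False True staircaseD(2)[OF f, of r' r] c(4) by auto
      have g: "staircase v g"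
      proof (rule staircaseI)
        show "g s \<le> g r" if "r \<le> s" for r s
          using that staircaseD(2)[OF f, of r s] by (auto simp: g_def)
        show "g s \<le> v" for s
          using fr' staircaseD(4)[OF f, of r'] staircaseD(4)[OF f, of s] by (auto simp: g_def)
      qed (use staircaseD(3)[OF f] in \<open>auto simp: g_def le_max_iff_disj\<close>)
      have "path_count T g 0 i \<le> path_count T' f 0 i"
      proof (rule path_count_le)
        fix t assume t: "0 < t" "t \<le> i" "(g t, t) \<in> T"
        consider "t < r'" | "t = r'" | "r' < t" "t < r" | "t = r" | "r < t" by linarith
        then show "(f t, t) \<in> T'"
        proof cases
          case 1
          then have "f t \<ge> c + 1"
            using fr' staircaseD(2)[OF f, of t r'] by simp
          then show ?thesis using 1 t c(4) by (auto simp: g_def T')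
        next
          case 2
          then show ?thesis using fr' t c(4) by (auto simp: g_def T')
        next
          case 3
          then have "f t \<ge> c"
            using True staircaseD(2)[OF f, of t r] by simp
          then show ?thesis using 3 t c(6)[of t] by (cases "f t = c") (auto simp: g_def T')
        next
          case 4
          then have "g t = c + 1" using True by (simp add: g_def)
          then show ?thesis using 4 t c(2)[of "c + 1"] by auto
        next
          case 5
          then show ?thesis using t by (auto simp: g_def T')
        qed
      qed
      then show ?thesis
        using assms(2) g i unfolding meets_def by (meson order_trans)
    qed
  qed
qed

lemma in_rows_kohnert_move:
  assumes "kohnert_move T T'" "in_rows 0 n T"
  shows "in_rows 0 n T'"
proof -
  obtain c r r' where *: "(c, r) \<in> T" "1 \<le> r'" "r' < r" "T' = insert (c, r') (T - {(c, r)})"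
    using assms(1) unfolding kohnert_move_def by blast
  then have "1 \<le> c" "r \<le> n"
    using assms(2) unfolding in_rows_def by blast+
  moreover have "finite T'"
    using assms(2) *(4) by (simp add: in_rows_def)
  moreover have "1 \<le> x \<and> 0 < y \<and> y \<le> n" if "(x, y) \<in> T'" for x y
  proof -
    have "(x, y) \<in> T \<or> x = c \<and> y = r'"
      using that *(4) by auto
    then show ?thesis
      using assms(2) *(2,3) \<open>1 \<le> c\<close> \<open>r \<le> n\<close> unfolding in_rows_def by auto
  qed
  ultimately show ?thesis
    unfolding in_rows_def by blast
qed

lemma card_col_kohnert_move:
  assumes "kohnert_move T T'" "in_rows 0 n T"
  shows "card (col T' v) = card (col T v)"
proof -
  obtain c r r' where *: "(c, r) \<in> T" "(c, r') \<notin> T" "T' = insert (c, r') (T - {(c, r)})"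
    using assms(1) unfolding kohnert_move_def by blast
  have "finite ((\<lambda>r. (v, r)) -` T)"
    using assms(2) by (intro finite_vimageI) (auto simp: in_rows_def inj_def)
  then have fin: "finite (col T v)"
    by (simp add: vimage_def)
  show ?thesis
  proof (cases "v = c")
    case True
    have "col T' v = insert r' (col T v - {r})" "r' \<notin> col T v - {r}"
      using * True by auto
    then show ?thesis
      using fin * True card.remove[OF fin, of r] by simp
  qed (use * in auto)
qed

lemma kohnert_moves_invariants:
  assumes "kohnert_move\<^sup>*\<^sup>* T T'" "in_rows 0 n T"
  shows "in_rows 0 n T'" "card (col T' v) = card (col T v)" "meets n T d \<Longrightarrow> meets n T' d"
proof -
  have "in_rows 0 n T' \<and> card (col T' v) = card (col T v) \<and> (meets n T d \<longrightarrow> meets n T' d)"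
    using assms by (induction rule: rtranclp_induct)
      (auto dest: in_rows_kohnert_move meets_kohnert_move simp: card_col_kohnert_move)
  then show "in_rows 0 n T'" "card (col T' v) = card (col T v)" "meets n T d \<Longrightarrow> meets n T' d"
    by auto
qed

lemma KD_invariants:
  assumes "b \<in> weak_comps n" "T \<in> KD b"
  shows "in_rows 0 n T" "1 \<le> v \<Longrightarrow> card (col T v) = prefix_parts b v n" "meets n T (prefix_parts b)"
proof -
  note inv = kohnert_moves_invariants[OF _ in_rows_key_diagram[OF assms(1)]]
  have T: "kohnert_move\<^sup>*\<^sup>* (key_diagram b) T"
    using assms(2) by (simp add: KD_def)
  show "in_rows 0 n T" "meets n T (prefix_parts b)"
    using inv(1,3)[OF T] meets_key_diagram by auto
  show "card (col T v) = prefix_parts b v n" if "1 \<le> v"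
    using inv(2)[OF T, of v] path_count_const[OF in_rows_key_diagram[OF assms(1)], of v]
      path_count_key_const[OF that, of b n] by simp
qed

text \<open>A row in which the cell could stop early has all its cells further left, so the cell is
  again the last of its row there and can move on.\<close>

lemma kohnert_drop:
  assumes "(c, r) \<in> T" "\<And>c'. (c', r) \<in> T \<Longrightarrow> c' \<le> c" "1 \<le> r'" "r' < r" "(c, r') \<notin> T"
    and "\<And>s. r' < s \<Longrightarrow> s < r \<Longrightarrow> (c, s) \<in> T \<or> (\<forall>c'. (c', s) \<in> T \<longrightarrow> c' < c)"
  shows "kohnert_move\<^sup>*\<^sup>* T (insert (c, r') (T - {(c, r)}))"
  using assms
proof (induction r arbitrary: T rule: less_induct)
  case (less r)
  \<comment> \<open>\<open>q\<close> is the row in which a single Kohnert move lands.\<close>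
  define q where "q = Max {s. s < r \<and> (c, s) \<notin> T}"
  have fin: "finite {s. s < r \<and> (c, s) \<notin> T}" by simp
  have mem: "r' \<in> {s. s < r \<and> (c, s) \<notin> T}" using less.prems(4,5) by simp
  have "q \<in> {s. s < r \<and> (c, s) \<notin> T}"
    unfolding q_def using Max_in[OF fin] mem by blast
  moreover have "r' \<le> q"
    unfolding q_def using Max_ge[OF fin mem] .
  ultimately have q: "q < r" "(c, q) \<notin> T" "r' \<le> q"
    by simp_all
  have between: "(c, s) \<in> T" if "q < s" "s < r" for s
  proof (rule ccontr)
    assume "(c, s) \<notin> T"
    then have "s \<le> q" unfolding q_def using that(2) by (intro Max_ge[OF fin]) simp
    then show False using that(1) by simp
  qed
  define T1 where "T1 = insert (c, q) (T - {(c, r)})"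
  have step: "kohnert_move T T1"
    unfolding kohnert_move_def T1_def
    using less.prems(1,2) order_trans[OF less.prems(3) q(3)] q(1,2) between by blast
  show ?case
  proof (cases "q = r'")
    case True
    then show ?thesis using r_into_rtranclp[of kohnert_move, OF step] by (simp add: T1_def)
  next
    case False
    then have "r' < q" using q by linarith
    have below: "c' < c" if "(c', q) \<in> T" for c'
      using less.prems(6)[OF \<open>r' < q\<close> q(1)] q(2) that by blast
    have "kohnert_move\<^sup>*\<^sup>* T1 (insert (c, r') (T1 - {(c, q)}))"
    proof (rule less.IH[OF q(1)])
      show "(c, q) \<in> T1" by (simp add: T1_def)
      show "c' \<le> c" if "(c', q) \<in> T1" for c'
        using that below[of c'] q by (auto simp: T1_def)
      show "(c, s) \<in> T1 \<or> (\<forall>c'. (c', s) \<in> T1 \<longrightarrow> c' < c)" if "r' < s" "s < q" for s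
        using less.prems(6)[of s] that q by (auto simp: T1_def)
    qed (use less.prems(3-5) \<open>r' < q\<close> q in \<open>auto simp: T1_def\<close>)
    moreover have "insert (c, r') (T1 - {(c, q)}) = insert (c, r') (T - {(c, r)})"
      using q(1,2) less.prems(1) by (auto simp: T1_def)
    ultimately show ?thesis using converse_rtranclp_into_rtranclp[of kohnert_move, OF step] by simp
  qed
qed

text \<open>The cells are dropped from right to left, so that each is the last one of its row when it moves.\<close>
lemma kohnert_drop_segment:
  assumes seg: "\<And>x. (x, s) \<in> T \<Longrightarrow> x \<le> h"
    and "\<And>x. h < x \<Longrightarrow> x \<le> e \<Longrightarrow> (x, r) \<in> T" "1 \<le> r" "r < s" "h \<le> e"
    and "\<And>t x. r < t \<Longrightarrow> t < s \<Longrightarrow> h < x \<Longrightarrow> x \<le> e \<Longrightarrow>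
           (x, t) \<in> T \<or> (\<forall>x'. (x', t) \<in> T \<longrightarrow> x' < x)"
  shows "kohnert_move\<^sup>*\<^sup>* (T - {h<..e} \<times> {r} \<union> {h<..e} \<times> {s}) T"
  using \<open>h \<le> e\<close> assms(2,6)
proof (induction e rule: dec_induct)
  case base
  then show ?case by simp
next
  case (step y)
  let ?T = "\<lambda>y. T - {h<..y} \<times> {r} \<union> {h<..y} \<times> {s}"
  have eq: "insert (Suc y, r) (?T (Suc y) - {(Suc y, s)}) = ?T y"
  proof -
    have "(Suc y, r) \<in> T" "(Suc y, s) \<notin> T"
      using step.prems(1)[of "Suc y"] step.hyps seg[of "Suc y"] by auto
    moreover have "{h<..Suc y} = insert (Suc y) {h<..y}"
      using step.hyps by auto
    ultimately show ?thesis
      using \<open>r < s\<close> by auto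
  qed
  have "kohnert_move\<^sup>*\<^sup>* (?T (Suc y)) (insert (Suc y, r) (?T (Suc y) - {(Suc y, s)}))"
  proof (rule kohnert_drop)
    show "x \<le> Suc y" if "(x, s) \<in> ?T (Suc y)" for x
      using that seg[of x] step.hyps by auto
    show "(Suc y, t) \<in> ?T (Suc y) \<or> (\<forall>x. (x, t) \<in> ?T (Suc y) \<longrightarrow> x < Suc y)" if "r < t" "t < s" for t
      using step.prems(2)[of t "Suc y"] that step.hyps by auto
  qed (use \<open>1 \<le> r\<close> \<open>r < s\<close> step.hyps in auto)
  moreover have "kohnert_move\<^sup>*\<^sup>* (?T y) T"
    using step by (intro step.IH) auto
  ultimately show ?case unfolding eq by (rule rtranclp_trans)
qed

section \<open>The left swap order\<close>

text \<open>The two key diagrams differ by a segment of columns that changes rows. Every row in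
  between is an initial interval, so it either contains a given column or ends to its left, which is
  what \<open>kohnert_drop_segment\<close> asks for.\<close>

lemma kohnert_moves_left_swap:
  assumes "left_swap n a b"
  shows "kohnert_move\<^sup>*\<^sup>* (key_diagram a) (key_diagram b)"
proof -
  obtain i j where ij: "1 \<le> i" "i < j" "a i < a j" and b: "b = a(i := a j, j := a i)"
    using assms unfolding left_swap_def by blast
  have "kohnert_move\<^sup>*\<^sup>* (key_diagram b - {a i<..a j} \<times> {i} \<union> {a i<..a j} \<times> {j}) (key_diagram b)"
    by (rule kohnert_drop_segment) (use ij in \<open>auto simp: key_diagram_def b\<close>)
  moreover have "key_diagram b - {a i<..a j} \<times> {i} \<union> {a i<..a j} \<times> {j} = key_diagram a"
    using ij by (auto simp: key_diagram_def b split: if_splits)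
  ultimately show ?thesis by simp
qed

lemma KD_swap_le:
  assumes "swap_le n b a"
  shows "KD b \<subseteq> KD a"
proof -
  have "kohnert_move\<^sup>*\<^sup>* (key_diagram a) (key_diagram b)"
    using assms unfolding swap_le_def
    by (induction rule: rtranclp_induct) (auto dest: kohnert_moves_left_swap)
  then show ?thesis
    unfolding KD_def by (auto intro: rtranclp_trans)
qed

lemma prefix_parts_swap:
  assumes "p < q" "b q < b p" "0 < p"
  shows "prefix_parts (b(p := b q, q := b p)) v i + of_bool (p \<le> i \<and> i < q \<and> b q < v \<and> v \<le> b p) =
    prefix_parts b v i"
proof (induction i)
  case (Suc i)
  consider "Suc i < p" | "Suc i = p" | "p < Suc i" "Suc i < q" | "Suc i = q" | "q < Suc i"
    by linarith
  then show ?case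
    using Suc assms by cases (auto simp: of_bool_def split: if_splits)
qed (use assms in simp)

lemma prefix_parts_left_swap:
  assumes "left_swap n a b"
  shows "prefix_parts a v i \<le> prefix_parts b v i" "prefix_parts b v n = prefix_parts a v n"
proof -
  obtain i' j where ij: "1 \<le> i'" "i' < j" "j \<le> n" "a i' < a j" and b: "b = a(i' := a j, j := a i')"
    using assms unfolding left_swap_def by blast
  have "a = b(i' := b j, j := b i')" using b ij by (auto simp: fun_eq_iff)
  then have *: "prefix_parts a v l + of_bool (i' \<le> l \<and> l < j \<and> b j < v \<and> v \<le> b i') = prefix_parts b v l" for l
    using prefix_parts_swap[of i' j b v l] ij b by simp
  show "prefix_parts a v i \<le> prefix_parts b v i" using *[of i] by linarith
  show "prefix_parts b v n = prefix_parts a v n" using *[of n] ij by simp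
qed

lemma prefix_parts_swap_le:
  assumes "swap_le n b a"
  shows "prefix_parts a v i \<le> prefix_parts b v i" "prefix_parts b v n = prefix_parts a v n"
proof -
  have "prefix_parts a v i \<le> prefix_parts b v i \<and> prefix_parts b v n = prefix_parts a v n"
    using assms unfolding swap_le_def
    by (induction rule: rtranclp_induct) (use prefix_parts_left_swap in \<open>fastforce intro: order_trans\<close>)+
  then show "prefix_parts a v i \<le> prefix_parts b v i" "prefix_parts b v n = prefix_parts a v n"
    by auto
qed

lemma swap_le_refl [simp]: "swap_le n a a"
  by (simp add: swap_le_def)

lemma swap_le_trans: "swap_le n c b \<Longrightarrow> swap_le n b a \<Longrightarrow> swap_le n c a"
  unfolding swap_le_def by (rule rtranclp_trans)

lemma weak_comps_swap:
  assumes "b \<in> weak_comps n" "p \<in> {1..n}" "q \<in> {1..n}"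
  shows "b(p := x, q := y) \<in> weak_comps n"
  using assms by (auto simp: weak_comps_def)

lemma prefix_parts_interval:
  assumes "p \<le> i" "1 \<le> p" "\<And>l. p \<le> l \<Longrightarrow> l \<le> i \<Longrightarrow> u \<le> b l \<longleftrightarrow> v \<le> b l"
  shows "prefix_parts b u i + prefix_parts b v (p - 1) = prefix_parts b v i + prefix_parts b u (p - 1)"
  using assms
proof (induction rule: dec_induct)
  case base
  then show ?case by (cases p) auto
qed auto

text \<open>A single part that is too large for the demand \<open>d\<close> is brought down to \<open>c\<close> by repeatedly
  exchanging it with the next part to its right that lies between \<open>c\<close> and it.\<close>
lemma reduce_part:
  assumes "b \<in> weak_comps n" "1 \<le> p" "p \<le> n" "c \<le> b p"
    and "\<And>v i. 1 \<le> v \<Longrightarrow> i \<le> n \<Longrightarrow> d v i \<le> prefix_parts b v i"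
    and "\<And>v i. c < v \<Longrightarrow> p \<le> i \<Longrightarrow> i \<le> n \<Longrightarrow>
           d v i + prefix_parts b c (p - 1) < prefix_parts b v (p - 1) + prefix_parts b c i"
    and "\<And>v. c < v \<Longrightarrow> prefix_parts b v n \<le> d v n"
  shows "\<exists>b'. b' \<in> weak_comps n \<and> swap_le n b b' \<and> b' p = c \<and> (\<forall>l<p. b' l = b l) \<and>
    (\<forall>v i. 1 \<le> v \<longrightarrow> i \<le> n \<longrightarrow> d v i \<le> prefix_parts b' v i) \<and>
    (\<forall>i. prefix_parts b' c i = prefix_parts b c i)"
  using assms
proof (induction "b p" arbitrary: b rule: less_induct)
  case less
  note prems = less.prems
  show ?case
  proof (cases "b p = c")
    case True
    then show ?thesis using prems by (intro exI[of _ b]) auto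
  next
    case False
    then have c: "c < b p" using prems(4) by simp
    let ?P = "\<lambda>q. p < q \<and> q \<le> n \<and> c \<le> b q \<and> b q < b p"
    have "\<exists>q. ?P q"
    proof (rule ccontr)
      \<comment> \<open>Otherwise the parts from \<open>p\<close> on that are at least
        \<open>c\<close> are exactly those at least \<open>b p\<close>. The strict inequality at
        \<open>i = n\<close> then yields \<open>d (b p) n < prefix_parts b (b p) n\<close>, against
        the last hypothesis.\<close>
      assume none: "\<nexists>q. ?P q"
      have "prefix_parts b c n + prefix_parts b (b p) (p - 1) =
          prefix_parts b (b p) n + prefix_parts b c (p - 1)"
      proof (rule prefix_parts_interval)
        show "c \<le> b l \<longleftrightarrow> b p \<le> b l" if "p \<le> l" "l \<le> n" for l
          using none that c by (cases "l = p") (auto simp: not_less)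
      qed (use prems in auto)
      then show False
        using prems(6)[OF c, of n] prems(7)[OF c] prems(3) by linarith
    qed
    define q where "q = (LEAST q. ?P q)"
    have q: "p < q" "q \<le> n" "c \<le> b q" "b q < b p"
      using LeastI_ex[OF \<open>\<exists>q. ?P q\<close>] unfolding q_def by auto
    have before: "\<not> ?P l" if "l < q" for l
      using not_less_Least that unfolding q_def by blast
    define b1 where "b1 = b(p := b q, q := b p)"
    have b1: "prefix_parts b1 v i + of_bool (p \<le> i \<and> i < q \<and> b q < v \<and> v \<le> b p) = prefix_parts b v i"
      for v i
      unfolding b1_def using q prems(2) by (intro prefix_parts_swap) auto
    have b1c: "prefix_parts b1 c i = prefix_parts b c i" for i
      using b1[of c i] q by simp
    have "left_swap n b1 b"
      unfolding left_swap_def using q prems(2)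
      by (intro exI[of _ p] exI[of _ q]) (auto simp: b1_def fun_eq_iff)
    then have swap: "swap_le n b b1"
      by (auto simp: swap_le_def)
    have "\<exists>b'. b' \<in> weak_comps n \<and> swap_le n b1 b' \<and> b' p = c \<and> (\<forall>l<p. b' l = b1 l) \<and>
      (\<forall>v i. 1 \<le> v \<longrightarrow> i \<le> n \<longrightarrow> d v i \<le> prefix_parts b' v i) \<and>
      (\<forall>i. prefix_parts b' c i = prefix_parts b1 c i)"
    proof (rule less.hyps)
      show "b1 p < b p" "c \<le> b1 p" using q by (auto simp: b1_def)
      show "b1 \<in> weak_comps n"
        unfolding b1_def using prems(1-3) q by (intro weak_comps_swap) auto
      show "d v i \<le> prefix_parts b1 v i" if "1 \<le> v" "i \<le> n" for v i
      proof (cases "p \<le> i \<and> i < q \<and> b q < v \<and> v \<le> b p")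
        case True
        \<comment> \<open>Here the exchange lowers the count by one. As \<open>q\<close> is the
          first candidate, the parts in \<open>{p..i}\<close> that are at least \<open>c\<close>
          coincide with those at least \<open>v\<close>, so the strict inequality provides the
          missing unit.\<close>
        have "prefix_parts b c i + prefix_parts b v (p - 1) = prefix_parts b v i + prefix_parts b c (p - 1)"
        proof (rule prefix_parts_interval)
          show "c \<le> b l \<longleftrightarrow> v \<le> b l" if "p \<le> l" "l \<le> i" for l
            using before[of l] that True q by (cases "l = p") auto
        qed (use prems True in auto)
        then have "d v i < prefix_parts b v i"
          using prems(6)[of v i] True that q by linarith
        then show ?thesis using b1[of v i] by (auto simp: of_bool_def split: if_splits)
      next
        case False
        then show ?thesis using b1[of v i] prems(5)[OF that] by auto
      qed
      show "d v i + prefix_parts b1 c (p - 1) < prefix_parts b1 v (p - 1) + prefix_parts b1 c i"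
        if "c < v" "p \<le> i" "i \<le> n" for v i
        using prems(6)[OF that] b1[of v "p - 1"] prems(2) by (cases p) (auto simp: b1c)
      show "prefix_parts b1 v n \<le> d v n" if "c < v" for v
        using prems(7)[OF that] b1[of v n] by linarith
    qed (use prems in auto)
    then obtain b' where b': "b' \<in> weak_comps n" "swap_le n b1 b'" "b' p = c" "\<forall>l<p. b' l = b1 l"
      "\<forall>v i. 1 \<le> v \<longrightarrow> i \<le> n \<longrightarrow> d v i \<le> prefix_parts b' v i"
      "\<forall>i. prefix_parts b' c i = prefix_parts b1 c i"
      by blast
    moreover have "\<forall>l<p. b' l = b l"
      using b'(4) q by (auto simp: b1_def)
    ultimately show ?thesis
      using swap_le_trans[OF swap b'(2)] b1c by auto
  qed
qed

lemma prefix_parts_gain: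
  assumes "1 \<le> p" "p \<le> i" "a p = c" "c < v"
  shows "prefix_parts a v i + prefix_parts a c (p - 1) < prefix_parts a v (p - 1) + prefix_parts a c i"
  using assms(2)
proof (induction rule: dec_induct)
  case base
  show ?case using assms by (cases p) auto
qed (use assms in auto)

text \<open>Positions are settled from left to right. Once \<open>b\<close> and \<open>a\<close>
  agree before \<open>p\<close>, domination at row \<open>p\<close> forces
  \<open>a p \<le> b p\<close>, and \<open>reduce_part\<close> with demand
  \<open>prefix_parts a\<close> undoes swaps until part \<open>p\<close> equals \<open>a p\<close>.
  Domination survives, so the argument continues at \<open>Suc p\<close>.\<close>

lemma swap_leI:
  assumes "a \<in> weak_comps n" "b \<in> weak_comps n"
    and "\<And>v i. 1 \<le> v \<Longrightarrow> i \<le> n \<Longrightarrow> prefix_parts a v i \<le> prefix_parts b v i"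
    and "\<And>v. 1 \<le> v \<Longrightarrow> prefix_parts b v n \<le> prefix_parts a v n"
  shows "swap_le n b a"
proof -
  have "swap_le n b a"
    if "p \<le> Suc n" "b \<in> weak_comps n" "\<And>l. 1 \<le> l \<Longrightarrow> l < p \<Longrightarrow> b l = a l" "1 \<le> p"
      "\<And>v i. 1 \<le> v \<Longrightarrow> i \<le> n \<Longrightarrow> prefix_parts a v i \<le> prefix_parts b v i"
      "\<And>v. 1 \<le> v \<Longrightarrow> prefix_parts b v n \<le> prefix_parts a v n" for p
    using that
  proof (induction arbitrary: b rule: inc_induct)
    case base
    have "b l = a l" for l
      using base(2)[of l] base(1) assms(1) by (cases "l \<in> {1..n}") (auto simp: weak_comps_def)
    then have "b = a" by auto
    then show ?case by simp
  next
    case (step p)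
    have eq: "prefix_parts b v (p - 1) = prefix_parts a v (p - 1)" for v
      by (rule prefix_parts_cong) (use step.prems(2) in auto)
    have p: "p \<le> n" "p = Suc (p - 1)" using step.hyps step.prems(3) by auto
    have "a p \<le> b p"
    proof (cases "a p = 0")
      case False
      then have "prefix_parts a (a p) p \<le> prefix_parts b (a p) p"
        using step.prems(4)[of "a p" p] p by simp
      then show ?thesis using eq[of "a p"] p(2) by (cases p) (auto simp: of_bool_def split: if_splits)
    qed simp
    have "\<exists>b'. b' \<in> weak_comps n \<and> swap_le n b b' \<and> b' p = a p \<and> (\<forall>l<p. b' l = b l) \<and>
      (\<forall>v i. 1 \<le> v \<longrightarrow> i \<le> n \<longrightarrow> prefix_parts a v i \<le> prefix_parts b' v i) \<and>
      (\<forall>i. prefix_parts b' (a p) i = prefix_parts b (a p) i)"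
    proof (rule reduce_part)
      show "prefix_parts a v i + prefix_parts b (a p) (p - 1) <
          prefix_parts b v (p - 1) + prefix_parts b (a p) i" if "a p < v" "p \<le> i" "i \<le> n" for v i
      proof -
        have "prefix_parts a (a p) i \<le> prefix_parts b (a p) i"
          using step.prems(4)[of "a p" i] that(3) by (cases "a p = 0") auto
        then show ?thesis
          using prefix_parts_gain[of p i a "a p" v] that step.prems(3) eq[of v] eq[of "a p"] by linarith
      qed
    qed (use step.prems p \<open>a p \<le> b p\<close> in auto)
    then obtain b' where b': "b' \<in> weak_comps n" "swap_le n b b'" "b' p = a p" "\<forall>l<p. b' l = b l"
      "\<And>v i. 1 \<le> v \<Longrightarrow> i \<le> n \<Longrightarrow> prefix_parts a v i \<le> prefix_parts b' v i"
      by blast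
    have "swap_le n b' a"
    proof (rule step.IH[OF b'(1)])
      show "b' l = a l" if "1 \<le> l" "l < Suc p" for l
        using that b'(3,4) step.prems(2)[of l] by (cases "l = p") auto
      show "prefix_parts b' v n \<le> prefix_parts a v n" if "1 \<le> v" for v
        using step.prems(5)[OF that] prefix_parts_swap_le(2)[OF b'(2), of v] by simp
    qed (use b'(5) in auto)
    then show ?case using b'(2) swap_le_trans by blast
  qed
  from this[of 1] show ?thesis using assms by auto
qed

section \<open>Chains of added cells and their columns\<close>

lemma prefix_parts_add_unit:
  assumes "1 \<le> j"
  shows "prefix_parts (a + unit_comp j) v i = prefix_parts a v i + of_bool (v = a j + 1 \<and> j \<le> i)"
  using assms by (induction i) (auto simp: single_part_def plus_fun_def le_Suc_eq of_bool_def)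

text \<open>A cell added in a row \<open>j \<le> k\<close> raises the count of its column from row
  \<open>j\<close> on, hence from row \<open>k\<close> on; swaps only raise prefix counts and
  preserve totals. Since the columns are distinct, no count is raised twice, and \<open>S\<close> is
  the set of these columns.\<close>

lemma prefix_parts_pieri_comps:
  assumes "b \<in> pieri_comps n m a k" "k \<le> n"
  obtains S where "finite S" "0 \<notin> S" "card S = m"
    "\<And>v i. i \<le> n \<Longrightarrow> prefix_parts a v i + of_bool (v \<in> S \<and> k \<le> i) \<le> prefix_parts b v i"
    "\<And>v. prefix_parts b v n = prefix_parts a v n + of_bool (v \<in> S)"
proof -
  obtain bs j where bs: "bs m = b" "\<forall>i\<in>{1..m}. 1 \<le> j i \<and> j i \<le> k"
    "swap_le n (bs 0) a" "\<forall>i\<in>{1..m}. swap_le n (bs i) (bs (i - 1) + unit_comp (j i))"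
    "inj_on (\<lambda>i. bs (i - 1) (j i) + 1) {1..m}"
    using assms(1) unfolding pieri_comps_def mem_Collect_eq by (elim exE conjE)
  define S where "S l = (\<lambda>i. bs (i - 1) (j i) + 1) ` {1..l}" for l
  have "(\<forall>v i. i \<le> n \<longrightarrow> prefix_parts a v i + of_bool (v \<in> S l \<and> k \<le> i) \<le> prefix_parts (bs l) v i) \<and>
      (\<forall>v. prefix_parts (bs l) v n = prefix_parts a v n + of_bool (v \<in> S l))" if "l \<le> m" for l
    using that
  proof (induction l)
    case 0
    then show ?case using prefix_parts_swap_le[OF bs(3)] by (simp add: S_def)
  next
    case (Suc l)
    define c where "c = bs l (j (Suc l)) + 1"
    have S: "S (Suc l) = insert c (S l)"
      by (auto simp: S_def c_def atLeastAtMostSuc_conv)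
    have "c \<notin> S l"
    proof
      assume "c \<in> S l"
      then obtain i where i: "i \<in> {1..l}" "c = bs (i - 1) (j i) + 1" by (auto simp: S_def)
      have "i = Suc l"
        by (rule inj_onD[OF bs(5)]) (use i Suc.prems in \<open>auto simp: c_def\<close>)
      then show False using i by simp
    qed
    have l: "Suc l \<in> {1..m}" using Suc.prems by simp
    note sw = prefix_parts_swap_le[OF bs(4)[rule_format, OF l]]
    have j: "1 \<le> j (Suc l)" "j (Suc l) \<le> k" using bs(2)[rule_format, OF l] by auto
    have add: "prefix_parts (bs l + unit_comp (j (Suc l))) v i =
        prefix_parts (bs l) v i + of_bool (v = c \<and> j (Suc l) \<le> i)" for v i
      unfolding c_def by (rule prefix_parts_add_unit) (use j in simp)
    show ?case
    proof (intro conjI allI impI)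
      fix v i assume "i \<le> n"
      then have "prefix_parts a v i + of_bool (v \<in> S l \<and> k \<le> i) \<le> prefix_parts (bs l) v i"
        using Suc by auto
      moreover have "prefix_parts (bs l) v i + of_bool (v = c \<and> j (Suc l) \<le> i) \<le> prefix_parts (bs (Suc l)) v i"
        using sw(1)[of v i] unfolding diff_Suc_1 add .
      ultimately show "prefix_parts a v i + of_bool (v \<in> S (Suc l) \<and> k \<le> i) \<le> prefix_parts (bs (Suc l)) v i"
        using \<open>c \<notin> S l\<close> j by (auto simp: S of_bool_def split: if_splits)
    next
      fix v
      have "prefix_parts (bs (Suc l)) v n = prefix_parts (bs l) v n + of_bool (v = c)"
        using sw(2)[of v] j assms(2) unfolding diff_Suc_1 add by simp
      then show "prefix_parts (bs (Suc l)) v n = prefix_parts a v n + of_bool (v \<in> S (Suc l))"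
        using Suc \<open>c \<notin> S l\<close> by (auto simp: S)
    qed
  qed
  moreover have "card (S m) = m"
    unfolding S_def by (subst card_image[OF bs(5)]) simp
  ultimately show thesis
    using that[of "S m"] bs(1) by (auto simp: S_def)
qed

text \<open>The chain is undone from its end, the largest column being the last one added. Columns
  beyond it carry no extra demand, so the strict inequality needed by \<open>reduce_part\<close>
  follows from supermodularity of the prefix counts of \<open>a\<close> and the slack in column
  \<open>c\<close>.\<close>

lemma in_pieri_comps_columns:
  assumes "finite S" "0 \<notin> S" "a \<in> weak_comps n" "b \<in> weak_comps n" "1 \<le> k" "k \<le> n"
    and "\<And>v i. 1 \<le> v \<Longrightarrow> i \<le> n \<Longrightarrow> prefix_parts a v i + of_bool (v \<in> S \<and> k \<le> i) \<le> prefix_parts b v i"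
    and "\<And>v. 1 \<le> v \<Longrightarrow> prefix_parts b v n \<le> prefix_parts a v n + of_bool (v \<in> S)"
  shows "\<exists>bs j. (\<forall>i\<le>card S. bs i \<in> weak_comps n) \<and> bs (card S) = b \<and>
    (\<forall>i\<in>{1..card S}. 1 \<le> j i \<and> j i \<le> k) \<and> swap_le n (bs 0) a \<and>
    (\<forall>i\<in>{1..card S}. swap_le n (bs i) (bs (i - 1) + unit_comp (j i))) \<and>
    bij_betw (\<lambda>i. bs (i - 1) (j i) + 1) {1..card S} S"
  using assms(1,2,4,7,8)
proof (induction S arbitrary: b rule: finite_linorder_max_induct)
  case empty
  have "swap_le n b a" by (rule swap_leI) (use empty assms in auto)
  then show ?case using empty by (intro exI[of _ "\<lambda>_. b"] exI[of _ "\<lambda>_. 1"]) (auto simp: bij_betw_def)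
next
  case (insert c S)
  have c: "c \<notin> S" "1 \<le> c" using insert by (auto simp: Suc_le_eq intro: gr0I)
  have card: "card (insert c S) = Suc (card S)" using insert c by simp
  \<comment> \<open>After \<open>i0\<close> the count of \<open>b\<close> for column
    \<open>c\<close> stays strictly above that of \<open>a\<close>: before row \<open>k\<close> by
    maximality, from row \<open>k\<close> on by the extra demand. So a cell of column
    \<open>c\<close> can be taken away in row \<open>Suc i0\<close>, which is at most
    \<open>k\<close>.\<close>
  define i0 where "i0 = Max {i. i < k \<and> prefix_parts b c i = prefix_parts a c i}"
  have fin: "finite {i. i < k \<and> prefix_parts b c i = prefix_parts a c i}" by simp
  have "0 \<in> {i. i < k \<and> prefix_parts b c i = prefix_parts a c i}"
    using assms(5) by simp
  then have "i0 \<in> {i. i < k \<and> prefix_parts b c i = prefix_parts a c i}"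
    unfolding i0_def using Max_in[OF fin] by blast
  then have i0: "i0 < k" "prefix_parts b c i0 = prefix_parts a c i0" by auto
  have slack: "prefix_parts a c i < prefix_parts b c i" if "i0 < i" "i \<le> n" for i
  proof (cases "i < k")
    case True
    have "prefix_parts b c i \<noteq> prefix_parts a c i"
    proof
      assume "prefix_parts b c i = prefix_parts a c i"
      then have "i \<le> i0" unfolding i0_def using True by (intro Max_ge[OF fin]) simp
      then show False using that by simp
    qed
    then show ?thesis using insert.prems(3)[of c i] that c by simp
  next
    case False
    then show ?thesis using insert.prems(3)[of c i] that c by simp
  qed
  define p where "p = Suc i0"
  have p: "1 \<le> p" "p \<le> k" "p \<le> n" using i0 assms(6) by (auto simp: p_def)
  have "c \<le> b p"
    using slack[of p] i0 p by (auto simp: p_def of_bool_def split: if_splits)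
  have nS: "v \<notin> insert c S" if "c < v" for v
    using insert.hyps(2) that by fastforce
  have "\<exists>b'. b' \<in> weak_comps n \<and> swap_le n b b' \<and> b' p = c \<and> (\<forall>l<p. b' l = b l) \<and>
    (\<forall>v i. 1 \<le> v \<longrightarrow> i \<le> n \<longrightarrow> prefix_parts a v i + of_bool (v \<in> insert c S \<and> k \<le> i) \<le> prefix_parts b' v i) \<and>
    (\<forall>i. prefix_parts b' c i = prefix_parts b c i)"
  proof (rule reduce_part)
    show "prefix_parts a v i + of_bool (v \<in> insert c S \<and> k \<le> i) + prefix_parts b c (p - 1)
        < prefix_parts b v (p - 1) + prefix_parts b c i" if "c < v" "p \<le> i" "i \<le> n" for v i
    proof -
      have "prefix_parts a v i0 \<le> prefix_parts b v i0"
        using insert.prems(3)[of v i0] that i0 assms(6) by simp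
      moreover have "prefix_parts a v i + prefix_parts a c i0 \<le> prefix_parts a v i0 + prefix_parts a c i"
        using prefix_parts_supermodular[of c v i0 i a] that by (simp add: p_def)
      moreover have "prefix_parts a c i < prefix_parts b c i"
        using slack[of i] that by (simp add: p_def)
      ultimately show ?thesis using nS[OF that(1)] i0 by (simp add: p_def)
    qed
    show "prefix_parts b v n \<le> prefix_parts a v n + of_bool (v \<in> insert c S \<and> k \<le> n)" if "c < v" for v
      using insert.prems(4)[of v] that nS[OF that] by simp
  qed (use insert.prems p \<open>c \<le> b p\<close> in auto)
  then obtain b' where b': "b' \<in> weak_comps n" "swap_le n b b'" "b' p = c"
    "\<And>v i. 1 \<le> v \<Longrightarrow> i \<le> n \<Longrightarrow> prefix_parts a v i + of_bool (v \<in> insert c S \<and> k \<le> i) \<le> prefix_parts b' v i"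
    "\<And>i. prefix_parts b' c i = prefix_parts b c i"
    by blast
  define b1 where "b1 = b'(p := c - 1)"
  have b1: "b1 + unit_comp p = b'"
    using b'(3) c by (auto simp: b1_def single_part_def plus_fun_def fun_eq_iff)
  have b1p: "b1 p + 1 = c" using c by (simp add: b1_def)
  have cnt: "prefix_parts b1 v i + of_bool (v = c \<and> p \<le> i) = prefix_parts b' v i" for v i
    using prefix_parts_add_unit[OF p(1), of b1 v i] b1p unfolding b1 by simp
  have "\<exists>bs j. (\<forall>i\<le>card S. bs i \<in> weak_comps n) \<and> bs (card S) = b1 \<and>
    (\<forall>i\<in>{1..card S}. 1 \<le> j i \<and> j i \<le> k) \<and> swap_le n (bs 0) a \<and>
    (\<forall>i\<in>{1..card S}. swap_le n (bs i) (bs (i - 1) + unit_comp (j i))) \<and>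
    bij_betw (\<lambda>i. bs (i - 1) (j i) + 1) {1..card S} S"
  proof (rule insert.IH)
    show "0 \<notin> S" using insert.prems by simp
    show "b1 \<in> weak_comps n" using b'(1) p by (auto simp: b1_def weak_comps_def)
    show "prefix_parts a v i + of_bool (v \<in> S \<and> k \<le> i) \<le> prefix_parts b1 v i" if "1 \<le> v" "i \<le> n" for v i
    proof (cases "v = c")
      case True
      then show ?thesis
        using cnt[of c i] b'(5)[of i] slack[of i] insert.prems(3)[of c i] that c
        by (cases "p \<le> i") (auto simp: p_def)
    next
      case False
      then show ?thesis using cnt[of v i] b'(4)[OF that] by simp
    qed
    show "prefix_parts b1 v n \<le> prefix_parts a v n + of_bool (v \<in> S)" if "1 \<le> v" for v
      using cnt[of v n] insert.prems(4)[OF that] prefix_parts_swap_le(2)[OF b'(2), of v] p c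
      by (auto simp: of_bool_def split: if_splits)
  qed
  then obtain bs j where bs: "\<forall>i\<le>card S. bs i \<in> weak_comps n" "bs (card S) = b1"
    "\<forall>i\<in>{1..card S}. 1 \<le> j i \<and> j i \<le> k" "swap_le n (bs 0) a"
    "\<forall>i\<in>{1..card S}. swap_le n (bs i) (bs (i - 1) + unit_comp (j i))"
    "bij_betw (\<lambda>i. bs (i - 1) (j i) + 1) {1..card S} S"
    by blast
  define bs' where "bs' = bs(Suc (card S) := b)"
  define j' where "j' = j(Suc (card S) := p)"
  have "bij_betw (\<lambda>i. bs' (i - 1) (j' i) + 1) {1..card S} S"
    using bs(6) by (rule bij_betw_cong[THEN iffD1, rotated]) (auto simp: bs'_def j'_def)
  moreover have last: "bs' (Suc (card S) - 1) (j' (Suc (card S))) + 1 = c"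
    using b1p bs(2) by (simp add: bs'_def j'_def)
  ultimately have "bij_betw (\<lambda>i. bs' (i - 1) (j' i) + 1) (insert (Suc (card S)) {1..card S}) (insert c S)"
    using notIn_Un_bij_betw[of "Suc (card S)" "{1..card S}" "\<lambda>i. bs' (i - 1) (j' i) + 1" S] c by simp
  moreover have "insert (Suc (card S)) {1..card S} = {1..Suc (card S)}" by auto
  ultimately have bij: "bij_betw (\<lambda>i. bs' (i - 1) (j' i) + 1) {1..Suc (card S)} (insert c S)"
    by simp
  show ?case
    unfolding card
  proof (intro exI[of _ bs'] exI[of _ j'] conjI ballI allI impI)
    show "bs' i \<in> weak_comps n" if "i \<le> Suc (card S)" for i
      using that bs(1) insert.prems(2) by (auto simp: bs'_def le_Suc_eq)
    show "swap_le n (bs' i) (bs' (i - 1) + unit_comp (j' i))" if "i \<in> {1..Suc (card S)}" for i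
    proof (cases "i = Suc (card S)")
      case True
      then show ?thesis using b'(2) bs(2) b1 by (simp add: bs'_def j'_def)
    next
      case False
      then show ?thesis using that bs(5) by (auto simp: bs'_def j'_def)
    qed
  qed (use bs p bij in \<open>auto simp: bs'_def j'_def\<close>)
qed

lemma in_pieri_comps:
  assumes "finite S" "0 \<notin> S" "a \<in> weak_comps n" "b \<in> weak_comps n" "1 \<le> k" "k \<le> n"
    and "\<And>v i. 1 \<le> v \<Longrightarrow> i \<le> n \<Longrightarrow> prefix_parts a v i + of_bool (v \<in> S \<and> k \<le> i) \<le> prefix_parts b v i"
    and "\<And>v. 1 \<le> v \<Longrightarrow> prefix_parts b v n \<le> prefix_parts a v n + of_bool (v \<in> S)"
  shows "b \<in> pieri_comps n (card S) a k"
proof -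
  obtain bs j where "\<forall>i\<le>card S. bs i \<in> weak_comps n" "bs (card S) = b"
    "\<forall>i\<in>{1..card S}. 1 \<le> j i \<and> j i \<le> k" "swap_le n (bs 0) a"
    "\<forall>i\<in>{1..card S}. swap_le n (bs i) (bs (i - 1) + unit_comp (j i))"
    "bij_betw (\<lambda>i. bs (i - 1) (j i) + 1) {1..card S} S"
    using in_pieri_comps_columns[OF assms] by blast
  then show ?thesis
    unfolding pieri_comps_def bij_betw_def by (intro CollectI exI[of _ bs] exI[of _ j]) auto
qed

lemma pieri_comps_weak_comps: "b \<in> pieri_comps n m a k \<Longrightarrow> b \<in> weak_comps n"
  unfolding pieri_comps_def by auto

section \<open>Path demands characterize Kohnert diagrams\<close>

text \<open>Inverts Kohnert moves while keeping all path counts: the violation of left-justification in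
  the rightmost possible column, and there in the topmost row \<open>r\<close>, is repaired by moving the end of
  row \<open>r\<close> up to the first row \<open>s\<close> that can take it.\<close>
lemma straighten_step:
  assumes T: "in_rows 0 n T" and d: "meets n T d"
    and size: "\<And>v. 1 \<le> v \<Longrightarrow> card (col T v) \<le> d v n"
    and bad: "(Suc c0, r0) \<in> T" "(c0, r0) \<notin> T" "1 \<le> c0"
  obtains T1 where "kohnert_move\<^sup>*\<^sup>* T1 T" "in_rows 0 n T1" "meets n T1 d"
    "(\<Sum>x\<in>T1. n - snd x) < (\<Sum>x\<in>T. n - snd x)"
proof -
  have finT: "finite T" using T by (simp add: in_rows_def)
  have cells: "1 \<le> c \<and> 0 < r \<and> r \<le> n" if "(c, r) \<in> T" for c r
    using T that unfolding in_rows_def by blast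
  define C where "C = {c. 1 \<le> c \<and> (\<exists>r. (Suc c, r) \<in> T \<and> (c, r) \<notin> T)}"
  have "C \<subseteq> (\<lambda>x. fst x - 1) ` T" by (force simp: C_def image_iff)
  then have finC: "finite C" using finT finite_surj by blast
  define c where "c = Max C"
  have "c \<in> C" unfolding c_def using finC bad by (intro Max_in) (auto simp: C_def)
  then have c1: "1 \<le> c" and "\<exists>r. (Suc c, r) \<in> T \<and> (c, r) \<notin> T" by (auto simp: C_def)
  define D where "D = {r. (Suc c, r) \<in> T \<and> (c, r) \<notin> T}"
  have "D \<subseteq> snd ` T" by (force simp: D_def image_iff)
  then have finD: "finite D" using finT finite_surj by blast
  define r where "r = Max D"
  have "r \<in> D"
    unfolding r_def using finD \<open>\<exists>r. (Suc c, r) \<in> T \<and> (c, r) \<notin> T\<close>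
    by (intro Max_in) (auto simp: D_def)
  then have r: "(Suc c, r) \<in> T" "(c, r) \<notin> T" by (auto simp: D_def)
  have nested1: "(x, t) \<in> T" if "(Suc x, t) \<in> T" "c < x" for x t
  proof (rule ccontr)
    assume "(x, t) \<notin> T"
    then have "x \<le> c" unfolding c_def using that finC c1 by (intro Max_ge) (auto simp: C_def)
    then show False using that by simp
  qed
  have nested: "(x, t) \<in> T" if "(y, t) \<in> T" "c < x" "x \<le> y" for x y t
    using that(3,1) by (induction rule: inc_induct) (use that(2) nested1 in auto)
  have top: "(c, t) \<in> T" if "(Suc c, t) \<in> T" "r < t" for t
  proof (rule ccontr)
    assume "(c, t) \<notin> T"
    then have "t \<le> r" unfolding r_def using that finD by (intro Max_ge) (auto simp: D_def)
    then show False using that by simp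
  qed
  have finrow: "finite {x. (x, t) \<in> T}" for t
  proof -
    have "{x. (x, t) \<in> T} \<subseteq> fst ` T" by (force simp: image_iff)
    then show ?thesis using finT finite_surj by blast
  qed
  define e where "e = Max {x. (x, r) \<in> T}"
  have "e \<in> {x. (x, r) \<in> T}" unfolding e_def using r finrow by (intro Max_in) auto
  then have e: "(e, r) \<in> T" "c < e"
    using Max_ge[OF finrow, of "Suc c" r] r by (auto simp: e_def)
  \<comment> \<open>Otherwise the path in column \<open>Suc c\<close> below \<open>r\<close> and in
    column \<open>c\<close> from \<open>r\<close> on would meet fewer cells than column
    \<open>Suc c\<close> contains, because of the hole at \<open>(c, r)\<close>; but the demand for
    \<open>Suc c\<close> is at least the height of that column.\<close>
  have "\<exists>t>r. (c, t) \<in> T \<and> (Suc c, t) \<notin> T"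
  proof (rule ccontr)
    assume none: "\<nexists>t. r < t \<and> (c, t) \<in> T \<and> (Suc c, t) \<notin> T"
    define f where "f t = (if t < r then Suc c else c)" for t
    have "staircase (Suc c) f"
      by (rule staircaseI) (use c1 in \<open>auto simp: f_def\<close>)
    then have "d (Suc c) n \<le> path_count T f 0 n"
      using d by (auto simp: meets_def)
    also have "\<dots> < path_count T (\<lambda>_. Suc c) 0 n"
      unfolding path_count_def
    proof (rule sum_strict_mono_ex1)
      show "\<forall>b\<in>{0<..n}. (of_bool ((f b, b) \<in> T) :: nat) \<le> of_bool ((Suc c, b) \<in> T)"
      proof
        fix b assume "b \<in> {0<..n}"
        show "(of_bool ((f b, b) \<in> T) :: nat) \<le> of_bool ((Suc c, b) \<in> T)"
          using none r by (cases b r rule: linorder_cases) (auto simp: f_def)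
      qed
      show "\<exists>b\<in>{0<..n}. (of_bool ((f b, b) \<in> T) :: nat) < of_bool ((Suc c, b) \<in> T)"
        using r cells[OF r(1)] by (intro bexI[of _ r]) (auto simp: f_def)
    qed auto
    also have "\<dots> \<le> d (Suc c) n"
      using size[of "Suc c"] path_count_const[OF T, of "Suc c"] by simp
    finally show False by simp
  qed
  then obtain t0 where t0: "r < t0" "(c, t0) \<in> T" "(Suc c, t0) \<notin> T" by blast
  then have t0': "r < t0 \<and> (c, t0) \<in> T \<and> (e, t0) \<notin> T"
    using nested[of e t0 "Suc c"] e by auto
  define s where "s = (LEAST t. r < t \<and> (c, t) \<in> T \<and> (e, t) \<notin> T)"
  have s: "r < s" "(c, s) \<in> T" "(e, s) \<notin> T"
    using LeastI[of "\<lambda>t. r < t \<and> (c, t) \<in> T \<and> (e, t) \<notin> T", OF t0'] by (auto simp: s_def)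
  have long: "(e, t) \<in> T" if "r < t" "t < s" "(c, t) \<in> T" for t
    using not_less_Least[of t "\<lambda>t. r < t \<and> (c, t) \<in> T \<and> (e, t) \<notin> T"] that by (auto simp: s_def)
  define h where "h = Max {x. (x, s) \<in> T}"
  have "h \<in> {x. (x, s) \<in> T}" unfolding h_def using s finrow by (intro Max_in) auto
  then have h: "(h, s) \<in> T" "c \<le> h" "\<And>x. (x, s) \<in> T \<Longrightarrow> x \<le> h"
    using Max_ge[OF finrow, of _ s] s by (auto simp: h_def)
  have he: "h < e"
    using nested[of h s e] h s e by (meson not_le)
  have row_s: "(x, s) \<in> T" if "c \<le> x" "x \<le> h" for x
    using nested[OF h(1), of x] that s by (cases "x = c") auto
  have seg: "(x, r) \<in> T" if "c < x" "x \<le> e" for x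
    using nested[OF e(1)] that by blast
  \<comment> \<open>Each row strictly between \<open>r\<close> and \<open>s\<close> is constant on
    the columns from \<open>c\<close> to \<open>e\<close>, so a path can be shifted sideways within
    these columns without changing what it meets.\<close>
  have mid: "(x, t) \<in> T \<longleftrightarrow> (c, t) \<in> T" if "r < t" "t < s" "c < x" "x \<le> e" for x t
    using long[OF that(1,2)] nested[of _ t] top[of t] that by (metis Suc_leI lessI)
  define T1 where "T1 = T - {h<..e} \<times> {r} \<union> {h<..e} \<times> {s}"
  have moves: "kohnert_move\<^sup>*\<^sup>* T1 T"
    unfolding T1_def
  proof (rule kohnert_drop_segment)
    show "(x, r) \<in> T" if "h < x" "x \<le> e" for x using seg that h by simp
    show "(x, t) \<in> T \<or> (\<forall>x'. (x', t) \<in> T \<longrightarrow> x' < x)" if "r < t" "t < s" "h < x" "x \<le> e" for t x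
    proof (cases "(c, t) \<in> T")
      case True
      then show ?thesis using mid[OF that(1,2)] that h by simp
    next
      case False
      have "x' < x" if x': "(x', t) \<in> T" for x'
      proof (rule ccontr)
        assume "\<not> x' < x"
        then have "(Suc c, t) \<in> T" using nested[OF x', of "Suc c"] h(2) \<open>h < x\<close> by auto
        then show False using top \<open>r < t\<close> False by blast
      qed
      then show ?thesis by blast
    qed
  qed (use h he s cells[OF r(1)] in auto)
  have rows1: "in_rows 0 n T1"
    using T cells[OF h(1)] h(2) c1 unfolding in_rows_def T1_def by auto
  have other: "(x, t) \<in> T1 \<longleftrightarrow> (x, t) \<in> T" if "t \<noteq> r" "t \<noteq> s" for x t
    using that by (auto simp: T1_def)
  have T1s: "(x, s) \<in> T1 \<longleftrightarrow> (x, s) \<in> T \<or> h < x \<and> x \<le> e" for x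
    using s by (auto simp: T1_def)
  have T1r: "(x, r) \<in> T1 \<longleftrightarrow> (x, r) \<in> T \<and> \<not> (h < x \<and> x \<le> e)" for x
    using s by (auto simp: T1_def)
  have "meets n T1 d"
    unfolding meets_def
  proof (intro allI impI)
    fix v f i assume f: "staircase v f" and i: "i \<le> n"
    note anti = staircaseD(2)[OF f]
    have "\<exists>g. staircase v g \<and> path_count T g 0 i \<le> path_count T1 f 0 i"
    proof (cases "r \<le> i \<and> h < f r \<and> f r \<le> e")
      case False
      have "path_count T f 0 i \<le> path_count T1 f 0 i"
      proof (rule path_count_le)
        fix t assume "t \<le> i" "(f t, t) \<in> T"
        then show "(f t, t) \<in> T1"
          using False by (cases "t = r"; cases "t = s") (auto simp: T1r T1s other)
      qed
      then show ?thesis using f by blast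
    next
      case fr: True
      show ?thesis
      proof (cases "s \<le> i \<and> c < f s")
        case True
        \<comment> \<open>The path is shifted right to column \<open>f r\<close> up to row
          \<open>s\<close>. There it passes beyond the end \<open>h\<close> of the old row, while
          \<open>f\<close> meets the extended row; this compensates for the cell that row
          \<open>r\<close> lost.\<close>
        define g where "g t = (if t \<le> s then max (f t) (f r) else f t)" for t
        have "staircase v g"
        proof (rule staircaseI)
          show "g t \<le> g u" if "u \<le> t" for t u
            using anti[OF that] that by (auto simp: g_def)
          show "1 \<le> g t" "g t \<le> v" for t
            using staircaseD(3,4)[OF f] by (auto simp: g_def le_max_iff_disj)
        qed
        moreover have "path_count T g 0 i \<le> path_count T1 f 0 i"
        proof (rule path_count_le_exchange[of _ _ r s])
          show "(f t, t) \<in> T1" if t: "0 < t" "t \<le> i" "t \<noteq> r" "t \<noteq> s" "(g t, t) \<in> T" for t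
          proof -
            consider "t < r" | "r < t" "t < s" | "s < t" using t by linarith
            then show ?thesis
            proof cases
              case 1
              then show ?thesis using t s anti[of t r] by (simp add: g_def other max_def split: if_splits)
            next
              case 2
              have "f t \<le> f r" "f s \<le> f t" using 2 anti by auto
              then show ?thesis
                using t 2 fr True mid[OF 2, of "f r"] mid[OF 2, of "f t"] h
                by (simp add: g_def other max_def split: if_splits)
            next
              case 3
              then show ?thesis using t by (simp add: g_def other)
            qed
          qed
          have "g s = f r" using anti[of r s] s by (simp add: g_def max_def)
          then show "(g s, s) \<notin> T" using fr h(3)[of "f r"] by auto
          have "f s \<le> e" using anti[of r s] s fr by auto
          then show "(f s, s) \<in> T1" using row_s[of "f s"] True by (auto simp: T1s)
        qed (use fr True s cells[OF r(1)] in auto)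
        ultimately show ?thesis by blast
      next
        case False
        \<comment> \<open>Here \<open>f\<close> is in columns up to \<open>c\<close> when it reaches
          row \<open>s\<close>, or stops before. Clamping to column \<open>c\<close> from row
          \<open>r\<close> on uses the hole at \<open>(c, r)\<close>, so \<open>g\<close> gets
          nothing in row \<open>r\<close> either.\<close>
        define g where "g t = (if r \<le> t then min (f t) c else f t)" for t
        have "staircase v g"
        proof (rule staircaseI)
          show "g t \<le> g u" if "u \<le> t" for t u
            using anti[OF that] that by (auto simp: g_def min_def)
          show "1 \<le> g t" "g t \<le> v" for t
            using staircaseD(3,4)[OF f, of t] c1 by (auto simp: g_def min_def)
        qed
        moreover have "path_count T g 0 i \<le> path_count T1 f 0 i"
        proof (rule path_count_le)
          fix t assume t: "0 < t" "t \<le> i" "(g t, t) \<in> T"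
          have gr: "g r = c" using fr h by (simp add: g_def min_def)
          consider "t < r" | "t = r" | "r < t" "t < s" | "t = s" | "s < t" using t by linarith
          then show "(f t, t) \<in> T1"
          proof cases
            case 1
            then show ?thesis using t s by (simp add: g_def other)
          next
            case 2
            then show ?thesis using gr t r by simp
          next
            case 3
            then have "f t \<le> e" using anti[of r t] fr by simp
            then show ?thesis
              using t 3 mid[OF 3, of "f t"] by (auto simp: g_def other min_def split: if_splits)
          next
            case 4
            then show ?thesis using t s False by (auto simp: g_def T1s min_def)
          next
            case 5
            then have "f t \<le> f s" using anti[of s t] by simp
            then show ?thesis using 5 t s False by (auto simp: g_def other min_def)
          qed
        qed
        ultimately show ?thesis by blast
      qed
    qed
    then show "d v i \<le> path_count T1 f 0 i"
      using d i unfolding meets_def by (meson order_trans)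
  qed
  moreover have "(\<Sum>x\<in>T1. n - snd x) < (\<Sum>x\<in>T. n - snd x)"
  proof -
    let ?A = "{h<..e}" and ?w = "\<lambda>x :: nat \<times> nat. n - snd x"
    have "T - ?A \<times> {r} \<union> ?A \<times> {r} = T" using seg h by auto
    then have "sum ?w T = sum ?w (T - ?A \<times> {r}) + sum ?w (?A \<times> {r})"
      using sum.union_disjoint[of "T - ?A \<times> {r}" "?A \<times> {r}" ?w] finT by auto
    moreover have "(T - ?A \<times> {r}) \<inter> ?A \<times> {s} = {}" using h(3) by fastforce
    then have "sum ?w T1 = sum ?w (T - ?A \<times> {r}) + sum ?w (?A \<times> {s})"
      unfolding T1_def using finT by (intro sum.union_disjoint) auto
    moreover have "sum ?w (?A \<times> {t}) = (e - h) * (n - t)" for t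
      by (subst sum.cong[OF refl, of _ _ "\<lambda>_. n - t"]) auto
    moreover have "n - s < n - r" using s cells[OF h(1)] by linarith
    then have "(e - h) * (n - s) < (e - h) * (n - r)" using he by simp
    ultimately show ?thesis by simp
  qed
  ultimately show thesis using that moves rows1 by blast
qed

text \<open>Straightening moves cells up and so lowers the sum of the distances to row
  \<open>n\<close>. When it stops, the diagram is left-justified, hence a key diagram, whose
  constant paths count exactly the prefix parts.\<close>

lemma exists_key_diagram:
  assumes "in_rows 0 n T" "meets n T d" "\<And>v. 1 \<le> v \<Longrightarrow> card (col T v) \<le> d v n"
  shows "\<exists>b\<in>weak_comps n. T \<in> KD b \<and> (\<forall>v i. 1 \<le> v \<longrightarrow> i \<le> n \<longrightarrow> d v i \<le> prefix_parts b v i)"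
  using assms
proof (induction "\<Sum>x\<in>T. n - snd x" arbitrary: T rule: less_induct)
  case less
  show ?case
  proof (cases "\<exists>c r. 1 \<le> c \<and> (Suc c, r) \<in> T \<and> (c, r) \<notin> T")
    case True
    then obtain T1 where T1: "kohnert_move\<^sup>*\<^sup>* T1 T" "in_rows 0 n T1" "meets n T1 d"
      "(\<Sum>x\<in>T1. n - snd x) < (\<Sum>x\<in>T. n - snd x)"
      using straighten_step[OF less.prems] by metis
    have "\<exists>b\<in>weak_comps n. T1 \<in> KD b \<and> (\<forall>v i. 1 \<le> v \<longrightarrow> i \<le> n \<longrightarrow> d v i \<le> prefix_parts b v i)"
      using less.hyps[OF T1(4,2,3)] less.prems(3) kohnert_moves_invariants(2)[OF T1(1,2)] by simp
    then show ?thesis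
      using T1(1) unfolding KD_def by (auto intro: rtranclp_trans)
  next
    case False
    have left: "(x, t) \<in> T" if "x \<le> y" "(y, t) \<in> T" "1 \<le> x" for x y t
      using that by (induction rule: inc_induct) (use False in auto)
    define b where "b t = card {x. (x, t) \<in> T}" for t
    have row: "{x. (x, t) \<in> T} = {1..b t}" for t
    proof (cases "{x. (x, t) \<in> T} = {}")
      case True
      then show ?thesis by (simp add: b_def)
    next
      case ne: False
      have "{x. (x, t) \<in> T} \<subseteq> fst ` T" by (force simp: image_iff)
      then have fin: "finite {x. (x, t) \<in> T}"
        using less.prems(1) finite_surj unfolding in_rows_def by blast
      define M where "M = Max {x. (x, t) \<in> T}"
      have M: "(M, t) \<in> T" "\<And>x. (x, t) \<in> T \<Longrightarrow> x \<le> M"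
        using Max_in[OF fin ne] Max_ge[OF fin] by (auto simp: M_def)
      have "{x. (x, t) \<in> T} = {1..M}"
      proof (intro subset_antisym subsetI)
        fix x assume "x \<in> {x. (x, t) \<in> T}"
        then have "(x, t) \<in> T" by simp
        moreover from this have "1 \<le> x"
          using less.prems(1) unfolding in_rows_def by blast
        ultimately show "x \<in> {1..M}" using M(2) by simp
      qed (use left[OF _ M(1)] in simp)
      then show ?thesis unfolding b_def by (metis card_atLeastAtMost diff_Suc_1)
    qed
    have mem: "(x, t) \<in> T \<longleftrightarrow> 1 \<le> x \<and> x \<le> b t" for x t
      using row[of t] by auto
    have b: "b \<in> weak_comps n"
    proof -
      have "b t = 0" if "t \<notin> {1..n}" for t
        using mem[of "b t" t] less.prems(1) that unfolding in_rows_def by (fastforce simp: not_le)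
      then show ?thesis by (simp add: weak_comps_def)
    qed
    have "0 < t" if "(x, t) \<in> T" for x t
      using less.prems(1) that by (simp add: in_rows_def)
    then have key: "T = key_diagram b"
      by (auto simp: key_diagram_def mem Suc_le_eq)
    then have "T \<in> KD b" by (simp add: KD_def)
    moreover have "d v i \<le> prefix_parts b v i" if "1 \<le> v" "i \<le> n" for v i
      using less.prems(2) staircase_const[OF that(1), of v] that(2) path_count_key_const[OF that(1), of b i]
      unfolding meets_def key by fastforce
    ultimately show ?thesis using b by blast
  qed
qed

text \<open>The column heights and path demands that describe both \<open>KD a\<close> (with \<open>S\<close> empty) and its Pieri
  product; \<open>S\<close> is the set of columns to which a cell is added.\<close>
definition pieri_demand :: "(nat \<Rightarrow> nat) \<Rightarrow> nat \<Rightarrow> nat set \<Rightarrow> nat \<Rightarrow> nat \<Rightarrow> nat" where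
  "pieri_demand a k S v i = prefix_parts a v i + of_bool (v \<in> S \<and> k \<le> i)"

text \<open>For the converse, straightening yields a \<open>b\<close> whose prefix counts satisfy
  the raised demand, and the column heights, which moves preserve, give the equality of totals
  required of a Pieri composition.\<close>

lemma pieri_diagrams_iff:
  assumes "a \<in> weak_comps n" "1 \<le> k" "k \<le> n"
  shows "T \<in> pieri_diagrams n m a k \<longleftrightarrow> in_rows 0 n T \<and>
    (\<exists>S. finite S \<and> 0 \<notin> S \<and> card S = m \<and>
      (\<forall>v\<ge>1. card (col T v) = pieri_demand a k S v n) \<and> meets n T (pieri_demand a k S))"
proof
  assume "T \<in> pieri_diagrams n m a k"
  then obtain b where b: "b \<in> pieri_comps n m a k" "T \<in> KD b"
    by (auto simp: pieri_diagrams_def)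
  obtain S where S: "finite S" "0 \<notin> S" "card S = m"
    "\<And>v i. i \<le> n \<Longrightarrow> prefix_parts a v i + of_bool (v \<in> S \<and> k \<le> i) \<le> prefix_parts b v i"
    "\<And>v. prefix_parts b v n = prefix_parts a v n + of_bool (v \<in> S)"
    using prefix_parts_pieri_comps[OF b(1) assms(3)] by blast
  note inv = KD_invariants[OF pieri_comps_weak_comps[OF b(1)] b(2)]
  have "meets n T (pieri_demand a k S)"
    unfolding meets_def pieri_demand_def
    using inv(3) S(4) unfolding meets_def by (meson order_trans)
  moreover have "\<forall>v\<ge>1. card (col T v) = pieri_demand a k S v n"
    using inv(2) S(5) assms(3) by (simp add: pieri_demand_def)
  ultimately show "in_rows 0 n T \<and> (\<exists>S. finite S \<and> 0 \<notin> S \<and> card S = m \<and>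
      (\<forall>v\<ge>1. card (col T v) = pieri_demand a k S v n) \<and> meets n T (pieri_demand a k S))"
    using inv(1) S(1-3) by blast
next
  assume "in_rows 0 n T \<and> (\<exists>S. finite S \<and> 0 \<notin> S \<and> card S = m \<and>
      (\<forall>v\<ge>1. card (col T v) = pieri_demand a k S v n) \<and> meets n T (pieri_demand a k S))"
  then obtain S where T: "in_rows 0 n T" and S: "finite S" "0 \<notin> S" "card S = m"
    "\<And>v. 1 \<le> v \<Longrightarrow> card (col T v) = pieri_demand a k S v n" "meets n T (pieri_demand a k S)"
    by blast
  obtain b where b: "b \<in> weak_comps n" "T \<in> KD b"
    "\<And>v i. 1 \<le> v \<Longrightarrow> i \<le> n \<Longrightarrow> pieri_demand a k S v i \<le> prefix_parts b v i"
    using exists_key_diagram[OF T S(5)] S(4) by auto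
  have "b \<in> pieri_comps n (card S) a k"
  proof (rule in_pieri_comps)
    show "prefix_parts b v n \<le> prefix_parts a v n + of_bool (v \<in> S)" if "1 \<le> v" for v
      using KD_invariants(2)[OF b(1,2) that] S(4)[OF that] assms(3) by (simp add: pieri_demand_def)
  qed (use S assms b in \<open>auto simp: pieri_demand_def\<close>)
  then show "T \<in> pieri_diagrams n m a k"
    using b(2) S(3) by (auto simp: pieri_diagrams_def)
qed

lemma KD_eq_pieri_diagrams:
  assumes "a \<in> weak_comps n"
  shows "KD a = pieri_diagrams n 0 a k"
proof -
  have "pieri_comps n 0 a k \<subseteq> {b. swap_le n b a}"
    by (auto simp: pieri_comps_def)
  moreover have "a \<in> pieri_comps n 0 a k"
    using assms by (auto simp: pieri_comps_def intro!: exI[of _ "\<lambda>_. a"])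
  ultimately show ?thesis
    using KD_swap_le unfolding pieri_diagrams_def by blast
qed

section \<open>Adding a lowest row\<close>

definition down_closed :: "(nat \<Rightarrow> bool) \<Rightarrow> nat set \<Rightarrow> bool" where
  "down_closed L A \<longleftrightarrow> finite A \<and> (\<forall>t. L t \<and> Suc t \<in> A \<longrightarrow> t \<in> A)"

definition up_closed :: "(nat \<Rightarrow> bool) \<Rightarrow> nat set \<Rightarrow> bool" where
  "up_closed L A \<longleftrightarrow> finite A \<and> (\<forall>t. L t \<and> t \<in> A \<longrightarrow> Suc t \<in> A)"

text \<open>The links \<open>L t\<close> between \<open>t\<close> and \<open>Suc t\<close> cut the naturals into runs, the last of which is
  infinite. Mirroring each finite run turns final segments of runs into initial ones, and the last
  run, which a finite up-closed set avoids, accommodates an initial segment of arbitrary size.\<close>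
lemma up_closed_down_closed_bij:
  assumes "\<exists>N. \<forall>t\<ge>N. L t"
  shows "\<exists>f. bij_betw f ({A. up_closed L A} \<times> UNIV) {A. down_closed L A} \<and>
    (\<forall>A t. up_closed L A \<longrightarrow> card (f (A, t)) = card A + t)"
proof -
  define N where "N = (LEAST N. \<forall>t\<ge>N. L t)"
  have N: "L t" if "N \<le> t" for t
    using LeastI_ex[OF assms] that unfolding N_def by blast
  have N': "\<not> L (N - 1)" if "0 < N"
  proof
    assume "L (N - 1)"
    then have "\<forall>t\<ge>N - 1. L t"
      using N by (metis Suc_pred' le_neq_implies_less Suc_leI that)
    then have "N \<le> N - 1" unfolding N_def by (rule Least_le)
    then show False using that by simp
  qed
  \<comment> \<open>For \<open>t < N\<close> the run of \<open>t\<close> is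
    \<open>{p t..q t}\<close> and \<open>r\<close> is its reflection. The infinite run starts at
    \<open>N\<close>, where \<open>q\<close> has no meaning and the reflection is not
    applied.\<close>
  define p where "p t = (LEAST p. p \<le> t \<and> (\<forall>s. p \<le> s \<and> s < t \<longrightarrow> L s))" for t
  define q where "q t = (LEAST q. t \<le> q \<and> \<not> L q)" for t
  define r where "r t = p t + q t - t" for t
  have p: "p t \<le> t" "\<And>s. p t \<le> s \<Longrightarrow> s < t \<Longrightarrow> L s" for t
  proof -
    have "t \<le> t \<and> (\<forall>s. t \<le> s \<and> s < t \<longrightarrow> L s)" by auto
    from LeastI[of "\<lambda>p. p \<le> t \<and> (\<forall>s. p \<le> s \<and> s < t \<longrightarrow> L s)", OF this]
    show "p t \<le> t" "\<And>s. p t \<le> s \<Longrightarrow> s < t \<Longrightarrow> L s" unfolding p_def by blast+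
  qed
  have pmin: "p t \<le> s" if "s \<le> t" "\<And>x. s \<le> x \<Longrightarrow> x < t \<Longrightarrow> L x" for s t
    unfolding p_def by (rule Least_le) (use that in blast)
  have qex: "t \<le> N - 1 \<and> \<not> L (N - 1)" if "t < N" for t
    using N' that by simp
  have q: "t \<le> q t" "\<not> L (q t)" "q t < N" if "t < N" for t
    using LeastI[of "\<lambda>q. t \<le> q \<and> \<not> L q", OF qex[OF that]]
      Least_le[of "\<lambda>q. t \<le> q \<and> \<not> L q", OF qex[OF that]] that by (auto simp: q_def)
  have qmin: "L s" if "t \<le> s" "s < q t" for s t
    using not_less_Least[OF that(2)[unfolded q_def]] that(1) by blast
  have run: "L s" if "p t \<le> s" "s < q t" for s t
    using p(2)[of t s] qmin[of t s] that by (cases "s < t") auto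
  have same: "p s = p t" "q s = q t" if "p t \<le> s" "s \<le> q t" "t < N" for s t
  proof -
    have sN: "s < N" using q(3)[OF that(3)] that by simp
    have "p s \<le> p t" by (rule pmin) (use that run in auto)
    moreover have "p t \<le> p s"
    proof (rule pmin)
      show "p s \<le> t" using \<open>p s \<le> p t\<close> p(1)[of t] by simp
      show "L x" if "p s \<le> x" "x < t" for x
        using p(2)[OF that(1)] run[of t x] that(2) q(1)[OF \<open>t < N\<close>] \<open>p t \<le> s\<close>
        by (cases "x < s") auto
    qed
    ultimately show "p s = p t" by simp
    have "q s \<le> q t"
      unfolding q_def[of s] by (rule Least_le) (use that q in auto)
    moreover have "q t \<le> q s"
    proof (rule ccontr)
      assume "\<not> q t \<le> q s"
      then have "L (q s)" using run[of t "q s"] that q(1)[OF sN] by simp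
      then show False using q(2)[OF sN] by simp
    qed
    ultimately show "q s = q t" by simp
  qed
  have r: "p t \<le> r t" "r t \<le> q t" "r t < N" "r (r t) = t" if "t < N" for t
  proof -
    show 1: "p t \<le> r t" "r t \<le> q t" using p(1)[of t] q(1)[OF that] by (auto simp: r_def)
    then show "r t < N" using q(3)[OF that] by simp
    show "r (r t) = t"
      using same[OF 1 that] p(1)[of t] q(1)[OF that] by (simp add: r_def)
  qed
  \<comment> \<open>Reflection reverses successors within a run, which exchanges closure upwards
    with closure downwards.\<close>
  have adj: "Suc t < N" "Suc (r (Suc t)) = r t" "L (r (Suc t))" if "t < N" "L t" for t
  proof -
    have "t \<noteq> q t" using q(2)[OF that(1)] that(2) by auto
    then have t: "p t \<le> Suc t" "Suc t \<le> q t" using p(1)[of t] q(1)[OF that(1)] by auto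
    then show "Suc t < N" using q(3)[OF that(1)] by simp
    show S: "Suc (r (Suc t)) = r t"
      using same[OF t that(1)] t p(1)[of t] by (simp add: r_def)
    show "L (r (Suc t))"
      using run[of t "r (Suc t)"] r(2)[OF that(1)] r(1)[OF \<open>Suc t < N\<close>] S same(1)[OF t that(1)] by simp
  qed
  have rinj: "inj_on r {..<N}"
    by (rule inj_on_inverseI[of _ r]) (use r in auto)
  have upN: "A \<subseteq> {..<N}" if "up_closed L A" for A
  proof (rule ccontr)
    assume "\<not> A \<subseteq> {..<N}"
    then obtain a where a: "a \<in> A" "N \<le> a" by (meson lessThan_iff not_le subsetI)
    have "a + x \<in> A" for x
      by (induction x) (use a that N in \<open>auto simp: up_closed_def\<close>)
    then have "(\<lambda>x. a + x) ` UNIV \<subseteq> A" by auto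
    then have "finite ((\<lambda>x. a + x) ` (UNIV :: nat set))"
      using that finite_subset unfolding up_closed_def by blast
    then show False by (subst (asm) finite_image_iff) auto
  qed
  define f where "f = (\<lambda>(A, t). r ` A \<union> {N..<N + t})"
  define g where "g B = (r ` (B \<inter> {..<N}), card (B \<inter> {N..}))" for B
  have rr: "r ` r ` A = A" if "A \<subseteq> {..<N}" for A
    using that r(4) by (force simp: image_image)
  have rN: "r ` A \<subseteq> {..<N}" if "A \<subseteq> {..<N}" for A
    using that r(3) by auto
  have "bij_betw f ({A. up_closed L A} \<times> UNIV) {A. down_closed L A}"
  proof (rule bij_betwI[where g = g])
    show "f \<in> {A. up_closed L A} \<times> UNIV \<rightarrow> {A. down_closed L A}"
    proof (clarsimp simp: f_def)
      fix A t assume A: "up_closed L A"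
      have "s \<in> r ` A \<union> {N..<N + t}" if s: "L s" "Suc s \<in> r ` A \<union> {N..<N + t}" for s
      proof (cases "N \<le> s")
        case True
        then show ?thesis using s rN[OF upN[OF A]] by auto
      next
        case False
        then have sN: "s < N" by simp
        then have "Suc s \<in> r ` A" using s adj(1)[OF sN s(1)] by auto
        then obtain a where a: "a \<in> A" "Suc s = r a" by auto
        then have "a < N" using upN[OF A] by auto
        then have "r (Suc s) = a" using r(4) a by simp
        then have "Suc a = r s" "L a" using adj(2,3)[OF sN s(1)] by auto
        then have "r s \<in> A" using A a(1) unfolding up_closed_def by metis
        then show ?thesis using r(4)[OF sN] by force
      qed
      then show "down_closed L (r ` A \<union> {N..<N + t})"
        using A unfolding down_closed_def up_closed_def by auto
    qed
    show "g \<in> {A. down_closed L A} \<rightarrow> {A. up_closed L A} \<times> UNIV"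
    proof (clarsimp simp: g_def)
      fix B assume B: "down_closed L B"
      have "Suc t \<in> r ` (B \<inter> {..<N})" if t: "L t" "t \<in> r ` (B \<inter> {..<N})" for t
      proof -
        obtain b where b: "b \<in> B" "b < N" "t = r b" using t by auto
        have tN: "t < N" and rt: "r t = b" using r(3,4) b by auto
        note a = adj[OF tN t(1)]
        have "r (Suc t) \<in> B" using B a(2,3) rt b unfolding down_closed_def by metis
        then show ?thesis using r(3,4)[OF a(1)] by (intro image_eqI[of _ _ "r (Suc t)"]) auto
      qed
      then show "up_closed L (r ` (B \<inter> {..<N}))"
        using B unfolding down_closed_def up_closed_def by blast
    qed
    show "g (f x) = x" if mem: "x \<in> {A. up_closed L A} \<times> UNIV" for x
    proof -
      obtain A t where x: "x = (A, t)" "up_closed L A" using mem by blast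
      have "(r ` A \<union> {N..<N + t}) \<inter> {..<N} = r ` A" "(r ` A \<union> {N..<N + t}) \<inter> {N..} = {N..<N + t}"
        using rN[OF upN[OF x(2)]] by auto
      then show ?thesis using x rr[OF upN[OF x(2)]] by (simp add: f_def g_def)
    qed
    show "f (g B) = B" if "B \<in> {A. down_closed L A}" for B
    proof -
      define X where "X = B \<inter> {N..}"
      have B: "down_closed L B" "finite X" using that by (auto simp: X_def down_closed_def)
      have "X = {N..<N + card X}"
      proof (cases "X = {}")
        case False
        have M: "Max X \<in> X" "\<And>x. x \<in> X \<Longrightarrow> x \<le> Max X" using B(2) False by auto
        have "x \<in> X" if "x \<le> Max X" "N \<le> x" for x
          using that by (induction rule: inc_induct) (use M(1) B(1) N in \<open>auto simp: X_def down_closed_def\<close>)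
        then have "X = {N..<Suc (Max X)}" using M by (auto simp: X_def less_Suc_eq_le)
        moreover from this have "card X = Suc (Max X) - N" by (metis card_atLeastLessThan)
        moreover have "N \<le> Max X" using M(1) by (simp add: X_def)
        ultimately show ?thesis by simp
      qed simp
      then show ?thesis
        using rr[of "B \<inter> {..<N}"] by (auto simp: f_def g_def X_def)
    qed
  qed
  moreover have "card (f (A, t)) = card A + t" if "up_closed L A" for A t
  proof -
    have "r ` A \<inter> {N..<N + t} = {}" using rN[OF upN[OF that]] by auto
    moreover have "finite A" using that by (simp add: up_closed_def)
    moreover have "card (r ` A) = card A"
      by (rule card_image) (use rinj upN[OF that] inj_on_subset in blast)
    ultimately show ?thesis by (simp add: f_def card_Un_disjoint)
  qed
  ultimately show ?thesis by blast
qed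

text \<open>\<open>R u v\<close> releases the pair \<open>u < v\<close>. Only unrelated pairs impose
  a condition: \<open>v \<in> Y\<close> then forces \<open>u \<in> Y\<close>.\<close>

definition lower_sets :: "(nat \<Rightarrow> nat \<Rightarrow> bool) \<Rightarrow> nat set \<Rightarrow> nat set set" where
  "lower_sets R Z = {Y. finite Y \<and> Y \<subseteq> Z \<and> (\<forall>u\<in>Z - Y. \<forall>v\<in>Y. u < v \<longrightarrow> R u v)}"

definition upper_sets :: "(nat \<Rightarrow> nat \<Rightarrow> bool) \<Rightarrow> nat set \<Rightarrow> nat set set" where
  "upper_sets R Z = {Y. finite Y \<and> Y \<subseteq> Z \<and> (\<forall>u\<in>Y. \<forall>v\<in>Z - Y. u < v \<longrightarrow> R u v)}"

text \<open>By monotonicity an unrelated pair makes all consecutive pairs between its ends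
  unrelated. So both conditions reduce to neighbours in the enumeration of \<open>Z\<close>, linked
  when unrelated, and \<open>fin\<close> makes the last run infinite.\<close>

lemma upper_sets_lower_sets_bij:
  assumes "infinite Z"
    and mono: "\<And>u u' v v'. u \<in> Z \<Longrightarrow> u \<le> u' \<Longrightarrow> u' < v' \<Longrightarrow> v' \<le> v \<Longrightarrow> R u' v' \<Longrightarrow> R u v"
    and fin: "\<exists>N. \<forall>u\<ge>N. \<forall>v>u. \<not> R u v"
  shows "\<exists>f. bij_betw f (upper_sets R Z \<times> UNIV) (lower_sets R Z) \<and>
    (\<forall>Y\<in>upper_sets R Z. \<forall>t. card (f (Y, t)) = card Y + t)"
proof -
  define z where "z = enumerate Z"
  have z: "strict_mono z" "range z = Z" "inj z"
    using strict_mono_enumerate[OF assms(1)] range_enumerate[OF assms(1)] strict_mono_imp_inj_on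
    by (auto simp: z_def)
  have zmem: "z t \<in> Z" for t using z(2) by auto
  have zless: "z s < z t \<longleftrightarrow> s < t" and zle: "z s \<le> z t \<longleftrightarrow> s \<le> t" for s t
    using z(1) by (auto simp: strict_mono_less strict_mono_less_eq)
  have zge: "t \<le> z t" for t using strict_mono_imp_increasing[OF z(1)] by simp
  define L where "L t \<longleftrightarrow> \<not> R (z t) (z (Suc t))" for t
  have between: "L x" if "\<not> R (z s) (z t)" "s \<le> x" "x < t" for s t x
    using mono[OF zmem[of s], of "z x" "z (Suc x)" "z t"] that by (auto simp: L_def zle zless)
  obtain N where N: "\<And>u v. N \<le> u \<Longrightarrow> u < v \<Longrightarrow> \<not> R u v" using fin by blast
  have "\<forall>t\<ge>N. L t" using N zge order_trans unfolding L_def by (metis lessI zless)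
  then obtain f where f: "bij_betw f ({A. up_closed L A} \<times> UNIV) {A. down_closed L A}"
    "\<And>A t. up_closed L A \<Longrightarrow> card (f (A, t)) = card A + t"
    using up_closed_down_closed_bij[of L] by blast
  have low: "down_closed L A \<longleftrightarrow> z ` A \<in> lower_sets R Z" for A
  proof
    assume A: "down_closed L A"
    have "R (z s) (z t)" if "z s \<notin> z ` A" "t \<in> A" "z s < z t" for s t
    proof (rule ccontr)
      assume nR: "\<not> R (z s) (z t)"
      have "s \<le> t" using that zless by simp
      then have "s \<in> A"
        by (induction rule: inc_induct) (use that A between[OF nR] in \<open>auto simp: down_closed_def\<close>)
      then show False using that by simp
    qed
    then have "\<forall>u\<in>Z - z ` A. \<forall>v\<in>z ` A. u < v \<longrightarrow> R u v"
      unfolding z(2)[symmetric] by blast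
    then show "z ` A \<in> lower_sets R Z"
      using A zmem by (auto simp: lower_sets_def down_closed_def)
  next
    assume A: "z ` A \<in> lower_sets R Z"
    have "t \<in> A" if "L t" "Suc t \<in> A" for t
    proof (rule ccontr)
      assume "t \<notin> A"
      then have "z t \<in> Z - z ` A" using zmem z(3) by (simp add: inj_image_mem_iff)
      then have "R (z t) (z (Suc t))" using A that(2) zless by (auto simp: lower_sets_def)
      then show False using that(1) by (simp add: L_def)
    qed
    moreover have "finite A"
      using A z(3) by (auto simp: lower_sets_def finite_image_iff inj_on_subset)
    ultimately show "down_closed L A" by (simp add: down_closed_def)
  qed
  have upp: "up_closed L A \<longleftrightarrow> z ` A \<in> upper_sets R Z" for A
  proof
    assume A: "up_closed L A"
    have "R (z s) (z t)" if "z t \<notin> z ` A" "s \<in> A" "z s < z t" for s t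
    proof (rule ccontr)
      assume nR: "\<not> R (z s) (z t)"
      have "s \<le> t" using that zless by simp
      then have "t \<in> A"
        by (induction rule: dec_induct) (use that A between[OF nR] in \<open>auto simp: up_closed_def\<close>)
      then show False using that by simp
    qed
    then have "\<forall>u\<in>z ` A. \<forall>v\<in>Z - z ` A. u < v \<longrightarrow> R u v"
      unfolding z(2)[symmetric] by blast
    then show "z ` A \<in> upper_sets R Z"
      using A zmem by (auto simp: upper_sets_def up_closed_def)
  next
    assume A: "z ` A \<in> upper_sets R Z"
    have "Suc t \<in> A" if "L t" "t \<in> A" for t
    proof (rule ccontr)
      assume "Suc t \<notin> A"
      then have "z (Suc t) \<in> Z - z ` A" using zmem z(3) by (simp add: inj_image_mem_iff)
      then have "R (z t) (z (Suc t))" using A that(2) zless by (auto simp: upper_sets_def)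
      then show False using that(1) by (simp add: L_def)
    qed
    moreover have "finite A"
      using A z(3) by (auto simp: upper_sets_def finite_image_iff inj_on_subset)
    ultimately show "up_closed L A" by (simp add: up_closed_def)
  qed
  have vim: "z ` (z -` Y) = Y" if "Y \<subseteq> Z" for Y using that z(2) by (simp add: image_vimage_eq Int_absorb2)
  have b1: "bij_betw (\<lambda>(Y, t). (z -` Y, t)) (upper_sets R Z \<times> UNIV) ({A. up_closed L A} \<times> (UNIV :: nat set))"
  proof (rule bij_betwI[where g = "\<lambda>(A, t). (z ` A, t)"])
    show "(\<lambda>(Y, t). (z -` Y, t)) \<in> upper_sets R Z \<times> UNIV \<rightarrow> {A. up_closed L A} \<times> UNIV"
      using vim by (auto simp: upp upper_sets_def)
  qed (use z(3) vim in \<open>auto simp: upp inj_vimage_image_eq upper_sets_def dest: injD\<close>)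
  have b2: "bij_betw (\<lambda>A. z ` A) {A. down_closed L A} (lower_sets R Z)"
  proof (rule bij_betwI[where g = "\<lambda>Y. z -` Y"])
    show "(\<lambda>Y. z -` Y) \<in> lower_sets R Z \<rightarrow> {A. down_closed L A}"
      using vim by (auto simp: low lower_sets_def)
  qed (use z(3) vim in \<open>auto simp: low inj_vimage_image_eq lower_sets_def dest: injD\<close>)
  define F where "F = (\<lambda>A. z ` A) \<circ> (f \<circ> (\<lambda>(Y, t). (z -` Y, t)))"
  have "bij_betw F (upper_sets R Z \<times> UNIV) (lower_sets R Z)"
    unfolding F_def using bij_betw_trans[OF bij_betw_trans[OF b1 f(1)] b2] .
  moreover have "card (F (Y, t)) = card Y + t" if "Y \<in> upper_sets R Z" for Y t
  proof -
    have Y: "z ` (z -` Y) = Y" using vim that by (simp add: upper_sets_def)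
    then have "up_closed L (z -` Y)" using that upp by simp
    moreover have "card Y = card (z -` Y)" using Y card_image[of z "z -` Y"] z(3) inj_on_subset by fastforce
    moreover have "card (z ` A) = card A" for A
      by (rule card_image) (use z(3) inj_on_subset in blast)
    ultimately show ?thesis using f(2) by (simp add: F_def)
  qed
  ultimately show ?thesis by blast
qed

section \<open>Demands and what one row leaves of them\<close>

definition is_demand :: "(nat \<Rightarrow> nat \<Rightarrow> nat) \<Rightarrow> bool" where
  "is_demand d \<longleftrightarrow> (\<forall>u v i. u \<le> v \<longrightarrow> d v i \<le> d u i) \<and>
    (\<forall>u v i i'. u \<le> v \<longrightarrow> i \<le> i' \<longrightarrow> d u i + d v i' \<le> d u i' + d v i) \<and>
    (\<exists>N. \<forall>v\<ge>N. \<forall>i. d v i = 0)"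

text \<open>\<open>residual d R\<close> is the demand left for the rows above after a row with cells in the columns
  \<open>R\<close>: a path starting in column \<open>u\<close> may have used any column \<open>u' \<ge> u\<close> of that row, and the best
  choices are \<open>u\<close> itself and the first column that avoids \<open>R\<close>.\<close>
definition next_free :: "nat set \<Rightarrow> nat \<Rightarrow> nat" where
  "next_free R v = (LEAST w. v \<le> w \<and> w \<notin> R)"

definition residual :: "(nat \<Rightarrow> nat \<Rightarrow> nat) \<Rightarrow> nat set \<Rightarrow> nat \<Rightarrow> nat \<Rightarrow> nat" where
  "residual d R v i = max (d v i - 1) (d (next_free R v) i)"

lemma next_free:
  assumes "finite R"
  shows "v \<le> next_free R v" "next_free R v \<notin> R" "v \<le> w \<Longrightarrow> w \<notin> R \<Longrightarrow> next_free R v \<le> w"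
proof -
  have "\<exists>w. v \<le> w \<and> w \<notin> R"
    using ex_new_if_finite[of "R \<union> {..<v}"] assms by (auto simp: not_less)
  from LeastI_ex[OF this] show "v \<le> next_free R v" "next_free R v \<notin> R" by (auto simp: next_free_def)
  show "v \<le> w \<Longrightarrow> w \<notin> R \<Longrightarrow> next_free R v \<le> w"
    unfolding next_free_def by (rule Least_le) simp
qed

lemma next_free_notin: "v \<notin> R \<Longrightarrow> next_free R v = v"
  unfolding next_free_def by (rule Least_equality) auto

lemma residual_notin: "v \<notin> R \<Longrightarrow> residual d R v i = d v i"
  by (simp add: residual_def next_free_notin)

text \<open>A maximum of supermodular functions need not be supermodular. Here
  \<open>u \<le> v\<close> either share the next free column, or that of \<open>u\<close> is at most
  \<open>v\<close>; in both cases the four columns involved form a chain along which the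
  inequalities for \<open>d\<close> combine.\<close>

lemma is_demand_residual:
  assumes "is_demand d" "finite R"
  shows "is_demand (residual d R)"
proof -
  note nf = next_free[OF assms(2)]
  have anti: "d v i \<le> d u i" if "u \<le> v" for u v i
    using assms(1) that by (simp add: is_demand_def)
  have super: "d u i + d v i' \<le> d u i' + d v i" if "u \<le> v" "i \<le> i'" for u v i i'
    using assms(1) that by (simp add: is_demand_def)
  have cases: "next_free R v = next_free R u \<or> next_free R u \<le> v" if "u \<le> v" for u v
    using nf[of u] nf[of v] that by (metis le_antisym nle_le order_trans)
  have "residual d R v i \<le> residual d R u i" if "u \<le> v" for u v i
    using anti[OF that, of i] anti[of "next_free R u" v i] anti[of "next_free R v" v i] anti[OF nf(1)[of v], of i]
      cases[OF that] unfolding residual_def by (auto simp: max_def)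
  moreover have "residual d R u i + residual d R v i' \<le> residual d R u i' + residual d R v i"
    if uv: "u \<le> v" and i: "i \<le> i'" for u v i i'
  proof (cases "next_free R u \<le> v")
    case False
    then have eq: "next_free R v = next_free R u" using cases[OF uv] by simp
    have le: "v \<le> next_free R u" using False by simp
    show ?thesis
      using super[OF uv i] super[OF le i] anti[OF uv, of i] anti[OF uv, of i'] anti[OF le, of i] anti[OF le, of i']
      unfolding residual_def eq by linarith
  next
    case True
    show ?thesis
      using super[OF nf(1)[of u] i] super[OF True i] super[OF nf(1)[of v] i]
        anti[OF nf(1)[of u], of i] anti[OF nf(1)[of u], of i'] anti[OF True, of i] anti[OF True, of i']
        anti[OF nf(1)[of v], of i] anti[OF nf(1)[of v], of i']
      unfolding residual_def by linarith
  qed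
  moreover have "\<exists>N. \<forall>v\<ge>N. \<forall>i. residual d R v i = 0"
  proof -
    obtain N where N: "\<And>v i. N \<le> v \<Longrightarrow> d v i = 0"
      using assms(1) unfolding is_demand_def by blast
    have "residual d R v i = 0" if "N \<le> v" for v i
      using N[OF that, of i] N[OF order_trans[OF that nf(1)], of i] by (simp add: residual_def)
    then show ?thesis by blast
  qed
  ultimately show ?thesis unfolding is_demand_def by blast
qed

text \<open>One row with cells in the columns \<open>R\<close> is put below a fixed diagram with column heights \<open>h\<close> and
  minimal path counts \<open>W\<close>; \<open>S\<close> is the set of columns that have one cell more than the demand \<open>d\<close>.\<close>
locale row_step =
  fixes j k n :: nat and d W :: "nat \<Rightarrow> nat \<Rightarrow> nat" and h :: "nat \<Rightarrow> nat"
  assumes kn: "k \<le> n" "j < n"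
    and demand: "is_demand d"
    and W_antimono: "1 \<le> u \<Longrightarrow> u \<le> v \<Longrightarrow> W v i \<le> W u i"
    and W_supermodular: "1 \<le> u \<Longrightarrow> u \<le> v \<Longrightarrow> i \<le> i' \<Longrightarrow> W u i + W v i' \<le> W u i' + W v i"
    and W_height: "1 \<le> v \<Longrightarrow> W v n \<le> h v"
    and h_finite: "finite {v. h v \<noteq> 0}"
begin

definition sizes :: "nat set \<Rightarrow> nat set \<Rightarrow> bool" where
  "sizes R S \<longleftrightarrow> finite R \<and> 0 \<notin> R \<and> finite S \<and> 0 \<notin> S \<and>
    (\<forall>v\<ge>1. h v + of_bool (v \<in> R) = d v n + of_bool (v \<in> S))"

text \<open>A path bounded by \<open>v\<close> crosses the new row in some column
  \<open>u \<le> v\<close> and continues above it with bound \<open>u\<close>, hence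
  \<open>W u i\<close>.\<close>

definition start_below :: "nat set \<Rightarrow> nat set \<Rightarrow> bool" where
  "start_below R S \<longleftrightarrow> (\<forall>u v i. 1 \<le> u \<longrightarrow> u \<le> v \<longrightarrow> i \<in> {j<..n} \<longrightarrow>
    d v i + of_bool (v \<in> S \<and> k \<le> i) \<le> W u i + of_bool (u \<in> R))"

definition start_above :: "nat set \<Rightarrow> nat set \<Rightarrow> bool" where
  "start_above R S \<longleftrightarrow> (\<forall>v i. 1 \<le> v \<longrightarrow> i \<in> {j<..n} \<longrightarrow>
    residual d R v i + of_bool (v \<in> S \<and> k \<le> i) \<le> W v i)"

definition surplus where "surplus = {v. 1 \<le> v \<and> h v = d v n + 1}"
definition deficit where "deficit = {v. 1 \<le> v \<and> h v + 1 = d v n}"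
definition exact where "exact = {v. 1 \<le> v \<and> h v = d v n}"
text \<open>The diagram above falls short of the demand of such a column, and only a cell in the new
  row can supply the missing unit.\<close>

definition forced where "forced = {v \<in> exact. \<exists>i\<in>{j<..n}. W v i < d v i}"

text \<open>What a path needs if it crosses the row in a column \<open>u\<close> without a cell
  while column \<open>v\<close> carries the raised demand.\<close>

definition strong :: "nat \<Rightarrow> nat \<Rightarrow> bool" where
  "strong u v \<longleftrightarrow> (\<forall>i\<in>{j<..n}. d v i + of_bool (k \<le> i) \<le> W u i)"

text \<open>The part of the conditions that concerns only the diagram above, not the choice of the
  row.\<close>

definition feasible :: bool where
  "feasible \<longleftrightarrow> (\<forall>v\<ge>1. v \<in> surplus \<union> deficit \<union> exact) \<and>
    (\<forall>i\<in>{j<..n}. (\<forall>v\<in>deficit. d v i \<le> W v i + 1) \<and>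
      (\<forall>v\<in>surplus. d v i + of_bool (k \<le> i) \<le> W v i) \<and>
      (\<forall>v\<in>exact. d v i + of_bool (k \<le> i) \<le> W v i + 1))"

lemma d_antimono: "u \<le> v \<Longrightarrow> d v i \<le> d u i"
  using demand by (simp add: is_demand_def)

lemma d_supermodular: "u \<le> v \<Longrightarrow> i \<le> i' \<Longrightarrow> d u i + d v i' \<le> d u i' + d v i"
  using demand by (simp add: is_demand_def)

lemma d_eventually_0: "\<exists>N. \<forall>v\<ge>N. \<forall>i. d v i = 0"
  using demand by (simp add: is_demand_def)

lemma strong_mono:
  assumes "1 \<le> u" "u \<le> u'" "v' \<le> v" "strong u' v'"
  shows "strong u v"
  unfolding strong_def
proof
  fix i assume "i \<in> {j<..n}"
  then have "d v' i + of_bool (k \<le> i) \<le> W u' i" using assms(4) unfolding strong_def by blast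
  then show "d v i + of_bool (k \<le> i) \<le> W u i"
    using W_antimono[OF assms(1,2), of i] d_antimono[OF assms(3), of i] by linarith
qed

lemma finite_parts: "finite surplus" "finite deficit" "finite forced"
proof -
  obtain N where N: "\<And>v i. N \<le> v \<Longrightarrow> d v i = 0"
    using d_eventually_0 by blast
  show "finite surplus"
    by (rule finite_subset[OF _ h_finite]) (auto simp: surplus_def)
  have "v < N" if "v \<in> deficit \<union> forced" for v
  proof (rule ccontr)
    assume "\<not> v < N"
    then have "d v i = 0" for i using N[of v i] by simp
    then show False using that by (auto simp: deficit_def forced_def)
  qed
  then have "deficit \<union> forced \<subseteq> {..<N}" by auto
  then have "finite (deficit \<union> forced)" by (rule finite_subset) simp
  then show "finite deficit" "finite forced" by auto
qed

text \<open>Beyond all cells and all demand every column is exact with zero demand. These columns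
  supply the infinite last run.\<close>

lemma infinite_free: "infinite (exact - forced)"
proof -
  obtain N where N: "\<And>v i. N \<le> v \<Longrightarrow> d v i = 0"
    using d_eventually_0 by blast
  obtain M where M: "\<And>v. h v \<noteq> 0 \<Longrightarrow> v \<le> M"
    using h_finite finite_nat_set_iff_bounded_le by auto
  have "h v = 0" if "Suc M \<le> v" for v using M[of v] that by fastforce
  then have "exact \<supseteq> {Suc (M + N)..}"
    using N by (auto simp: exact_def)
  then have "infinite exact" using infinite_Ici infinite_super by blast
  then show ?thesis using finite_parts by (simp add: Diff_infinite_finite)
qed

text \<open>At \<open>i = n\<close> the relation needs \<open>W u n\<close> to be positive because
  \<open>k \<le> n\<close>, but \<open>W u n \<le> h u\<close> and \<open>h\<close> vanishes far to
  the right.\<close>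

lemma eventually_not_strong: "\<exists>N. \<forall>u\<ge>N. \<forall>v>u. \<not> strong u v"
proof -
  obtain M where M: "\<And>v. h v \<noteq> 0 \<Longrightarrow> v \<le> M"
    using h_finite finite_nat_set_iff_bounded_le by auto
  have "\<not> strong u v" if "Suc M \<le> u" for u v
  proof
    assume "strong u v"
    moreover have "n \<in> {j<..n}" using kn by simp
    ultimately have "d v n + of_bool (k \<le> n) \<le> W u n" unfolding strong_def by blast
    then have "1 \<le> W u n" using kn(1) by simp
    moreover have "h u = 0" using M[of u] that by fastforce
    ultimately show False using W_height[of u] that by simp
  qed
  then show ?thesis by blast
qed

lemma disjoint_parts:
  "surplus \<inter> deficit = {}" "surplus \<inter> exact = {}" "deficit \<inter> exact = {}" "forced \<subseteq> exact"
  "0 \<notin> surplus" "0 \<notin> deficit" "0 \<notin> exact"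
  by (auto simp: surplus_def deficit_def exact_def forced_def)

text \<open>Elements of \<open>forced\<close> belong to every \<open>R\<close>; they do not interact with the other elements of
  \<open>exact\<close>, since both \<open>d\<close> and \<open>W\<close> are supermodular.\<close>
lemma forced_strong:
  assumes feasible "u \<in> exact" "v \<in> exact" "u < v" "u \<in> forced \<longleftrightarrow> v \<notin> forced"
  shows "strong u v"
proof (rule ccontr)
  assume "\<not> strong u v"
  then obtain i1 where i1: "i1 \<in> {j<..n}" "W u i1 < d v i1 + of_bool (k \<le> i1)"
    by (auto simp: strong_def not_le)
  have u1: "1 \<le> u" using assms(2) by (simp add: exact_def)
  have weak: "d w i + of_bool (k \<le> i) \<le> W w i + 1" if "w \<in> exact" "i \<in> {j<..n}" for w i
    using assms(1) that by (simp add: feasible_def)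
  \<comment> \<open>From row \<open>k\<close> on, feasibility of an exact column gives
    \<open>d w i \<le> W w i\<close>, so a shortage lies before row \<open>k\<close>, while the
    failure of \<open>strong\<close> at \<open>i1\<close> turns out to need
    \<open>k \<le> i1\<close>. Supermodularity compares these two rows.\<close>
  have early: "i < k" if "W w i < d w i" "w \<in> exact" "i \<in> {j<..n}" for w i
    using weak[of w i] that by (cases "k \<le> i") auto
  note uv = less_imp_le[OF assms(4)]
  show False
  proof (cases "u \<in> forced")
    case True
    then obtain i0 where i0: "i0 \<in> {j<..n}" "W u i0 < d u i0" by (auto simp: forced_def)
    have v: "d v i \<le> W v i" if "i \<in> {j<..n}" for i
      using assms(3,5) True that by (auto simp: forced_def not_less)
    have "d v i1 \<le> W u i1" using v[OF i1(1)] W_antimono[OF u1 uv, of i1] by simp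
    then have k: "k \<le> i1" "W u i1 = d v i1" using i1(2) by (auto simp: of_bool_def split: if_splits)
    have "d u i1 \<le> W u i1" using weak[OF assms(2) i1(1)] k by simp
    moreover have "i0 \<le> i1" using early[OF i0(2) assms(2) i0(1)] k by simp
    ultimately show False
      using d_supermodular[OF uv, of i0 i1] d_antimono[OF uv, of i1] k i0 v[OF i0(1)]
        W_antimono[OF u1 uv, of i0] by simp
  next
    case False
    then have "v \<in> forced" using assms(5) by blast
    then obtain i0 where i0: "i0 \<in> {j<..n}" "W v i0 < d v i0" by (auto simp: forced_def)
    have u: "d u i \<le> W u i" if "i \<in> {j<..n}" for i
      using assms(2) False that by (auto simp: forced_def not_less)
    have "d v i1 \<le> W u i1" using u[OF i1(1)] d_antimono[OF uv, of i1] by simp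
    then have k: "k \<le> i1" "W u i1 = d v i1" using i1(2) by (auto simp: of_bool_def split: if_splits)
    have "d v i1 \<le> W v i1" using weak[OF assms(3) i1(1)] k by simp
    moreover have "i0 \<le> i1" using early[OF i0(2) assms(3) i0(1)] k by simp
    ultimately show False
      using W_supermodular[OF u1 uv, of i0 i1] d_antimono[OF uv, of i0] k i0 u[OF i0(1)] by simp
  qed
qed

lemma sizes_cases:
  assumes "sizes R S" "1 \<le> v"
  shows "v \<in> surplus \<and> v \<notin> R \<and> v \<in> S \<or> v \<in> deficit \<and> v \<in> R \<and> v \<notin> S \<or>
    v \<in> exact \<and> (v \<in> R \<longleftrightarrow> v \<in> S)"
  using assms unfolding sizes_def surplus_def deficit_def exact_def
  by (cases "v \<in> R"; cases "v \<in> S") auto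

lemma sizes_sets:
  assumes "sizes R S" "forced \<subseteq> R" "Y = (R \<inter> exact) - forced"
  shows "R = deficit \<union> forced \<union> Y" "S = surplus \<union> forced \<union> Y" "finite Y" "Y \<subseteq> exact - forced"
proof -
  note c = sizes_cases[OF assms(1)]
  have zero: "0 \<notin> R" "0 \<notin> S" using assms(1) by (auto simp: sizes_def)
  have "v \<in> R \<longleftrightarrow> v \<in> deficit \<union> forced \<union> Y" for v
    using c[of v] zero disjoint_parts assms(2,3) by (cases "v = 0") (auto simp: Suc_le_eq)
  then show "R = deficit \<union> forced \<union> Y" by blast
  have "v \<in> S \<longleftrightarrow> v \<in> surplus \<union> forced \<union> Y" for v
    using c[of v] zero disjoint_parts assms(2,3) by (cases "v = 0") (auto simp: Suc_le_eq)
  then show "S = surplus \<union> forced \<union> Y" by blast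
  show "finite Y" "Y \<subseteq> exact - forced" using assms(1,3) by (auto simp: sizes_def)
qed

lemma sizes_of_parts:
  assumes feasible "finite Y" "Y \<subseteq> exact - forced"
  shows "sizes (deficit \<union> forced \<union> Y) (surplus \<union> forced \<union> Y)"
proof -
  have "h v + of_bool (v \<in> deficit \<union> forced \<union> Y) = d v n + of_bool (v \<in> surplus \<union> forced \<union> Y)"
    if "1 \<le> v" for v
  proof -
    have "v \<in> surplus \<or> v \<in> deficit \<or> v \<in> exact"
      using assms(1) that by (auto simp: feasible_def)
    then consider "v \<in> surplus" "v \<notin> deficit" "v \<notin> exact" | "v \<in> deficit" "v \<notin> surplus" "v \<notin> exact"
      | "v \<in> exact" "v \<notin> surplus" "v \<notin> deficit"
      using disjoint_parts by blast
    then show ?thesis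
    proof cases
      case 1
      then have "v \<notin> forced \<union> Y" using assms(3) disjoint_parts by blast
      then show ?thesis using 1 by (auto simp: surplus_def)
    next
      case 2
      then have "v \<notin> forced \<union> Y" using assms(3) disjoint_parts by blast
      then show ?thesis using 2 by (auto simp: deficit_def)
    next
      case 3
      then show ?thesis by (auto simp: exact_def)
    qed
  qed
  then show ?thesis
    unfolding sizes_def using finite_parts assms disjoint_parts by auto
qed

text \<open>The second hypothesis is the case \<open>u = v\<close> of \<open>start_below\<close>,
  and \<open>start_above\<close> implies it too. Hence both conditions share feasibility and the
  forced columns.\<close>

lemma feasibleI:
  assumes "sizes R S"
    and "\<And>v i. 1 \<le> v \<Longrightarrow> i \<in> {j<..n} \<Longrightarrow> d v i + of_bool (v \<in> S \<and> k \<le> i) \<le> W v i + of_bool (v \<in> R)"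
  shows feasible "forced \<subseteq> R"
proof -
  show "forced \<subseteq> R"
  proof
    fix v assume "v \<in> forced"
    then obtain i where "1 \<le> v" "i \<in> {j<..n}" "W v i < d v i" by (auto simp: forced_def exact_def)
    then show "v \<in> R" using assms(2)[of v i] by (cases "v \<in> R") auto
  qed
  show feasible
    unfolding feasible_def
  proof (intro conjI allI impI ballI)
    show "v \<in> surplus \<union> deficit \<union> exact" if "1 \<le> v" for v
      using sizes_cases[OF assms(1) that] by blast
    fix i assume i: "i \<in> {j<..n}"
    show "d v i \<le> W v i + 1" if "v \<in> deficit" for v
      using that assms(2)[of v i] i by (auto simp: deficit_def of_bool_def split: if_splits)
    show "d v i + of_bool (k \<le> i) \<le> W v i" if "v \<in> surplus" for v
    proof -
      have "1 \<le> v" using that by (simp add: surplus_def)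
      moreover have "v \<notin> R" "v \<in> S" using sizes_cases[OF assms(1) \<open>1 \<le> v\<close>] that disjoint_parts by auto
      ultimately show ?thesis using assms(2)[of v i] i by simp
    qed
    show "d v i + of_bool (k \<le> i) \<le> W v i + 1" if "v \<in> exact" for v
    proof -
      have "1 \<le> v" using that by (simp add: exact_def)
      moreover have "v \<in> R \<longleftrightarrow> v \<in> S" using sizes_cases[OF assms(1) \<open>1 \<le> v\<close>] that disjoint_parts by auto
      ultimately show ?thesis using assms(2)[of v i] i by (auto simp: of_bool_def split: if_splits)
    qed
  qed
qed

text \<open>Heights fix \<open>R\<close> and \<open>S\<close> outside \<open>exact\<close>, where
  they agree. After feasibility and \<open>forced_strong\<close>, the only open constraints are
  between a column \<open>u\<close> left out of \<open>R\<close> and a later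
  \<open>v \<in> S\<close>, both free: exactly the lower set condition.\<close>

lemma start_below_iff:
  "sizes R S \<and> start_below R S \<longleftrightarrow>
    feasible \<and> (\<exists>Y\<in>lower_sets strong (exact - forced). R = deficit \<union> forced \<union> Y \<and> S = surplus \<union> forced \<union> Y)"
proof
  assume RS: "sizes R S \<and> start_below R S"
  then have B: "d v i + of_bool (v \<in> S \<and> k \<le> i) \<le> W u i + of_bool (u \<in> R)"
    if "1 \<le> u" "u \<le> v" "i \<in> {j<..n}" for u v i
    using that by (simp add: start_below_def)
  note f = feasibleI[OF conjunct1[OF RS] B[OF _ order_refl]]
  define Y where "Y = (R \<inter> exact) - forced"
  note s = sizes_sets[OF conjunct1[OF RS] f(2) Y_def]
  have "strong u v" if "u \<in> exact - forced - Y" "v \<in> Y" "u < v" for u v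
  proof -
    have "u \<notin> R" using that(1) unfolding Y_def by blast
    moreover have "v \<in> S" using that(2) s(2) by blast
    moreover have "1 \<le> u" using that(1) by (simp add: exact_def)
    ultimately show ?thesis using B[of u v] that(3) by (auto simp: strong_def)
  qed
  then have "Y \<in> lower_sets strong (exact - forced)"
    using s(3,4) by (auto simp: lower_sets_def)
  then show "feasible \<and> (\<exists>Y\<in>lower_sets strong (exact - forced).
      R = deficit \<union> forced \<union> Y \<and> S = surplus \<union> forced \<union> Y)"
    using f(1) s(1,2) by blast
next
  assume "feasible \<and> (\<exists>Y\<in>lower_sets strong (exact - forced).
      R = deficit \<union> forced \<union> Y \<and> S = surplus \<union> forced \<union> Y)"
  then obtain Y where f: feasible and Y: "finite Y" "Y \<subseteq> exact - forced"
    "\<And>u v. u \<in> exact - forced - Y \<Longrightarrow> v \<in> Y \<Longrightarrow> u < v \<Longrightarrow> strong u v"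
    and R: "R = deficit \<union> forced \<union> Y" and S: "S = surplus \<union> forced \<union> Y"
    by (auto simp: lower_sets_def)
  have rs: "sizes R S" unfolding R S using sizes_of_parts[OF f Y(1,2)] .
  have "d v i + of_bool (v \<in> S \<and> k \<le> i) \<le> W u i + of_bool (u \<in> R)"
    if u: "1 \<le> u" "u \<le> v" and i: "i \<in> {j<..n}" for u v i
  proof -
    note W = W_antimono[OF u, of i] and dd = d_antimono[OF u(2), of i]
    have v1: "1 \<le> v" using u by simp
    have F: "\<And>v. v \<in> deficit \<Longrightarrow> d v i \<le> W v i + 1"
      "\<And>v. v \<in> surplus \<Longrightarrow> d v i + of_bool (k \<le> i) \<le> W v i"
      "\<And>v. v \<in> exact \<Longrightarrow> d v i + of_bool (k \<le> i) \<le> W v i + 1"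
      "\<And>v. v \<in> exact \<Longrightarrow> v \<notin> forced \<Longrightarrow> d v i \<le> W v i"
      using f i by (auto simp: feasible_def forced_def not_less)
    have st: "d v i + of_bool (k \<le> i) \<le> W u i" if "strong u v"
      using that i by (simp add: strong_def)
    show ?thesis
    proof (cases "v \<in> surplus")
      case True
      then show ?thesis using F(2)[OF True] W by auto
    next
      case nsur: False
      show ?thesis
      proof (cases "u \<in> R")
        case True
        have "d v i + of_bool (v \<in> S \<and> k \<le> i) \<le> W v i + 1"
        proof (cases "v \<in> exact")
          case True
          then show ?thesis using F(3)[OF True] by (auto simp: of_bool_def split: if_splits)
        next
          case False
          then have "v \<in> deficit" "v \<notin> S"
            using sizes_cases[OF rs v1] nsur by auto
          then show ?thesis using F(1)[of v] by simp
        qed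
        then show ?thesis using W True by simp
      next
        case uR: False
        have "u \<in> surplus \<or> u \<in> exact - forced - Y"
          using sizes_cases[OF rs u(1)] uR R by blast
        then show ?thesis
        proof
          assume "u \<in> surplus"
          then show ?thesis using F(2)[of u] dd by auto
        next
          assume u': "u \<in> exact - forced - Y"
          then have "d v i \<le> W u i" using F(4)[of u] dd by auto
          moreover have "strong u v" if "v \<in> S"
          proof -
            have "v \<in> forced \<union> Y" using that S nsur by blast
            moreover have "u \<noteq> v" using uR that sizes_cases[OF rs v1] nsur by blast
            ultimately show ?thesis
              using Y(2,3) u' u(2) forced_strong[OF f, of u v] disjoint_parts(4) by fastforce
          qed
          ultimately show ?thesis using st by auto
        qed
      qed
    qed
  qed
  then show "sizes R S \<and> start_below R S"
    using rs by (simp add: start_below_def)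
qed

text \<open>Now the roles are reversed: for \<open>u \<in> Y\<close>, the residual still contains
  the demand of the next column outside \<open>R\<close>, so the binding pairs have \<open>u\<close>
  chosen and a later \<open>v\<close> not chosen.\<close>

lemma start_above_iff:
  "sizes R S \<and> start_above R S \<longleftrightarrow>
    feasible \<and> (\<exists>Y\<in>upper_sets strong (exact - forced). R = deficit \<union> forced \<union> Y \<and> S = surplus \<union> forced \<union> Y)"
proof
  assume RS: "sizes R S \<and> start_above R S"
  then have A: "residual d R v i + of_bool (v \<in> S \<and> k \<le> i) \<le> W v i"
    if "1 \<le> v" "i \<in> {j<..n}" for v i
    using that by (simp add: start_above_def)
  have fin: "finite R" using RS by (simp add: sizes_def)
  have B: "d v i + of_bool (v \<in> S \<and> k \<le> i) \<le> W v i + of_bool (v \<in> R)"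
    if "1 \<le> v" "i \<in> {j<..n}" for v i
  proof (cases "v \<in> R")
    case True
    have "d v i \<le> residual d R v i + 1" by (simp add: residual_def)
    then show ?thesis using A[OF that] True by simp
  qed (use A[OF that] residual_notin in simp)
  note f = feasibleI[OF conjunct1[OF RS] B]
  define Y where "Y = (R \<inter> exact) - forced"
  note s = sizes_sets[OF conjunct1[OF RS] f(2) Y_def]
  have "strong u v" if "u \<in> Y" "v \<in> exact - forced - Y" "u < v" for u v
  proof -
    have uv: "v \<notin> R" "u \<in> S" "1 \<le> u"
      using that(1,2) s(2,4) unfolding Y_def by (blast, blast, auto simp: exact_def)
    have le: "d v i \<le> residual d R u i" for i
      using d_antimono[OF next_free(3)[OF fin less_imp_le[OF that(3)] uv(1)], of i]
      by (simp add: residual_def)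
    have "d v i + of_bool (k \<le> i) \<le> W u i" if "i \<in> {j<..n}" for i
    proof -
      have "residual d R u i + of_bool (k \<le> i) \<le> W u i" using A[OF uv(3) that] uv(2) by simp
      then show ?thesis using le[of i] by linarith
    qed
    then show ?thesis by (simp add: strong_def)
  qed
  then have "Y \<in> upper_sets strong (exact - forced)"
    using s(3,4) by (auto simp: upper_sets_def)
  then show "feasible \<and> (\<exists>Y\<in>upper_sets strong (exact - forced).
      R = deficit \<union> forced \<union> Y \<and> S = surplus \<union> forced \<union> Y)"
    using f(1) s(1,2) by blast
next
  assume "feasible \<and> (\<exists>Y\<in>upper_sets strong (exact - forced).
      R = deficit \<union> forced \<union> Y \<and> S = surplus \<union> forced \<union> Y)"
  then obtain Y where f: feasible and Y: "finite Y" "Y \<subseteq> exact - forced"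
    "\<And>u v. u \<in> Y \<Longrightarrow> v \<in> exact - forced - Y \<Longrightarrow> u < v \<Longrightarrow> strong u v"
    and R: "R = deficit \<union> forced \<union> Y" and S: "S = surplus \<union> forced \<union> Y"
    by (auto simp: upper_sets_def)
  have rs: "sizes R S" unfolding R S using sizes_of_parts[OF f Y(1,2)] .
  then have fin: "finite R" by (simp add: sizes_def)
  have "residual d R v i + of_bool (v \<in> S \<and> k \<le> i) \<le> W v i" if v: "1 \<le> v" and i: "i \<in> {j<..n}" for v i
  proof -
    have F: "\<And>v. v \<in> deficit \<Longrightarrow> d v i \<le> W v i + 1"
      "\<And>v. v \<in> surplus \<Longrightarrow> d v i + of_bool (k \<le> i) \<le> W v i"
      "\<And>v. v \<in> exact \<Longrightarrow> d v i + of_bool (k \<le> i) \<le> W v i + 1"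
      "\<And>v. v \<in> exact \<Longrightarrow> v \<notin> forced \<Longrightarrow> d v i \<le> W v i"
      using f i by (auto simp: feasible_def forced_def not_less)
    show ?thesis
    proof (cases "v \<in> R")
      case False
      then have "v \<in> surplus \<or> v \<in> exact - forced \<and> v \<notin> S"
        using sizes_cases[OF rs v] R by blast
      then show ?thesis using F(2,4)[of v] residual_notin[OF False] by auto
    next
      case vR: True
      define w where "w = next_free R v"
      have w: "v \<le> w" "w \<notin> R" "1 \<le> w" using next_free[OF fin, of v] v by (auto simp: w_def)
      then have "v < w" using vR by (metis le_neq_implies_less)
      have w': "w \<in> surplus \<or> w \<in> exact - forced - Y"
        using sizes_cases[OF rs w(3)] w(2) R by blast
      note W = W_antimono[OF v w(1), of i]
      have dw: "d w i \<le> W v i" using w' F(2,4)[of w] W by auto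
      \<comment> \<open>If \<open>d v i = 0\<close>, the truncated subtraction in
        \<open>residual\<close> removes nothing; the bound then comes from
        \<open>d2\<close>.\<close>
      have d1: "d v i - 1 + of_bool (v \<in> S \<and> k \<le> i) \<le> W v i \<or> d v i = 0"
      proof (cases "v \<in> exact")
        case True
        then show ?thesis using F(3)[OF True] by (auto simp: of_bool_def split: if_splits)
      next
        case False
        then have "v \<in> deficit" "v \<notin> S" using sizes_cases[OF rs v] vR by auto
        then show ?thesis using F(1)[of v] by (simp add: le_diff_conv)
      qed
      have d2: "d w i + of_bool (v \<in> S \<and> k \<le> i) \<le> W v i"
      proof (cases "v \<in> S")
        case True
        then have vv: "v \<in> forced \<union> Y" using vR R S disjoint_parts by blast
        show ?thesis
        proof (cases "w \<in> surplus")
          case True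
          then show ?thesis using F(2)[of w] W by (auto simp: of_bool_def split: if_splits)
        next
          case False
          then have "w \<in> exact - forced - Y" using w' by blast
          then have "strong v w"
            using vv Y(2,3) \<open>v < w\<close> forced_strong[OF f, of v w] disjoint_parts(4) by fastforce
          then have "d w i + of_bool (k \<le> i) \<le> W v i" using i unfolding strong_def by blast
          then show ?thesis by (auto simp: of_bool_def split: if_splits)
        qed
      qed (use dw in simp)
      then show ?thesis
        using d1 d2 by (auto simp: residual_def w_def[symmetric] max_def)
    qed
  qed
  then show "sizes R S \<and> start_above R S"
    using rs by (simp add: start_above_def)
qed

text \<open>If feasible, \<open>card R\<close> and \<open>card S\<close> differ from
  \<open>card Y\<close> by constants, so enlarging the free part by \<open>t\<close> raises both by
  \<open>t\<close>. Otherwise both sides are empty.\<close>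

lemma row_bij:
  "\<exists>f. bij_betw f (SIGMA t:{..m}. {R. \<exists>S. card S = m - t \<and> sizes R S \<and> start_above R S})
      {R. \<exists>S. card S = m \<and> sizes R S \<and> start_below R S} \<and>
    (\<forall>t R S. t \<le> m \<longrightarrow> card S = m - t \<longrightarrow> sizes R S \<longrightarrow> start_above R S \<longrightarrow> card (f (t, R)) = card R + t)"
  (is "\<exists>f. bij_betw f (SIGMA t:{..m}. ?E t) ?V \<and> _")
proof (cases feasible)
  case False
  then have none: "\<not> (sizes R S \<and> start_above R S)" "\<not> (sizes R S \<and> start_below R S)" for R S
    using start_above_iff start_below_iff by blast+
  have e: "(SIGMA t:{..m}. ?E t) = {}" using none(1) by blast
  have v: "?V = {}" using none(2) by blast
  show ?thesis unfolding e v using none(1) by (auto simp: bij_betw_def)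
next
  case True
  let ?Z = "exact - forced"
  have mono: "strong u v" if "u \<in> ?Z" "u \<le> u'" "u' < v'" "v' \<le> v" "strong u' v'" for u u' v v'
    by (rule strong_mono[OF _ that(2,4,5)]) (use that(1) in \<open>simp add: exact_def\<close>)
  have ex: "\<exists>g. bij_betw g (upper_sets strong ?Z \<times> UNIV) (lower_sets strong ?Z) \<and>
      (\<forall>Y\<in>upper_sets strong ?Z. \<forall>t. card (g (Y, t)) = card Y + t)"
    by (rule upper_sets_lower_sets_bij[OF infinite_free], rule mono) (assumption+, fact eventually_not_strong)
  obtain g where g: "bij_betw g (upper_sets strong ?Z \<times> UNIV) (lower_sets strong ?Z)"
    "\<And>Y t. Y \<in> upper_sets strong ?Z \<Longrightarrow> card (g (Y, t)) = card Y + t"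
    using ex by blast
  define R where "R Y = deficit \<union> forced \<union> Y" for Y
  define S where "S Y = surplus \<union> forced \<union> Y" for Y
  define c where "c = card surplus + card forced"
  have Ydis: "Y \<inter> (deficit \<union> forced) = {}" "Y \<inter> (surplus \<union> forced) = {}" if "Y \<subseteq> ?Z" for Y
    using that disjoint_parts by auto
  have RY: "R Y - (deficit \<union> forced) = Y" if "Y \<subseteq> ?Z" for Y
    using Ydis[OF that] by (auto simp: R_def)
  have cardR: "card (R Y) = card (deficit \<union> forced) + card Y"
    and cardS: "card (S Y) = c + card Y" if "finite Y" "Y \<subseteq> ?Z" for Y
  proof -
    show "card (R Y) = card (deficit \<union> forced) + card Y"
      unfolding R_def using that finite_parts Ydis[OF that(2)] by (intro card_Un_disjoint) auto
    have "card (S Y) = card (surplus \<union> forced) + card Y"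
      unfolding S_def using that finite_parts Ydis[OF that(2)] by (intro card_Un_disjoint) auto
    moreover have "surplus \<inter> forced = {}" using disjoint_parts by auto
    ultimately show "card (S Y) = c + card Y"
      using finite_parts by (simp add: c_def card_Un_disjoint)
  qed
  have up: "finite Y" "Y \<subseteq> ?Z" if "Y \<in> upper_sets strong ?Z" for Y
    using that by (auto simp: upper_sets_def)
  have lo: "finite Y" "Y \<subseteq> ?Z" if "Y \<in> lower_sets strong ?Z" for Y
    using that by (auto simp: lower_sets_def)
  have E: "?E t = R ` {Y \<in> upper_sets strong ?Z. c + card Y = m - t}" for t
  proof -
    have "(\<exists>S. card S = m - t \<and> sizes Q S \<and> start_above Q S) \<longleftrightarrow>
        Q \<in> R ` {Y \<in> upper_sets strong ?Z. c + card Y = m - t}" for Q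
    proof -
      have "(\<exists>S. card S = m - t \<and> sizes Q S \<and> start_above Q S) \<longleftrightarrow>
          (\<exists>Y\<in>upper_sets strong ?Z. Q = R Y \<and> card (S Y) = m - t)"
        unfolding start_above_iff R_def[symmetric] S_def[symmetric] using True by blast
      also have "\<dots> \<longleftrightarrow> (\<exists>Y\<in>upper_sets strong ?Z. Q = R Y \<and> c + card Y = m - t)"
        using cardS up by (intro bex_cong) auto
      finally show ?thesis by blast
    qed
    then show ?thesis by blast
  qed
  have V: "?V = R ` {Y \<in> lower_sets strong ?Z. c + card Y = m}"
  proof -
    have "(\<exists>S. card S = m \<and> sizes Q S \<and> start_below Q S) \<longleftrightarrow>
        Q \<in> R ` {Y \<in> lower_sets strong ?Z. c + card Y = m}" for Q
    proof -
      have "(\<exists>S. card S = m \<and> sizes Q S \<and> start_below Q S) \<longleftrightarrow>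
          (\<exists>Y\<in>lower_sets strong ?Z. Q = R Y \<and> card (S Y) = m)"
        unfolding start_below_iff R_def[symmetric] S_def[symmetric] using True by blast
      also have "\<dots> \<longleftrightarrow> (\<exists>Y\<in>lower_sets strong ?Z. Q = R Y \<and> c + card Y = m)"
        using cardS lo by (intro bex_cong) auto
      finally show ?thesis by blast
    qed
    then show ?thesis by blast
  qed
  define f where "f = (\<lambda>(t, Q). R (g (Q - (deficit \<union> forced), t)))"
  have fR: "f (t, R Y) = R (g (Y, t))" if "Y \<in> upper_sets strong ?Z" for t Y
    using RY[OF up(2)[OF that]] by (simp add: f_def)
  have gl: "g (Y, t) \<in> lower_sets strong ?Z" if "Y \<in> upper_sets strong ?Z" for Y t
    using g(1) that by (auto simp: bij_betw_def)
  have "bij_betw f (SIGMA t:{..m}. ?E t) ?V"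
    unfolding bij_betw_def
  proof
    show "inj_on f (SIGMA t:{..m}. ?E t)"
    proof (rule inj_onI, unfold E)
      fix x y assume x: "x \<in> (SIGMA t:{..m}. R ` {Y \<in> upper_sets strong ?Z. c + card Y = m - t})"
        and y: "y \<in> (SIGMA t:{..m}. R ` {Y \<in> upper_sets strong ?Z. c + card Y = m - t})" and eq: "f x = f y"
      obtain t Y where x': "x = (t, R Y)" "Y \<in> upper_sets strong ?Z" using x by auto
      obtain s X where y': "y = (s, R X)" "X \<in> upper_sets strong ?Z" using y by auto
      have "R (g (Y, t)) = R (g (X, s))" using eq x' y' fR by simp
      then have "g (Y, t) = g (X, s)" using RY lo(2) gl x'(2) y'(2) by metis
      then have "(Y, t) = (X, s)"
        using inj_onD[OF bij_betw_imp_inj_on[OF g(1)], of "(Y, t)" "(X, s)"] x' y' by simp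
      then show "x = y" using x' y' by simp
    qed
    show "f ` (SIGMA t:{..m}. ?E t) = ?V"
      unfolding E V
    proof (intro subset_antisym subsetI)
      fix Q assume "Q \<in> f ` (SIGMA t:{..m}. R ` {Y \<in> upper_sets strong ?Z. c + card Y = m - t})"
      then obtain t Y where "t \<le> m" "Y \<in> upper_sets strong ?Z" "c + card Y = m - t" "Q = f (t, R Y)" by auto
      then show "Q \<in> R ` {Y \<in> lower_sets strong ?Z. c + card Y = m}"
        using fR gl g(2) by auto
    next
      fix Q assume "Q \<in> R ` {Y \<in> lower_sets strong ?Z. c + card Y = m}"
      then obtain X where X: "X \<in> lower_sets strong ?Z" "c + card X = m" "Q = R X" by auto
      have "X \<in> g ` (upper_sets strong ?Z \<times> UNIV)"
        unfolding bij_betw_imp_surj_on[OF g(1)] by (rule X(1))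
      then obtain Y t where Y: "Y \<in> upper_sets strong ?Z" "g (Y, t) = X" by blast
      have "card X = card Y + t" using g(2)[OF Y(1), of t] Y(2) by simp
      then have "t \<in> {..m}" "c + card Y = m - t" using X(2) by auto
      then have mem: "(t, R Y) \<in> (SIGMA t:{..m}. R ` {Y \<in> upper_sets strong ?Z. c + card Y = m - t})"
        using Y(1) by blast
      have eq: "f (t, R Y) = Q" using fR[OF Y(1)] Y(2) X(3) by simp
      show "Q \<in> f ` (SIGMA t:{..m}. R ` {Y \<in> upper_sets strong ?Z. c + card Y = m - t})"
        using imageI[OF mem, of f] unfolding eq .
    qed
  qed
  moreover have "card (f (t, Q)) = card Q + t"
    if T: "card T = m - t" "sizes Q T" "start_above Q T" for t Q T
  proof -
    obtain Y where Y: "Y \<in> upper_sets strong ?Z" "Q = R Y"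
      using start_above_iff[of Q T] T(2,3) unfolding R_def by blast
    then show ?thesis
      using fR[OF Y(1)] cardR[OF up[OF Y(1)]] cardR[OF lo[OF gl[OF Y(1)]]] g(2)[OF Y(1)] by simp
  qed
  ultimately show ?thesis by blast
qed

end

section \<open>The weight-preserving bijection\<close>

text \<open>Meaningful for \<open>1 \<le> v\<close>; no staircase has bound
  \<open>0\<close>.\<close>

definition min_count :: "cell set \<Rightarrow> nat \<Rightarrow> nat \<Rightarrow> nat \<Rightarrow> nat" where
  "min_count T j v i = (LEAST x. \<exists>f. staircase v f \<and> path_count T f j i = x)"

lemma min_count_le: "staircase v f \<Longrightarrow> min_count T j v i \<le> path_count T f j i"
  unfolding min_count_def by (rule Least_le) blast

lemma min_count_attained:
  assumes "1 \<le> v"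
  obtains f where "staircase v f" "path_count T f j i = min_count T j v i"
proof -
  have "\<exists>x f. staircase v f \<and> path_count T f j i = x"
    using staircase_const[OF assms order_refl] by blast
  from LeastI_ex[OF this] show thesis
    using that unfolding min_count_def by blast
qed

lemma le_min_count_iff:
  assumes "1 \<le> v"
  shows "x \<le> min_count T j v i \<longleftrightarrow> (\<forall>f. staircase v f \<longrightarrow> x \<le> path_count T f j i)"
proof
  assume "x \<le> min_count T j v i"
  then show "\<forall>f. staircase v f \<longrightarrow> x \<le> path_count T f j i"
    using min_count_le order_trans by blast
next
  assume x: "\<forall>f. staircase v f \<longrightarrow> x \<le> path_count T f j i"
  obtain f where "staircase v f" "path_count T f j i = min_count T j v i"
    using min_count_attained[OF assms] by blast
  then show "x \<le> min_count T j v i" using x by metis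
qed

lemma min_count_antimono:
  assumes "1 \<le> u" "u \<le> v"
  shows "min_count T j v i \<le> min_count T j u i"
proof -
  obtain f where f: "staircase u f" "path_count T f j i = min_count T j u i"
    using min_count_attained[OF assms(1)] by blast
  then have "staircase v f"
    using assms(2) unfolding staircase_def by (meson order_trans)
  then show ?thesis using min_count_le f(2) by metis
qed

text \<open>Two paths are replaced by their pointwise minimum and maximum.\<close>
lemma min_count_supermodular:
  assumes "1 \<le> u" "u \<le> v" "i \<le> i'"
  shows "min_count T j u i + min_count T j v i' \<le> min_count T j u i' + min_count T j v i"
proof -
  obtain f where f: "staircase u f" "path_count T f j i' = min_count T j u i'"
    using min_count_attained[OF assms(1)] by blast
  obtain f' where f': "staircase v f'" "path_count T f' j i = min_count T j v i"
    using min_count_attained[OF order_trans[OF assms(1,2)]] by blast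
  define g where "g r = min (f r) (f' r)" for r
  define g' where "g' r = (if r \<le> i then max (f r) (f' r) else f r)" for r
  have g: "staircase u g"
  proof (rule staircaseI)
    show "g s \<le> g r" if "r \<le> s" for r s
      using staircaseD(2)[OF f(1) that] staircaseD(2)[OF f'(1) that] by (auto simp: g_def min_def)
    show "1 \<le> g r" "g r \<le> u" for r
      using staircaseD(3,4)[OF f(1), of r] staircaseD(3,4)[OF f'(1), of r] by (auto simp: g_def min_def)
  qed
  have g': "staircase v g'"
  proof (rule staircaseI)
    show "g' s \<le> g' r" if "r \<le> s" for r s
      using staircaseD(2)[OF f(1) that] staircaseD(2)[OF f'(1) that] that by (auto simp: g'_def max_def)
    show "1 \<le> g' r" "g' r \<le> v" for r
      using staircaseD(3,4)[OF f(1), of r] staircaseD(3,4)[OF f'(1), of r] assms(2)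
      by (auto simp: g'_def max_def)
  qed
  have ext: "path_count T p j i = (\<Sum>r\<in>{j<..i'}. of_bool (r \<le> i \<and> (p r, r) \<in> T))" for p
    unfolding path_count_def using assms(3) by (intro sum.mono_neutral_cong_left) auto
  have "path_count T g j i + path_count T g' j i' = path_count T f j i' + path_count T f' j i"
    unfolding ext unfolding path_count_def sum.distrib[symmetric]
    by (rule sum.cong) (auto simp: g_def g'_def min_def max_def)
  then show ?thesis
    using min_count_le[OF g, of T j i] min_count_le[OF g', of T j i'] f(2) f'(2) by linarith
qed

lemma min_count_height:
  assumes "in_rows j n T" "1 \<le> v"
  shows "min_count T j v n \<le> card (col T v)"
  using min_count_le[OF staircase_const[OF assms(2) order_refl], of T j n] path_count_const[OF assms(1)]
  by simp

section \<open>Separating the lowest row\<close>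

lemma in_rowsD:
  assumes "in_rows j n T" "(c, r) \<in> T"
  shows "1 \<le> c" "j < r" "r \<le> n"
  using assms unfolding in_rows_def by blast+

definition add_row :: "nat \<Rightarrow> nat set \<Rightarrow> cell set \<Rightarrow> cell set" where
  "add_row j R U = R \<times> {Suc j} \<union> U"

lemma add_row_inject:
  assumes "in_rows (Suc j) n U" "in_rows (Suc j) n U'"
  shows "add_row j R U = add_row j R' U' \<longleftrightarrow> R = R' \<and> U = U'"
proof
  assume eq: "add_row j R U = add_row j R' U'"
  have *: "R = {c. (c, Suc j) \<in> add_row j R U}" "U = {x \<in> add_row j R U. snd x \<noteq> Suc j}"
    if "in_rows (Suc j) n U" for R U
    using that by (auto simp: add_row_def dest: in_rowsD(2))
  show "R = R' \<and> U = U'" using *[OF assms(1), of R] *[OF assms(2), of R'] eq by simp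
qed simp

lemma in_rows_add_row:
  "in_rows (Suc j) n U \<Longrightarrow> finite R \<Longrightarrow> 0 \<notin> R \<Longrightarrow> j < n \<Longrightarrow> in_rows j n (add_row j R U)"
  unfolding in_rows_def add_row_def by (fastforce simp: Suc_le_eq intro: gr0I)

lemma add_row_cases:
  assumes "in_rows j n T"
  obtains R U where "T = add_row j R U" "finite R" "0 \<notin> R" "in_rows (Suc j) n U"
proof
  let ?R = "{c. (c, Suc j) \<in> T}" and ?U = "{x \<in> T. snd x \<noteq> Suc j}"
  show "T = add_row j ?R ?U" by (auto simp: add_row_def)
  have "?R \<subseteq> fst ` T" by (force simp: image_iff)
  then show "finite ?R" using assms finite_surj unfolding in_rows_def by blast
  show "0 \<notin> ?R" using assms by (auto simp: in_rows_def)
  have "1 \<le> c \<and> Suc j < r \<and> r \<le> n" if "(c, r) \<in> ?U" for c r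
    using in_rowsD[OF assms, of c r] that by auto
  moreover have "finite ?U" using assms by (simp add: in_rows_def)
  ultimately show "in_rows (Suc j) n ?U" unfolding in_rows_def by blast
qed

lemma wt_add_row:
  assumes "in_rows (Suc j) n U"
  shows "wt (add_row j R U) = single_part (card R) (Suc j) + wt U"
proof
  fix i
  have "{c. (c, i) \<in> add_row j R U} = (if i = Suc j then R else {c. (c, i) \<in> U})"
    using assms by (auto simp: add_row_def dest: in_rowsD(2))
  moreover have "{c. (c, Suc j) \<in> U} = {}"
    using assms by (auto dest: in_rowsD(2))
  ultimately show "wt (add_row j R U) i = (single_part (card R) (Suc j) + wt U) i"
    by (simp add: wt_def single_part_def)
qed

lemma card_col_add_row:
  assumes "in_rows (Suc j) n U"
  shows "card (col (add_row j R U) v) = card (col U v) + of_bool (v \<in> R)"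
proof -
  have "(\<lambda>r. (v, r)) -` U = col U v" by auto
  then have "finite (col U v)"
    using assms finite_vimageI[of U "\<lambda>r. (v, r)"] by (auto simp: in_rows_def inj_def)
  moreover have "Suc j \<notin> col U v" using assms by (auto dest: in_rowsD(2))
  moreover have "col (add_row j R U) v = (if v \<in> R then insert (Suc j) (col U v) else col U v)"
    by (auto simp: add_row_def)
  ultimately show ?thesis by simp
qed

lemma path_count_add_row:
  assumes "in_rows (Suc j) n U" "j < i"
  shows "path_count (add_row j R U) f j i = path_count U f (Suc j) i + of_bool (f (Suc j) \<in> R)"
proof -
  have "{j<..i} = insert (Suc j) {Suc j<..i}" using assms(2) by auto
  moreover have "(\<Sum>r\<in>{Suc j<..i}. of_bool ((f r, r) \<in> add_row j R U)) =
      (\<Sum>r\<in>{Suc j<..i}. of_bool ((f r, r) \<in> U) :: nat)"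
    by (rule sum.cong) (auto simp: add_row_def)
  moreover have "(f (Suc j), Suc j) \<in> add_row j R U \<longleftrightarrow> f (Suc j) \<in> R"
    using assms(1) by (auto simp: add_row_def dest: in_rowsD(2))
  ultimately show ?thesis by (simp add: path_count_def)
qed

text \<open>A path is cut after row \<open>Suc j\<close>: its column \<open>u\<close> there is the
  bound for the remaining path, and any continuation with bound \<open>u\<close> can be prolonged
  downwards by the constant \<open>u\<close>.\<close>

lemma le_min_count_add_row:
  assumes U: "in_rows (Suc j) n U" and "j < i" "1 \<le> v"
  shows "x \<le> min_count (add_row j R U) j v i \<longleftrightarrow>
    (\<forall>u. 1 \<le> u \<longrightarrow> u \<le> v \<longrightarrow> x \<le> min_count U (Suc j) u i + of_bool (u \<in> R))"
proof
  assume x: "x \<le> min_count (add_row j R U) j v i"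
  show "\<forall>u. 1 \<le> u \<longrightarrow> u \<le> v \<longrightarrow> x \<le> min_count U (Suc j) u i + of_bool (u \<in> R)"
  proof (intro allI impI)
    fix u assume u: "1 \<le> u" "u \<le> v"
    obtain f where f: "staircase u f" "path_count U f (Suc j) i = min_count U (Suc j) u i"
      using min_count_attained[OF u(1)] by blast
    define g where "g r = (if r \<le> Suc j then u else f r)" for r
    have "staircase v g"
    proof (rule staircaseI)
      show "g s \<le> g r" if "r \<le> s" for r s
        using staircaseD(2)[OF f(1) that] staircaseD(4)[OF f(1)] that by (auto simp: g_def)
      show "1 \<le> g r" "g r \<le> v" for r
        using staircaseD(3,4)[OF f(1), of r] u by (auto simp: g_def)
    qed
    then have "x \<le> path_count (add_row j R U) g j i"
      using x le_min_count_iff[OF assms(3)] by blast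
    also have "\<dots> = path_count U f (Suc j) i + of_bool (u \<in> R)"
      unfolding path_count_add_row[OF U assms(2)] by (simp add: g_def path_count_def)
    finally show "x \<le> min_count U (Suc j) u i + of_bool (u \<in> R)" using f(2) by simp
  qed
next
  assume x: "\<forall>u. 1 \<le> u \<longrightarrow> u \<le> v \<longrightarrow> x \<le> min_count U (Suc j) u i + of_bool (u \<in> R)"
  show "x \<le> min_count (add_row j R U) j v i"
    unfolding le_min_count_iff[OF assms(3)]
  proof (intro allI impI)
    fix f assume f: "staircase v f"
    define u where "u = f (Suc j)"
    define g where "g r = min (f r) u" for r
    have "staircase u g"
    proof (rule staircaseI)
      show "g s \<le> g r" if "r \<le> s" for r s
        using staircaseD(2)[OF f that] by (auto simp: g_def min_def)
      show "1 \<le> g r" "g r \<le> u" for r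
        using staircaseD(3)[OF f] by (auto simp: g_def u_def min_def)
    qed
    then have "min_count U (Suc j) u i \<le> path_count U g (Suc j) i" by (rule min_count_le)
    also have "\<dots> = path_count U f (Suc j) i"
      unfolding path_count_def
      by (rule sum.cong) (use staircaseD(2)[OF f] in \<open>auto simp: g_def u_def min_absorb1\<close>)
    finally have "min_count U (Suc j) u i \<le> path_count U f (Suc j) i" .
    moreover have "x \<le> min_count U (Suc j) u i + of_bool (u \<in> R)"
      using x staircaseD(3,4)[OF f, of "Suc j"] by (simp add: u_def)
    ultimately show "x \<le> path_count (add_row j R U) f j i"
      unfolding path_count_add_row[OF U assms(2)] u_def by linarith
  qed
qed

text \<open>The rows up to \<open>j\<close> have been removed. The case \<open>i = j\<close> is
  included on purpose: no row is counted there, so the set is empty unless \<open>d v j = 0\<close>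
  for \<open>1 \<le> v\<close>, and at \<open>j = k\<close> unless \<open>S\<close> is empty. The
  latter is what ends the induction.\<close>

definition demand_diagrams :: "nat \<Rightarrow> nat \<Rightarrow> nat \<Rightarrow> nat \<Rightarrow> (nat \<Rightarrow> nat \<Rightarrow> nat) \<Rightarrow> cell set set" where
  "demand_diagrams n k m j d = {T. in_rows j n T \<and> (\<exists>S. finite S \<and> 0 \<notin> S \<and> card S = m \<and>
    (\<forall>v\<ge>1. card (col T v) = d v n + of_bool (v \<in> S)) \<and>
    (\<forall>v i. 1 \<le> v \<longrightarrow> j \<le> i \<longrightarrow> i \<le> n \<longrightarrow> d v i + of_bool (v \<in> S \<and> k \<le> i) \<le> min_count T j v i))}"

lemma pieri_diagrams_eq:
  assumes "a \<in> weak_comps n" "1 \<le> k" "k \<le> n"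
  shows "pieri_diagrams n m a k = demand_diagrams n k m 0 (prefix_parts a)"
proof -
  have "meets n T (pieri_demand a k S) \<longleftrightarrow>
      (\<forall>v i. 1 \<le> v \<longrightarrow> 0 \<le> i \<longrightarrow> i \<le> n \<longrightarrow>
        prefix_parts a v i + of_bool (v \<in> S \<and> k \<le> i) \<le> min_count T 0 v i)" for T S
  proof -
    have v: "1 \<le> v" if "staircase v f" for v f
      using staircaseD(3,4)[OF that, of 0] by linarith
    show ?thesis
      unfolding meets_def pieri_demand_def
    proof (intro iffI allI impI)
      fix v i :: nat
      assume "\<forall>v f i. staircase v f \<longrightarrow> i \<le> n \<longrightarrow>
          prefix_parts a v i + of_bool (v \<in> S \<and> k \<le> i) \<le> path_count T f 0 i" "1 \<le> v" "i \<le> n"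
      then show "prefix_parts a v i + of_bool (v \<in> S \<and> k \<le> i) \<le> min_count T 0 v i"
        unfolding le_min_count_iff[OF \<open>1 \<le> v\<close>] by blast
    next
      fix v f i
      assume m: "\<forall>v i. 1 \<le> v \<longrightarrow> 0 \<le> i \<longrightarrow> i \<le> n \<longrightarrow>
          prefix_parts a v i + of_bool (v \<in> S \<and> k \<le> i) \<le> min_count T 0 v i"
        and f: "staircase v f" "i \<le> n"
      have "prefix_parts a v i + of_bool (v \<in> S \<and> k \<le> i) \<le> min_count T 0 v i"
        using m v[OF f(1)] f(2) by blast
      then show "prefix_parts a v i + of_bool (v \<in> S \<and> k \<le> i) \<le> path_count T f 0 i"
        using min_count_le[OF f(1), of T 0 i] by linarith
    qed
  qed
  then show ?thesis
    unfolding set_eq_iff pieri_diagrams_iff[OF assms] demand_diagrams_def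
    using assms(3) by (simp add: pieri_demand_def)
qed

lemma row_step_min_count:
  assumes "is_demand d" "k \<le> n" "j < n" "in_rows (Suc j) n U"
  shows "row_step j k n d (min_count U (Suc j)) (\<lambda>v. card (col U v))"
proof
  have "{v. card (col U v) \<noteq> 0} \<subseteq> fst ` U"
  proof
    fix v assume "v \<in> {v. card (col U v) \<noteq> 0}"
    then have "col U v \<noteq> {}" by (auto simp del: Collect_empty_eq)
    then obtain r where "(v, r) \<in> U" by blast
    then show "v \<in> fst ` U" by force
  qed
  then show "finite {v. card (col U v) \<noteq> 0}"
    using assms(4) finite_surj unfolding in_rows_def by blast
qed (use assms min_count_antimono min_count_supermodular min_count_height in auto)

text \<open>The condition on column heights; for other \<open>R\<close> the truncated subtraction in \<open>residual\<close> or the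
  maximum with the next free column would change the total number of cells.\<close>
definition good_rows :: "nat \<Rightarrow> (nat \<Rightarrow> nat \<Rightarrow> nat) \<Rightarrow> nat set set" where
  "good_rows n d = {R. finite R \<and> 0 \<notin> R \<and> (\<forall>v\<ge>1. residual d R v n + of_bool (v \<in> R) = d v n)}"

context
  fixes n k j :: nat and d :: "nat \<Rightarrow> nat \<Rightarrow> nat"
  assumes jk: "j < k" "k \<le> n" and d: "is_demand d"
begin

lemma add_row_demand_diagrams:
  assumes U: "in_rows (Suc j) n U" and R: "finite R" "0 \<notin> R" and zero: "\<And>v. 1 \<le> v \<Longrightarrow> d v j = 0"
  shows "add_row j R U \<in> demand_diagrams n k m j d \<longleftrightarrow>
    (\<exists>S. card S = m \<and> row_step.sizes n d (\<lambda>v. card (col U v)) R S \<and>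
      row_step.start_below j k n d (min_count U (Suc j)) R S)"
proof -
  interpret row_step j k n d "min_count U (Suc j)" "\<lambda>v. card (col U v)"
    by (rule row_step_min_count) (use jk d U in auto)
  have "(\<forall>v i. 1 \<le> v \<longrightarrow> j \<le> i \<longrightarrow> i \<le> n \<longrightarrow>
      d v i + of_bool (v \<in> S \<and> k \<le> i) \<le> min_count (add_row j R U) j v i) \<longleftrightarrow> start_below R S" for S
  proof -
    let ?x = "\<lambda>v i. d v i + of_bool (v \<in> S \<and> k \<le> i)"
    have "?x v j = 0" if "1 \<le> v" for v
      using zero[OF that] jk by simp
    then have "(\<forall>v i. 1 \<le> v \<longrightarrow> j \<le> i \<longrightarrow> i \<le> n \<longrightarrow> ?x v i \<le> min_count (add_row j R U) j v i) \<longleftrightarrow>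
      (\<forall>v i. 1 \<le> v \<longrightarrow> i \<in> {j<..n} \<longrightarrow> ?x v i \<le> min_count (add_row j R U) j v i)"
      by (metis greaterThanAtMost_iff le_neq_implies_less less_imp_le zero_le)
    also have "\<dots> \<longleftrightarrow> (\<forall>v i. 1 \<le> v \<longrightarrow> i \<in> {j<..n} \<longrightarrow>
        (\<forall>u. 1 \<le> u \<longrightarrow> u \<le> v \<longrightarrow> ?x v i \<le> min_count U (Suc j) u i + of_bool (u \<in> R)))"
      by (intro all_cong1 imp_cong refl le_min_count_add_row[OF U]) auto
    also have "\<dots> \<longleftrightarrow> start_below R S"
      unfolding start_below_def using order_trans by blast
    finally show ?thesis .
  qed
  then show ?thesis
    using in_rows_add_row[OF U R] R jk card_col_add_row[OF U]
    by (auto simp: demand_diagrams_def sizes_def)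
qed

lemma residual_demand_diagrams:
  assumes U: "in_rows (Suc j) n U"
  shows "R \<in> good_rows n d \<and> U \<in> demand_diagrams n k m (Suc j) (residual d R) \<longleftrightarrow>
    (\<exists>S. card S = m \<and> row_step.sizes n d (\<lambda>v. card (col U v)) R S \<and>
      row_step.start_above j k n d (min_count U (Suc j)) R S)"
proof -
  interpret row_step j k n d "min_count U (Suc j)" "\<lambda>v. card (col U v)"
    by (rule row_step_min_count) (use jk d U in auto)
  \<comment> \<open>For \<open>v \<in> R\<close> the height of \<open>U\<close> is
    \<open>d v n - 1\<close> plus the extra cell, and it bounds the residual at \<open>n\<close>;
    the residual is never below \<open>d v n - 1\<close>. So the row takes exactly one unit.\<close>
  have good: "residual d R v n + of_bool (v \<in> R) = d v n"
    if S: "sizes R S" "start_above R S" and v: "1 \<le> v" for S v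
  proof (cases "v \<in> R")
    case True
    have "n \<in> {j<..n}" using jk by simp
    then have "residual d R v n + of_bool (v \<in> S \<and> k \<le> n) \<le> min_count U (Suc j) v n"
      using S(2) v unfolding start_above_def by blast
    then have "residual d R v n + of_bool (v \<in> S) \<le> min_count U (Suc j) v n"
      using jk by simp
    moreover have "card (col U v) + 1 = d v n + of_bool (v \<in> S)"
      using S(1) v True by (auto simp: sizes_def)
    moreover have "d v n \<le> residual d R v n + 1" by (simp add: residual_def)
    ultimately show ?thesis using min_count_height[OF U v] True by simp
  qed (simp add: residual_notin)
  show ?thesis
  proof
    assume "R \<in> good_rows n d \<and> U \<in> demand_diagrams n k m (Suc j) (residual d R)"
    then obtain S where S: "R \<in> good_rows n d" "finite S" "0 \<notin> S" "card S = m"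
      "\<forall>v\<ge>1. card (col U v) = residual d R v n + of_bool (v \<in> S)"
      "\<forall>v i. 1 \<le> v \<longrightarrow> Suc j \<le> i \<longrightarrow> i \<le> n \<longrightarrow>
        residual d R v i + of_bool (v \<in> S \<and> k \<le> i) \<le> min_count U (Suc j) v i"
      unfolding demand_diagrams_def by blast
    have "sizes R S"
      unfolding sizes_def using S(1-3,5) by (auto simp: good_rows_def)
    moreover have "start_above R S"
      unfolding start_above_def using S(6) by auto
    ultimately show "\<exists>S. card S = m \<and> sizes R S \<and> start_above R S" using S(4) by blast
  next
    assume "\<exists>S. card S = m \<and> sizes R S \<and> start_above R S"
    then obtain S where S: "card S = m" "sizes R S" "start_above R S" by blast
    note g = good[OF S(2,3)]
    have "R \<in> good_rows n d" using S(2) g by (auto simp: good_rows_def sizes_def)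
    moreover have "\<forall>v\<ge>1. card (col U v) = residual d R v n + of_bool (v \<in> S)"
    proof (intro allI impI)
      fix v :: nat assume v: "1 \<le> v"
      have "card (col U v) + of_bool (v \<in> R) = d v n + of_bool (v \<in> S)"
        using S(2) v unfolding sizes_def by blast
      then show "card (col U v) = residual d R v n + of_bool (v \<in> S)" using g[OF v] by linarith
    qed
    moreover have "\<forall>v i. 1 \<le> v \<longrightarrow> Suc j \<le> i \<longrightarrow> i \<le> n \<longrightarrow>
        residual d R v i + of_bool (v \<in> S \<and> k \<le> i) \<le> min_count U (Suc j) v i"
      using S(3) unfolding start_above_def by auto
    ultimately show "R \<in> good_rows n d \<and> U \<in> demand_diagrams n k m (Suc j) (residual d R)"
      using U S(1,2) unfolding demand_diagrams_def sizes_def by blast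
  qed
qed

end

section \<open>Weighted bijections\<close>

definition wequiv :: "'a set \<Rightarrow> ('a \<Rightarrow> 'w) \<Rightarrow> 'b set \<Rightarrow> ('b \<Rightarrow> 'w) \<Rightarrow> bool" where
  "wequiv A w B w' \<longleftrightarrow> (\<exists>f. bij_betw f A B \<and> (\<forall>x\<in>A. w' (f x) = w x))"

lemma wequivI: "bij_betw f A B \<Longrightarrow> (\<And>x. x \<in> A \<Longrightarrow> w' (f x) = w x) \<Longrightarrow> wequiv A w B w'"
  unfolding wequiv_def by blast

lemma wequiv_sym:
  assumes "wequiv A w B w'"
  shows "wequiv B w' A w"
proof -
  obtain f where f: "bij_betw f A B" "\<And>x. x \<in> A \<Longrightarrow> w' (f x) = w x"
    using assms unfolding wequiv_def by blast
  show ?thesis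
  proof (rule wequivI[OF bij_betw_inv_into[OF f(1)]])
    fix y assume "y \<in> B"
    then show "w (inv_into A f y) = w' y"
      using f(2)[OF bij_betwE[OF bij_betw_inv_into[OF f(1)], rule_format, of y]]
        bij_betw_inv_into_right[OF f(1)] by simp
  qed
qed

lemma wequiv_trans:
  assumes "wequiv A w B w'" "wequiv B w' C w''"
  shows "wequiv A w C w''"
proof -
  obtain f where f: "bij_betw f A B" "\<And>x. x \<in> A \<Longrightarrow> w' (f x) = w x"
    using assms(1) unfolding wequiv_def by blast
  obtain g where g: "bij_betw g B C" "\<And>x. x \<in> B \<Longrightarrow> w'' (g x) = w' x"
    using assms(2) unfolding wequiv_def by blast
  show ?thesis
    by (rule wequivI[OF bij_betw_trans[OF f(1) g(1)]]) (use f g bij_betwE in fastforce)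
qed

lemma wequiv_cong:
  assumes "wequiv A w B w'" "\<And>x. x \<in> A \<Longrightarrow> v x = w x" "\<And>x. x \<in> B \<Longrightarrow> v' x = w' x"
  shows "wequiv A v B v'"
proof -
  obtain f where f: "bij_betw f A B" "\<And>x. x \<in> A \<Longrightarrow> w' (f x) = w x"
    using assms(1) unfolding wequiv_def by blast
  show ?thesis
    by (rule wequivI[OF f(1)]) (use f(2) assms(2,3) bij_betwE[OF f(1)] in simp)
qed

lemma wequiv_empty: "wequiv {} w {} w'"
  by (simp add: wequiv_def bij_betw_def)

lemma wequiv_weight_map: "wequiv A w B w' \<Longrightarrow> wequiv A (\<lambda>x. h (w x)) B (\<lambda>x. h (w' x))"
  unfolding wequiv_def by metis

lemma wequiv_Sigma:
  assumes "\<And>i. i \<in> I \<Longrightarrow> wequiv (A i) (w i) (B i) (w' i)"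
  shows "wequiv (Sigma I A) (\<lambda>(i, x). w i x) (Sigma I B) (\<lambda>(i, x). w' i x)"
proof -
  obtain f where f: "\<And>i. i \<in> I \<Longrightarrow> bij_betw (f i) (A i) (B i)"
    "\<And>i x. i \<in> I \<Longrightarrow> x \<in> A i \<Longrightarrow> w' i (f i x) = w i x"
    using assms unfolding wequiv_def by metis
  have "bij_betw (\<lambda>(i, x). (i, f i x)) (Sigma I A) (Sigma I B)"
    unfolding bij_betw_def
  proof
    show "inj_on (\<lambda>(i, x). (i, f i x)) (Sigma I A)"
      using f(1) by (auto simp: inj_on_def bij_betw_def)
    show "(\<lambda>(i, x). (i, f i x)) ` Sigma I A = Sigma I B"
    proof (intro subset_antisym subsetI)
      fix y assume "y \<in> Sigma I B"
      then obtain i b where y: "y = (i, b)" "i \<in> I" "b \<in> B i" by blast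
      have "b \<in> f i ` A i"
        unfolding bij_betw_imp_surj_on[OF f(1)[OF y(2)]] by (rule y(3))
      then obtain x where "b = f i x" "x \<in> A i" by (rule imageE)
      then show "y \<in> (\<lambda>(i, x). (i, f i x)) ` Sigma I A"
        using y by (intro image_eqI[of _ _ "(i, x)"]) auto
    next
      fix y assume "y \<in> (\<lambda>(i, x). (i, f i x)) ` Sigma I A"
      then obtain i x where "y = (i, f i x)" "i \<in> I" "x \<in> A i" by auto
      then show "y \<in> Sigma I B" using bij_betwE[OF f(1)] by simp
    qed
  qed
  then show ?thesis by (rule wequivI) (use f(2) in auto)
qed

lemma wequiv_Times:
  assumes "wequiv A w B w'"
  shows "wequiv (A \<times> X) (\<lambda>(x, y). h (w x) y) (B \<times> X) (\<lambda>(x, y). h (w' x) y)"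
proof -
  obtain f where f: "bij_betw f A B" "\<And>x. x \<in> A \<Longrightarrow> w' (f x) = w x"
    using assms unfolding wequiv_def by blast
  show ?thesis
    by (rule wequivI[OF bij_betw_map_prod[OF f(1) bij_betw_id]]) (use f(2) in auto)
qed

text \<open>Exponent vectors of the monomials of the complete homogeneous polynomial of degree \<open>m\<close> in the
  variables with indices \<open>j + 1, \<dots>, k\<close>.\<close>
definition exponents :: "nat \<Rightarrow> nat \<Rightarrow> nat \<Rightarrow> (nat \<Rightarrow> nat) set" where
  "exponents m j k = {\<mu>. (\<forall>i. i \<notin> {j<..k} \<longrightarrow> \<mu> i = 0) \<and> sum \<mu> {j<..k} = m}"

lemma exponents_split:
  assumes "j < k"
  shows "wequiv (SIGMA t:{..m}. exponents (m - t) (Suc j) k) (\<lambda>(t, \<mu>). single_part t (Suc j) + \<mu>)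
    (exponents m j k) (\<lambda>\<mu>. \<mu>)"
proof (rule wequivI)
  have set: "{j<..k} = insert (Suc j) {Suc j<..k}" using assms by auto
  show "bij_betw (\<lambda>(t, \<mu>). single_part t (Suc j) + \<mu>) (SIGMA t:{..m}. exponents (m - t) (Suc j) k)
      (exponents m j k)"
  proof (rule bij_betwI[where g = "\<lambda>\<mu>. (\<mu> (Suc j), \<mu>(Suc j := 0))"])
    show "(\<lambda>(t, \<mu>). single_part t (Suc j) + \<mu>) \<in>
        (SIGMA t:{..m}. exponents (m - t) (Suc j) k) \<rightarrow> exponents m j k"
      unfolding exponents_def set by (auto simp: single_part_def sum.distrib)
    show "(\<lambda>\<mu>. (\<mu> (Suc j), \<mu>(Suc j := 0))) \<in>
        exponents m j k \<rightarrow> (SIGMA t:{..m}. exponents (m - t) (Suc j) k)"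
      unfolding exponents_def set by auto
  qed (auto simp: exponents_def single_part_def fun_eq_iff)
qed auto

lemma single_part_add: "single_part (x + y) i = single_part x i + single_part y i"
  by (auto simp: single_part_def fun_eq_iff)

lemma in_rows_demand_diagrams: "T \<in> demand_diagrams n k m j d \<Longrightarrow> in_rows j n T"
  by (simp add: demand_diagrams_def)

abbreviation residual_pairs ::
    "nat \<Rightarrow> nat \<Rightarrow> nat \<Rightarrow> (nat \<Rightarrow> nat \<Rightarrow> nat) \<Rightarrow> nat \<Rightarrow> (nat set \<times> cell set) set" where
  "residual_pairs n k j d m \<equiv> (SIGMA R:good_rows n d. demand_diagrams n k m (Suc j) (residual d R))"

text \<open>\<open>row_bij\<close> is applied to each upper diagram \<open>U\<close> separately and
  leaves \<open>U\<close> unchanged; the bijections are glued along the decomposition of a diagram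
  into its lowest row and the rest.\<close>

lemma demand_diagrams_split_row:
  assumes jk: "j < k" "k \<le> n" and d: "is_demand d" and zero: "\<And>v. 1 \<le> v \<Longrightarrow> d v j = 0"
  shows "wequiv (SIGMA t:{..m}. residual_pairs n k j d (m - t))
    (\<lambda>(t, R, U). single_part (card R + t) (Suc j) + wt U) (demand_diagrams n k m j d) wt"
proof -
  define E where "E U t = {R \<in> good_rows n d. U \<in> demand_diagrams n k (m - t) (Suc j) (residual d R)}" for U t
  define V where "V U = {R. finite R \<and> 0 \<notin> R \<and> add_row j R U \<in> demand_diagrams n k m j d}" for U
  have "\<exists>g. bij_betw g (SIGMA t:{..m}. E U t) (V U) \<and> (\<forall>t R. t \<le> m \<longrightarrow> R \<in> E U t \<longrightarrow> card (g (t, R)) = card R + t)"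
    if U: "in_rows (Suc j) n U" for U
  proof -
    interpret row_step j k n d "min_count U (Suc j)" "\<lambda>v. card (col U v)"
      by (rule row_step_min_count) (use jk d U in auto)
    have E: "E U t = {R. \<exists>S. card S = m - t \<and> sizes R S \<and> start_above R S}" for t
      unfolding E_def using residual_demand_diagrams[OF jk d U] by blast
    have V: "V U = {R. \<exists>S. card S = m \<and> sizes R S \<and> start_below R S}"
    proof (intro set_eqI iffI)
      fix R assume "R \<in> V U"
      then show "R \<in> {R. \<exists>S. card S = m \<and> sizes R S \<and> start_below R S}"
        unfolding V_def using add_row_demand_diagrams[OF jk d U _ _ zero, of R m] by blast
    next
      fix R assume R: "R \<in> {R. \<exists>S. card S = m \<and> sizes R S \<and> start_below R S}"
      then have "finite R" "0 \<notin> R" unfolding sizes_def by blast+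
      then show "R \<in> V U"
        using R unfolding V_def using add_row_demand_diagrams[OF jk d U _ _ zero, of R m] by blast
    qed
    obtain g where g: "bij_betw g (SIGMA t:{..m}. {R. \<exists>S. card S = m - t \<and> sizes R S \<and> start_above R S})
        {R. \<exists>S. card S = m \<and> sizes R S \<and> start_below R S}"
      "\<forall>t R S. t \<le> m \<longrightarrow> card S = m - t \<longrightarrow> sizes R S \<longrightarrow> start_above R S \<longrightarrow> card (g (t, R)) = card R + t"
      using row_bij by blast
    show ?thesis
      unfolding E V by (rule exI[of _ g]) (use g in blast)
  qed
  then obtain g where g: "\<And>U. in_rows (Suc j) n U \<Longrightarrow> bij_betw (g U) (SIGMA t:{..m}. E U t) (V U)"
    "\<And>U t R. in_rows (Suc j) n U \<Longrightarrow> t \<le> m \<Longrightarrow> R \<in> E U t \<Longrightarrow> card (g U (t, R)) = card R + t"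
    by metis
  define F where "F = (\<lambda>(t, R, U). add_row j (g U (t, R)) U)"
  have mem: "t \<le> m" "in_rows (Suc j) n U" "(t, R) \<in> (SIGMA t:{..m}. E U t)"
    if "(t, R, U) \<in> (SIGMA t:{..m}. residual_pairs n k j d (m - t))" for t R U
    using that in_rows_demand_diagrams by (auto simp: E_def)
  show ?thesis
  proof (rule wequivI[of F])
    show "bij_betw F (SIGMA t:{..m}. residual_pairs n k j d (m - t)) (demand_diagrams n k m j d)"
      unfolding bij_betw_def
    proof
      show "inj_on F (SIGMA t:{..m}. residual_pairs n k j d (m - t))"
      proof (rule inj_onI)
        fix x y assume x: "x \<in> (SIGMA t:{..m}. residual_pairs n k j d (m - t))"
          and y: "y \<in> (SIGMA t:{..m}. residual_pairs n k j d (m - t))" and eq: "F x = F y"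
        obtain t R U where x': "x = (t, R, U)" by (cases x)
        obtain s Q W where y': "y = (s, Q, W)" by (cases y)
        note mx = mem[OF x[unfolded x']] and my = mem[OF y[unfolded y']]
        have "g U (t, R) = g W (s, Q)" "U = W"
          using eq add_row_inject[OF mx(2) my(2)] by (auto simp: F_def x' y')
        then have "(t, R) = (s, Q)"
          using inj_onD[OF bij_betw_imp_inj_on[OF g(1)[OF mx(2)]]] mx(3) my(3) by blast
        then show "x = y" using \<open>U = W\<close> by (simp add: x' y')
      qed
      show "F ` (SIGMA t:{..m}. residual_pairs n k j d (m - t)) = demand_diagrams n k m j d"
      proof (intro subset_antisym subsetI)
        fix T assume "T \<in> F ` (SIGMA t:{..m}. residual_pairs n k j d (m - t))"
        then obtain t R U where x: "(t, R, U) \<in> (SIGMA t:{..m}. residual_pairs n k j d (m - t))"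
          and T: "T = add_row j (g U (t, R)) U" unfolding F_def by blast
        have "g U (t, R) \<in> V U"
          using bij_betwE[OF g(1)[OF mem(2)[OF x]]] mem(3)[OF x] by blast
        then show "T \<in> demand_diagrams n k m j d" by (simp add: V_def T)
      next
        fix T assume T: "T \<in> demand_diagrams n k m j d"
        obtain R' U where T': "T = add_row j R' U" and R': "finite R'" "0 \<notin> R'"
          and U: "in_rows (Suc j) n U"
          using add_row_cases[OF in_rows_demand_diagrams[OF T]] by blast
        have "R' \<in> V U" using T R' by (simp add: V_def T')
        then have "R' \<in> g U ` (SIGMA t:{..m}. E U t)"
          unfolding bij_betw_imp_surj_on[OF g(1)[OF U]] .
        then obtain t R where tR: "R' = g U (t, R)" "t \<le> m" "R \<in> E U t" by blast
        then have "(t, R, U) \<in> (SIGMA t:{..m}. residual_pairs n k j d (m - t))"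
          by (simp add: E_def)
        from imageI[OF this, of F] show "T \<in> F ` (SIGMA t:{..m}. residual_pairs n k j d (m - t))"
          by (simp add: F_def T' tR(1))
      qed
    qed
  next
    fix x assume x: "x \<in> (SIGMA t:{..m}. residual_pairs n k j d (m - t))"
    obtain t R U where x': "x = (t, R, U)" by (cases x)
    note mx = mem[OF x[unfolded x']]
    have "card (g U (t, R)) = card R + t"
      using g(2)[OF mx(2,1), of R] mx(3) by blast
    then show "wt (F x) = (case x of (t, R, U) \<Rightarrow> single_part (card R + t) (Suc j) + wt U)"
      by (simp add: F_def x' wt_add_row[OF mx(2)])
  qed
qed

lemma demand_diagrams_no_columns:
  assumes "1 \<le> v" "0 < d v j + of_bool (v \<in> S \<and> k \<le> j)"
  shows "\<not> d v j + of_bool (v \<in> S \<and> k \<le> j) \<le> min_count T j v j"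
  using min_count_le[OF staircase_const[OF assms(1) order_refl], of T j j] assms(2)
  by (simp add: path_count_def)

text \<open>The demand varies in the induction, since the hypothesis is applied to
  \<open>residual d R\<close> for every row \<open>R\<close>.\<close>

lemma demand_diagrams_product:
  assumes "j \<le> k" "k \<le> n" "is_demand d"
  shows "wequiv (demand_diagrams n k 0 j d \<times> exponents m j k) (\<lambda>(T, \<mu>). wt T + \<mu>)
    (demand_diagrams n k m j d) wt"
  using assms
proof (induction j arbitrary: d m rule: inc_induct)
  case base
  show ?case
  proof (cases "m = 0")
    case True
    have "exponents 0 k k = {0}" by (auto simp: exponents_def fun_eq_iff)
    then show ?thesis
      unfolding True by (intro wequivI[of fst]) (auto simp: bij_betw_def inj_on_def image_iff)
  next
    case False
    have "exponents m k k = {}" using False by (auto simp: exponents_def)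
    moreover have "demand_diagrams n k m k d = {}"
    proof (rule ccontr)
      assume "demand_diagrams n k m k d \<noteq> {}"
      then obtain T where "T \<in> demand_diagrams n k m k d" by blast
      then obtain S where S: "0 \<notin> S" "card S = m"
        "\<forall>v i. 1 \<le> v \<longrightarrow> k \<le> i \<longrightarrow> i \<le> n \<longrightarrow> d v i + of_bool (v \<in> S \<and> k \<le> i) \<le> min_count T k v i"
        unfolding demand_diagrams_def by blast
      obtain v where v: "v \<in> S" using S(2) False by fastforce
      then have "1 \<le> v" using S(1) by (cases v) auto
      then show False
        using S(3)[rule_format, OF _ order_refl base(1), of v]
          demand_diagrams_no_columns[of v d k S k T] v by auto
    qed
    ultimately show ?thesis by (simp add: wequiv_empty)
  qed
next
  case (step j)
  note jk = step.hyps(2) step.prems(1) and d = step.prems(2)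
  let ?D = "\<lambda>m. demand_diagrams n k m j d" and ?P = "residual_pairs n k j d"
  let ?D' = "\<lambda>m R. demand_diagrams n k m (Suc j) (residual d R)"
  let ?X = "\<lambda>m. exponents m (Suc j) k"
  let ?s = "\<lambda>t. single_part t (Suc j)"
  let ?w = "\<lambda>(R, U). ?s (card R) + wt U"
  show ?case
  proof (cases "\<forall>v\<ge>1. d v j = 0")
    case False
    then obtain v where v: "1 \<le> v" "0 < d v j" by auto
    have "?D m = {}" for m
      unfolding demand_diagrams_def
      using demand_diagrams_no_columns[of v d j _ k] v jk by (fastforce simp del: of_bool_eq_1_iff)
    then show ?thesis by (simp add: wequiv_empty)
  next
    case True
    then have zero: "\<And>v. 1 \<le> v \<Longrightarrow> d v j = 0" by blast
    note split = demand_diagrams_split_row[OF jk d zero]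
    \<comment> \<open>The case \<open>m = 0\<close> of the splitting, where only
      \<open>t = 0\<close> occurs; it returns from residual pairs to \<open>d\<close>
      itself.\<close>
    have D0: "wequiv (?D 0) wt (?P 0) ?w"
    proof -
      have "wequiv (?P 0) ?w (SIGMA t:{..0}. ?P (0 - t)) (\<lambda>(t, R, U). ?s (card R + t) + wt U)"
        by (rule wequivI[of "\<lambda>x. (0, x)"]) (auto simp: bij_betw_def inj_on_def)
      then show ?thesis using wequiv_sym wequiv_trans split by blast
    qed
    \<comment> \<open>\<open>good_rows n d\<close> depends on neither \<open>m\<close> nor the
      diagram above, so the induction hypothesis can be used for each \<open>R\<close> and the
      exponent vectors factored out of the sum over \<open>R\<close>.\<close>
    have P: "wequiv (?D 0 \<times> ?X m) (\<lambda>(T, \<mu>). wt T + \<mu>) (?P m) ?w" for m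
    proof -
      have "wequiv (?P 0 \<times> ?X m) (\<lambda>(x, \<mu>). ?w x + \<mu>)
          (SIGMA R:good_rows n d. ?D' 0 R \<times> ?X m) (\<lambda>(R, T, \<mu>). ?s (card R) + (wt T + \<mu>))"
        by (rule wequivI[of "\<lambda>((R, T), \<mu>). (R, T, \<mu>)"], rule bij_betwI[where g = "\<lambda>(R, T, \<mu>). ((R, T), \<mu>)"])
          (auto simp: add.assoc)
      moreover have "wequiv (SIGMA R:good_rows n d. ?D' 0 R \<times> ?X m) (\<lambda>(R, T, \<mu>). ?s (card R) + (wt T + \<mu>))
          (SIGMA R:good_rows n d. ?D' m R) ?w"
      proof (rule wequiv_Sigma)
        fix R assume "R \<in> good_rows n d"
        then have "is_demand (residual d R)"
          using is_demand_residual[OF d] by (simp add: good_rows_def)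
        from wequiv_weight_map[OF step.IH[OF jk(2) this, of m], of "(+) (?s (card R))"]
        show "wequiv (?D' 0 R \<times> ?X m) (\<lambda>(T, \<mu>). ?s (card R) + (wt T + \<mu>)) (?D' m R) (\<lambda>U. ?s (card R) + wt U)"
          by (rule wequiv_cong) auto
      qed
      ultimately have "wequiv (?P 0 \<times> ?X m) (\<lambda>(x, \<mu>). ?w x + \<mu>) (?P m) ?w"
        by (rule wequiv_trans)
      with wequiv_Times[OF D0, where h = "(+)" and X = "?X m"] show ?thesis
        by (rule wequiv_trans)
    qed
    have 1: "wequiv (?D 0 \<times> exponents m j k) (\<lambda>(T, \<mu>). wt T + \<mu>)
        (?D 0 \<times> (SIGMA t:{..m}. ?X (m - t))) (\<lambda>(T, x). wt T + (\<lambda>(t, \<mu>). ?s t + \<mu>) x)"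
    proof (rule wequiv_Sigma)
      fix T :: "cell set"
      from wequiv_weight_map[OF wequiv_sym[OF exponents_split[OF jk(1), of m]], of "(+) (wt T)"]
      show "wequiv (exponents m j k) (\<lambda>\<mu>. wt T + \<mu>)
          (SIGMA t:{..m}. ?X (m - t)) (\<lambda>x. wt T + (\<lambda>(t, \<mu>). ?s t + \<mu>) x)"
        by (rule wequiv_cong) auto
    qed
    have 2: "wequiv (?D 0 \<times> (SIGMA t:{..m}. ?X (m - t))) (\<lambda>(T, x). wt T + (\<lambda>(t, \<mu>). ?s t + \<mu>) x)
        (SIGMA t:{..m}. ?D 0 \<times> ?X (m - t)) (\<lambda>(t, T, \<mu>). ?s t + (wt T + \<mu>))"
      by (rule wequivI[of "\<lambda>(T, t, \<mu>). (t, T, \<mu>)"], rule bij_betwI[where g = "\<lambda>(t, T, \<mu>). (T, t, \<mu>)"])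
        (auto simp: ac_simps)
    have 3: "wequiv (SIGMA t:{..m}. ?D 0 \<times> ?X (m - t)) (\<lambda>(t, T, \<mu>). ?s t + (wt T + \<mu>))
        (SIGMA t:{..m}. ?P (m - t)) (\<lambda>(t, x). ?s t + ?w x)"
    proof (rule wequiv_Sigma)
      fix t
      from wequiv_weight_map[OF P[of "m - t"], of "(+) (?s t)"]
      show "wequiv (?D 0 \<times> ?X (m - t)) (\<lambda>(T, \<mu>). ?s t + (wt T + \<mu>)) (?P (m - t)) (\<lambda>x. ?s t + ?w x)"
        by (rule wequiv_cong) auto
    qed
    have 4: "wequiv (SIGMA t:{..m}. ?P (m - t)) (\<lambda>(t, x). ?s t + ?w x) (?D m) wt"
      by (rule wequiv_cong[OF split]) (auto simp: single_part_add ac_simps)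
    show ?thesis
      by (rule wequiv_trans[OF 1 wequiv_trans[OF 2 wequiv_trans[OF 3 4]]])
  qed
qed

section \<open>The demand of a composition and the one-part case\<close>

lemma is_demand_prefix_parts:
  assumes "a \<in> weak_comps n"
  shows "is_demand (prefix_parts a)"
proof -
  define N where "N = Suc (Max (a ` {0..n}))"
  have "a l < N" for l
  proof (cases "l \<in> {1..n}")
    case True
    then show ?thesis by (auto simp: N_def less_Suc_eq_le intro: Max_ge)
  qed (use assms in \<open>auto simp: weak_comps_def N_def\<close>)
  then have "\<not> v \<le> a l" if "N \<le> v" for v l using that by (meson leD le_trans)
  then have "\<forall>v\<ge>N. \<forall>i. prefix_parts a v i = 0"
    by (simp add: prefix_parts_def)
  then show ?thesis
    using prefix_parts_antimono prefix_parts_supermodular unfolding is_demand_def by blast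
qed

text \<open>With zero demand the set \<open>S\<close> is forced to be \<open>{1..m}\<close>, and the
  raised demand is then the prefix count of \<open>single_part m k\<close>.\<close>

lemma KD_single_part:
  assumes "1 \<le> k" "k \<le> n"
  shows "KD (single_part m k) = demand_diagrams n k m 0 (\<lambda>_ _. 0)"
proof -
  have s: "single_part m k \<in> weak_comps n"
    using assms by (simp add: weak_comps_def single_part_def)
  have parts: "prefix_parts (single_part m k) v i = of_bool (v \<in> {1..m} \<and> k \<le> i)" if "1 \<le> v" for v i
    by (induction i) (use that assms in \<open>auto simp: single_part_def le_Suc_eq\<close>)
  have "T \<in> demand_diagrams n k 0 0 (prefix_parts (single_part m k)) \<longleftrightarrow> in_rows 0 n T \<and>
      (\<forall>v\<ge>1. card (col T v) = of_bool (v \<in> {1..m})) \<and>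
      (\<forall>v i. 1 \<le> v \<longrightarrow> i \<le> n \<longrightarrow> of_bool (v \<in> {1..m} \<and> k \<le> i) \<le> min_count T 0 v i)" for T
    unfolding demand_diagrams_def using parts assms(2) by auto
  moreover have "T \<in> demand_diagrams n k m 0 (\<lambda>_ _. 0) \<longleftrightarrow> in_rows 0 n T \<and>
      (\<forall>v\<ge>1. card (col T v) = of_bool (v \<in> {1..m})) \<and>
      (\<forall>v i. 1 \<le> v \<longrightarrow> i \<le> n \<longrightarrow> of_bool (v \<in> {1..m} \<and> k \<le> i) \<le> min_count T 0 v i)" (is "?l \<longleftrightarrow> ?r") for T
  proof
    assume ?r
    then show ?l
      unfolding demand_diagrams_def by (intro CollectI conjI exI[of _ "{1..m}"]) auto
  next
    assume ?l
    then obtain S where T: "in_rows 0 n T" and S: "finite S" "0 \<notin> S" "card S = m"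
      "\<And>v. 1 \<le> v \<Longrightarrow> card (col T v) = of_bool (v \<in> S)"
      "\<And>v i. 1 \<le> v \<Longrightarrow> i \<le> n \<Longrightarrow> of_bool (v \<in> S \<and> k \<le> i) \<le> min_count T 0 v i"
      by (auto simp: demand_diagrams_def)
    \<comment> \<open>Minimal path counts decrease with the bound, so a demand in column
      \<open>v\<close> puts a cell into every column \<open>u \<le> v\<close>.\<close>
    have down: "u \<in> S" if "v \<in> S" "1 \<le> u" "u \<le> v" for u v
    proof -
      have "1 \<le> v" using that by simp
      then have "1 \<le> min_count T 0 v n" using S(5)[of v n] that(1) assms(2) by simp
      also have "\<dots> \<le> min_count T 0 u n" using min_count_antimono[OF that(2,3)] .
      also have "\<dots> \<le> card (col T u)" using min_count_height[OF T that(2)] .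
      finally show ?thesis using S(4)[OF that(2)] by (cases "u \<in> S") auto
    qed
    have "S = {1..m}"
    proof (cases "S = {}")
      case False
      have "S = {1..Max S}"
        using Max_in[OF S(1) False] Max_ge[OF S(1)] down[of "Max S"] S(2)
        by (auto simp: Suc_le_eq intro: gr0I)
      then show ?thesis using S(3) by (metis card_atLeastAtMost diff_Suc_1)
    qed (use S in simp)
    then show ?r using T S by simp
  qed
  ultimately show ?thesis
    unfolding KD_eq_pieri_diagrams[OF s, of k] pieri_diagrams_eq[OF s assms] by blast
qed

text \<open>The product theorem for zero demand: its first factor consists of the empty diagram
  alone, so the monomials are identified with the second factor of the claim without describing its
  diagrams.\<close>

lemma wequiv_exponents_KD:
  assumes "1 \<le> k" "k \<le> n"
  shows "wequiv (exponents m 0 k) (\<lambda>\<mu>. \<mu>) (KD (single_part m k)) wt"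
proof -
  have "demand_diagrams n k 0 0 (\<lambda>_ _. 0) = KD (single_part 0 k)"
    using KD_single_part[OF assms, of 0] by simp
  also have "\<dots> = {{}}"
  proof -
    have "T = {}" if "kohnert_move\<^sup>*\<^sup>* {} T" for T
      using that by (induction rule: rtranclp_induct) (auto simp: kohnert_move_def)
    moreover have "key_diagram (single_part 0 k) = {}" by (auto simp: key_diagram_def single_part_def)
    ultimately show ?thesis by (auto simp: KD_def)
  qed
  finally have D: "demand_diagrams n k 0 0 (\<lambda>_ _. 0) = {{}}" .
  have "wequiv (exponents m 0 k) (\<lambda>\<mu>. \<mu>) ({{}} \<times> exponents m 0 k) (\<lambda>(T, \<mu>). wt T + \<mu>)"
    by (rule wequivI[of "\<lambda>\<mu>. ({}, \<mu>)"]) (auto simp: bij_betw_def inj_on_def wt_def fun_eq_iff)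
  moreover have "is_demand (\<lambda>_ _. 0)" by (simp add: is_demand_def)
  then have "wequiv ({{}} \<times> exponents m 0 k) (\<lambda>(T, \<mu>). wt T + \<mu>) (KD (single_part m k)) wt"
    using demand_diagrams_product[of 0 k n "\<lambda>_ _. 0" m] assms
    unfolding D KD_single_part[OF assms] by simp
  ultimately show ?thesis by (rule wequiv_trans)
qed

theorem theorem6p1p5:
  fixes a :: "nat \<Rightarrow> nat" and n k m :: nat
  assumes "a \<in> weak_comps n" and "1 \<le> k" and "k \<le> n" and "1 \<le> m"
  shows "\<exists>f. bij_betw f (KD a \<times> KD (single_part m k)) (pieri_diagrams n m a k) \<and>
             (\<forall>S \<in> KD a. \<forall>T \<in> KD (single_part m k). wt (f (S, T)) = wt S + wt T)"
proof -
  have "wequiv (KD a \<times> KD (single_part m k)) (\<lambda>(S, T). wt S + wt T)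
      (KD a \<times> exponents m 0 k) (\<lambda>(S, \<mu>). wt S + \<mu>)"
  proof (rule wequiv_Sigma)
    fix S :: "cell set"
    from wequiv_weight_map[OF wequiv_sym[OF wequiv_exponents_KD[OF assms(2,3), of m]], of "(+) (wt S)"]
    show "wequiv (KD (single_part m k)) (\<lambda>T. wt S + wt T) (exponents m 0 k) (\<lambda>\<mu>. wt S + \<mu>)"
      by (rule wequiv_cong) auto
  qed
  moreover have "wequiv (KD a \<times> exponents m 0 k) (\<lambda>(S, \<mu>). wt S + \<mu>) (pieri_diagrams n m a k) wt"
    using demand_diagrams_product[OF _ assms(3) is_demand_prefix_parts[OF assms(1)], of 0 m]
    unfolding KD_eq_pieri_diagrams[OF assms(1), of k] pieri_diagrams_eq[OF assms(1-3)] by simp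
  ultimately have "wequiv (KD a \<times> KD (single_part m k)) (\<lambda>(S, T). wt S + wt T) (pieri_diagrams n m a k) wt"
    by (rule wequiv_trans)
  then show ?thesis
    unfolding wequiv_def by auto
qed

end
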